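(* Let $\tau$ be a (possibly killed) subordinator, not identically zero, with Laplace exponent $\Phi$, and let $G(t)$ be its undershoot at level $t$. Let $\alpha\in(0,1)$ and $\hat{\alpha}=1-\alpha$. Let $\ell:(0,\infty)\to(0,\infty)$ be slowly varying at $0+$, and suppose $\varepsilon:(0,\infty)\to(0,1)$ satisfies $\varepsilon(t)\to 0$ as $t\to0+$. Then the following statements hold. (1) Assume $\Phi(\lambda)\sim \lambda^\alpha \ell(1/\lambda)$ as $\lambda\to\infty$. Then $$\mathbb{P}\bigg(\frac{G(t)}{t}\leq \varepsilon(t)\bigg)\sim\frac{\sin(\pi\alpha)}{\pi\alpha}\,\frac{\ell(t)}{\ell(\varepsilon(t)t)}\,\varepsilon(t)^\alpha,\qquad t\to0+.$$ Suppose additionally that $\tau$ is special. Then $$\mathbb{P}\bigg(\frac{G(t)}{t}\geq 1-\varepsilon(t)\bigg)\sim\frac{\sin(\pi\hat{\alpha})}{\pi\hat{\alpha}}\,\frac{\ell(\varepsilon(t)t)}{\ell(t)}\,\varepsilon(t)^{\hat{\alpha}},\qquad t\to0+.$$ (2) Assume $\Phi(\lambda)\asymp \lambda^\alpha \ell(1/\lambda)$ as $\lambda\to\infty$. Then $$\mathbb{P}\bigg(\frac{G(t)}{t}\leq \varepsilon(t)\bigg)\asymp\frac{\ell(t)}{\ell(\varepsilon(t)t)}\,\varepsilon(t)^\alpha,\qquad t\to0+.$$ Suppose additionally that $\tau$ is special. Then $$\mathbb{P}\bigg(\frac{G(t)}{t}\geq 1-\varepsilon(t)\bigg)\asymp\frac{\ell(\varepsilon(t)t)}{\ell(t)}\,\varepsilon(t)^{\hat{\alpha}},\qquad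 t\to0+.$$
   Context: Asymptotic notation: $f(x)\sim g(x)$ as $x\to a$ means $f(x)/g(x)\to1$. For non-negative $f,g$, $f(x)\asymp g(x)$ as $x\to a$ means that there are constants $0<C_1\le C_2<\infty$ with $C_1f(x)\le g(x)\le C_2f(x)$ for all $x$ in some neighborhood of $a$. A positive measurable function $\ell$ is slowly varying at $0+$ if $\ell(\lambda x)/\ell(x)\to1$ as $x\to0+$ for every $\lambda>0$. Subordinators: a (killed) subordinator $\tau=(\tau(s))_{s\ge0}$, defined on a probability space $(\Omega,\mathcal F,\mathbb P)$, is a non-negative Lévy process killed (sent to the cemetery point $\infty$) at an independent exponential random time (possibly never killed). Its Laplace exponent $\Phi:(0,\infty)\to[0,\infty)$ is defined by $\mathbb{E}\exp(-\lambda\tau(s))=\exp(-\Phi(\lambda)s)$, $\lambda,s>0$ (with $\exp(-\infty)=0$). "Not identically zero" means $\Phi\neq0$. Undershoot: $L(t)=\inf\{s\ge0: \tau(s)\in(t,\infty]\}$ and $G(t)=\tau(L(t)-)$, $t\ge0$; almost surely $G(t)=\sup\{\tau(s): s\ge0,\ \tau(s)\le t\}$. Special: a Bernstein function is an infinitely differentiable $\Phi:(0,\infty)\to[0,\infty)$ with $(-d/d\lambda)^n\Phi(\lambda)\le0$ for all integers $n\ge1$ and all $\lambda>0$. A Bernstein function $\Phi\ne0$ is special if $\lambda/\Phi(\lambda)$ is also a Bernstein function. The subordinator $\tau$ is special if its Laplace exponent $\Phi$ is special. *)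

theory Defs
  imports "HOL-Probability.Probability" "HOL-Library.Landau_Symbols"
begin

text \<open>
  The time set is \<open>[0, \<infinity>)\<close>: processes are indexed by \<^typ>\<open>real\<close>, and no condition is imposed on
  their values at negative times.  Likewise functions on \<open>(0, \<infinity>)\<close> are total functions of which only
  the values at positive arguments matter.
\<close>

definition slowly_varying_at_0 :: "(real \<Rightarrow> real) \<Rightarrow> bool" where
  "slowly_varying_at_0 l \<longleftrightarrow>
     (\<forall>x>0. 0 < l x) \<and> l \<in> borel_measurable (restrict_space borel {0<..}) \<and>
     (\<forall>c>0. ((\<lambda>x. l (c * x) / l x) \<longlongrightarrow> 1) (at_right 0))"

definition same_order :: "'a filter \<Rightarrow> ('a \<Rightarrow> real) \<Rightarrow> ('a \<Rightarrow> real) \<Rightarrow> bool" where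
  "same_order F f g \<longleftrightarrow>
     (\<exists>C\<^sub>1 C\<^sub>2. 0 < C\<^sub>1 \<and> C\<^sub>1 \<le> C\<^sub>2 \<and> (\<forall>\<^sub>F x in F. C\<^sub>1 * f x \<le> g x \<and> g x \<le> C\<^sub>2 * f x))"

definition bernstein :: "(real \<Rightarrow> real) \<Rightarrow> bool" where
  "bernstein f \<longleftrightarrow>
     (\<forall>x>0. 0 \<le> f x) \<and>
     (\<forall>n. \<forall>x>0. (deriv ^^ n) f differentiable (at x)) \<and>
     (\<forall>n\<ge>1. \<forall>x>0. (-1) ^ n * (deriv ^^ n) f x \<le> 0)"

definition special_bernstein :: "(real \<Rightarrow> real) \<Rightarrow> bool" where
  "special_bernstein f \<longleftrightarrow>
     bernstein f \<and> (\<exists>x>0. f x \<noteq> 0) \<and> bernstein (\<lambda>x. x / f x)"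

definition cadlag :: "(real \<Rightarrow> real) \<Rightarrow> bool" where
  "cadlag x \<longleftrightarrow>
     (\<forall>s\<ge>0. continuous (at_right s) x) \<and> (\<forall>s>0. \<exists>y. (x \<longlongrightarrow> y) (at_left s))"

definition levy_process :: "'w measure \<Rightarrow> (real \<Rightarrow> 'w \<Rightarrow> real) \<Rightarrow> bool" where
  "levy_process M X \<longleftrightarrow>
     prob_space M \<and>
     (\<forall>s\<ge>0. X s \<in> borel_measurable M) \<and>
     (AE \<omega> in M. X 0 \<omega> = 0) \<and>
     (\<forall>n (t::nat \<Rightarrow> real). 0 \<le> t 0 \<and> (\<forall>i<n. t i < t (Suc i)) \<longrightarrow>
        prob_space.indep_vars M (\<lambda>_. borel) (\<lambda>i \<omega>. X (t (Suc i)) \<omega> - X (t i) \<omega>) {..<n}) \<and>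
     (\<forall>s\<ge>0. \<forall>h\<ge>0. distr M borel (\<lambda>\<omega>. X (s + h) \<omega> - X s \<omega>) = distr M borel (X h)) \<and>
     (\<forall>\<omega>\<in>space M. cadlag (\<lambda>s. X s \<omega>))"

text \<open>Independence of the random time \<open>T\<close> and of the \<open>\<sigma>\<close>-algebra generated by all \<open>X s\<close>, \<open>s \<ge> 0\<close>.
  (The library's \<open>indep_var\<close> requires both random variables to have the same type.)\<close>

definition indep_of_process ::
    "'w measure \<Rightarrow> ('w \<Rightarrow> real) \<Rightarrow> (real \<Rightarrow> 'w \<Rightarrow> real) \<Rightarrow> bool" where
  "indep_of_process M T X \<longleftrightarrow>
     prob_space.indep_set M
       (sets (vimage_algebra (space M) T borel))
       (sets (vimage_algebra (space M) (\<lambda>\<omega>. \<lambda>s\<in>{0..}. X s \<omega>) (\<Pi>\<^sub>M s\<in>{0..}. borel)))"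

text \<open>The two alternatives are: never killed, and killed at an exponential time \<open>T\<close>
  of rate \<open>q > 0\<close>; the cemetery point is \<open>\<infinity>\<close>.\<close>

definition killed_subordinator :: "'w measure \<Rightarrow> (real \<Rightarrow> 'w \<Rightarrow> ennreal) \<Rightarrow> bool" where
  "killed_subordinator M \<tau> \<longleftrightarrow>
     (\<exists>X. levy_process M X \<and> (\<forall>s\<ge>0. \<forall>\<omega>\<in>space M. 0 \<le> X s \<omega>) \<and>
       ((\<forall>s\<ge>0. \<forall>\<omega>\<in>space M. \<tau> s \<omega> = ennreal (X s \<omega>)) \<or>
        (\<exists>q T. 0 < q \<and> distributed M lborel T (exponential_density q) \<and> indep_of_process M T X \<and>
          (\<forall>s\<ge>0. \<forall>\<omega>\<in>space M. \<tau> s \<omega> = (if s < T \<omega> then ennreal (X s \<omega>) else \<infinity>)))))"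

definition has_laplace_exponent ::
    "'w measure \<Rightarrow> (real \<Rightarrow> 'w \<Rightarrow> ennreal) \<Rightarrow> (real \<Rightarrow> real) \<Rightarrow> bool" where
  "has_laplace_exponent M \<tau> \<Phi> \<longleftrightarrow>
     (\<forall>u>0. \<forall>s>0.
        (\<integral>\<omega>. (if \<tau> s \<omega> = \<infinity> then 0 else exp (- u * enn2real (\<tau> s \<omega>))) \<partial>M) = exp (- \<Phi> u * s))"

definition passage_time :: "(real \<Rightarrow> 'w \<Rightarrow> ennreal) \<Rightarrow> real \<Rightarrow> 'w \<Rightarrow> ereal" where
  "passage_time \<tau> t \<omega> = Inf {ereal s | s. 0 \<le> s \<and> ennreal t < \<tau> s \<omega>}"

text \<open>The undershoot \<open>\<tau>(L(t)-)\<close>, with the convention \<open>\<tau>(0-) = 0\<close>.  On the event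
  \<open>L(t) = \<infinity>\<close>, which is null if the subordinator is not identically zero, the left limit is the
  limit as time tends to infinity.\<close>

definition undershoot :: "(real \<Rightarrow> 'w \<Rightarrow> ennreal) \<Rightarrow> real \<Rightarrow> 'w \<Rightarrow> ennreal" where
  "undershoot \<tau> t \<omega> =
     (if passage_time \<tau> t \<omega> = 0 then 0
      else Lim (at_left (passage_time \<tau> t \<omega>)) (\<lambda>s. \<tau> (real_of_ereal s) \<omega>))"

end

theory Submission
  imports Defs "HOL-Real_Asymp.Real_Asymp"
begin

text \<open>Let \<open>L(x)\<close> be the first time at which the subordinator exceeds \<open>x\<close>.  For \<open>0 \<le> x \<le> t\<close> the undershoot
  \<open>G(t)\<close> is, almost surely, at most \<open>x\<close> exactly if the path passes the levels \<open>x\<close> and \<open>t\<close> at the same time,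
  \<open>L(x) = L(t)\<close>.  For small \<open>h\<close> the times \<open>s\<close> with \<open>\<tau>(s) \<le> x\<close> and \<open>\<tau>(s + h) > t\<close> form, up to end points,
  the interval from \<open>L(t) - h\<close> to \<open>L(x)\<close>; its length divided by \<open>h\<close> tends to the indicator of
  \<open>L(x) = L(t)\<close>.  Taking expectations and using the Markov property,

    \<open>P(G(t) \<le> x) = lim (1/h) \<integral> 1[y \<le> x] P(\<tau>(h) > t - y) U(dy)\<close>  as \<open>h \<rightarrow> 0\<close>,

  where \<open>U\<close> is the potential measure (expected occupation time), with Laplace transform \<open>1/\<Phi>(u)\<close>.
  The limit of \<open>P(\<tau>(h) > z)/h\<close> is the tail of the Levy measure, but this limit need not be taken:
  \<open>P(\<tau>(h) > z)/h\<close> is itself a decreasing function of \<open>z\<close> with the explicit Laplace transform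
  \<open>(1 - exp(-h \<Phi>(u)))/(h u)\<close>, and it suffices to let \<open>h\<close> tend to zero together with \<open>t\<close>, sufficiently
  fast (\<open>rate_approx\<close>, \<open>rate_increment_approx\<close>).

  Small undershoot.  With \<open>x = \<epsilon>(t) t\<close> the integral lies between \<open>U[0,x] P(\<tau>(h) > t)/h\<close> and
  \<open>U[0,x] P(\<tau>(h) > t - x)/h\<close>.  A version of Karamata's Tauberian theorem for families of measures
  (\<open>karamata_tauberian\<close>) and monotonicity of the tail give \<open>U[0,x] \<sim> 1/(\<Gamma>(1+\<alpha>) \<Phi>(1/x))\<close> and
  \<open>P(\<tau>(h) > t)/h \<sim> \<Phi>(1/t)/\<Gamma>(1-\<alpha>)\<close>, so that
  \<open>P(G(t) \<le> \<epsilon>(t) t) \<sim> \<Phi>(1/t)/\<Phi>(1/(\<epsilon>(t) t))\<close> up to the factor \<open>sin(\<pi>\<alpha>)/(\<pi>\<alpha>)\<close> given by the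
  reflection formula of the Gamma function.  Only the values of \<open>\<Phi>\<close> at \<open>1/t\<close> and \<open>1/(\<epsilon>(t) t)\<close> occur,
  and there \<open>\<Phi>\<close> can be replaced by \<open>u\<^sup>\<alpha> l(1/u)\<close>.

  Undershoot near \<open>t\<close>.  If \<open>\<tau>\<close> is special, \<open>U\<close> has a decreasing density \<open>v\<close> on \<open>(0, \<infinity>)\<close>, and the part of
  the integral over \<open>(x, t]\<close> lies between \<open>v(t)\<close> and \<open>v(x)\<close> times the integral of \<open>P(\<tau>(h) > z)/h\<close>
  over \<open>0 \<le> z \<le> t - x\<close>; the asymptotics of both factors follow from the same Tauberian theorem.  The density
  exists because the Post-Widder inversion of \<open>1/\<Phi>(u) = \<Psi>(u)/u\<close> has decreasing weights
  when \<open>\<Psi>(u) = u/\<Phi>(u)\<close> is a Bernstein function (\<open>laplace_monotone_density\<close>).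

  For the statements up to constants, the Tauberian limits are replaced by the elementary bounds
  \<open>U[0,r] \<asymp> 1/\<Phi>(1/r)\<close> and their analogue for the tail, and a lower bound for a monotone density is
  obtained by comparing distribution functions at \<open>z\<close> and \<open>K z\<close> for a large constant \<open>K\<close>.\<close>

section \<open>Laplace transforms of measures on the half-line\<close>

text \<open>The Laplace transform is required to be finite for every positive argument, so that distribution
  functions are finite although the measures themselves (such as a potential measure) may be infinite.\<close>

definition has_laplace :: "real measure \<Rightarrow> (real \<Rightarrow> real) \<Rightarrow> bool" where
  "has_laplace N f \<longleftrightarrow> sets N = sets borel \<and> (AE x in N. 0 \<le> x) \<and>
     (\<forall>u>0. 0 \<le> f u \<and> (\<integral>\<^sup>+x. ennreal (exp (- u * x)) \<partial>N) = ennreal (f u))"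

lemma has_laplaceD:
  assumes "has_laplace N f"
  shows "sets N = sets borel" "AE x in N. 0 \<le> x" "space N = UNIV"
    and "u > 0 \<Longrightarrow> 0 \<le> f u"
    and "u > 0 \<Longrightarrow> (\<integral>\<^sup>+x. ennreal (exp (- u * x)) \<partial>N) = ennreal (f u)"
  using assms unfolding has_laplace_def
  by (auto dest: sets_eq_imp_space_eq)

lemma has_laplace_bochner:
  assumes "has_laplace N f" "u > 0"
  shows "has_bochner_integral N (\<lambda>x. exp (- u * x)) (f u)"
proof -
  have [measurable_cong]: "sets N = sets borel" using has_laplaceD(1)[OF assms(1)] .
  show ?thesis
    by (rule has_bochner_integral_nn_integral) (use has_laplaceD[OF assms(1)] assms(2) in auto)
qed

lemma has_laplace_emeasure_le:
  assumes "has_laplace N f" "u > 0"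
  shows "emeasure N {..x} \<le> ennreal (exp (u * x) * f u)"
proof -
  note L = has_laplaceD[OF assms(1)]
  have [measurable_cong]: "sets N = sets borel" using L(1) .
  have "emeasure N {..x} = (\<integral>\<^sup>+y. indicator {..x} y \<partial>N)"
    by (subst nn_integral_indicator) auto
  also have "\<dots> \<le> (\<integral>\<^sup>+y. ennreal (exp (u * x)) * ennreal (exp (- u * y)) \<partial>N)"
  proof (intro nn_integral_mono)
    fix y show "indicator {..x} y \<le> ennreal (exp (u * x)) * ennreal (exp (- u * y))"
      using assms(2) by (auto simp: indicator_def ennreal_mult[symmetric] exp_add[symmetric]
          simp flip: ennreal_1 intro!: ennreal_leI)
  qed
  also have "\<dots> = ennreal (exp (u * x) * f u)"
    using L(4,5)[OF assms(2)] by (subst nn_integral_cmult) (auto simp: ennreal_mult)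
  finally show ?thesis .
qed

lemma has_laplace_finite:
  assumes "has_laplace N f" shows "emeasure N {..x} < \<infinity>" "emeasure N {..x} = ennreal (measure N {..x})"
proof -
  show *: "emeasure N {..x} < \<infinity>"
    by (rule le_less_trans[OF has_laplace_emeasure_le[OF assms, of 1]]) auto
  show "emeasure N {..x} = ennreal (measure N {..x})"
    using * by (intro emeasure_eq_ennreal_measure) auto
qed

lemma has_laplace_measure_le:
  assumes "has_laplace N f" "u > 0"
  shows "measure N {..x} \<le> exp (u * x) * f u"
  using has_laplace_emeasure_le[OF assms, of x] has_laplace_finite(2)[OF assms(1), of x]
    has_laplaceD(4)[OF assms] by (simp add: ennreal_le_iff)

lemma has_laplace_integrable_indicator:
  assumes "has_laplace N f"
  shows "integrable N (indicator {..x} :: real \<Rightarrow> real)" "integral\<^sup>L N (indicator {..x}) = measure N {..x}"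
  using has_laplace_finite(1)[OF assms, of x] has_laplaceD[OF assms]
  by (auto simp: integrable_indicator_iff)

lemma has_laplace_mono:
  assumes "has_laplace N f" "x \<le> y"
  shows "measure N {..x} \<le> measure N {..y}"
  using has_laplace_finite(1)[OF assms(1), of y] has_laplaceD[OF assms(1)] assms(2)
  by (intro measure_mono_fmeasurable) (auto intro!: fmeasurableI)

lemma has_laplace_right_cont:
  assumes "has_laplace N f"
  shows "((\<lambda>y. measure N {..y}) \<longlongrightarrow> measure N {..x}) (at_right x)"
proof (rule tendsto_at_right_sequentially[of _ "x+1"])
  fix S :: "nat \<Rightarrow> real" assume S: "\<And>n. x < S n" "decseq S" "S \<longlonglongrightarrow> x"
  have eq: "{..x} = (\<Inter>n. {..S n})"
  proof (intro equalityI subsetI)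
    fix y assume "y \<in> (\<Inter>n. {..S n})"
    then have "\<And>n. y \<le> S n" by auto
    then show "y \<in> {..x}" using S(3) by (auto intro: LIMSEQ_le_const)
  next
    fix y assume "y \<in> {..x}"
    then have "y \<le> S n" for n using S(1)[of n] by simp
    then show "y \<in> (\<Inter>n. {..S n})" by simp
  qed
  show "(\<lambda>n. measure N {..S n}) \<longlonglongrightarrow> measure N {..x}"
    unfolding eq
  proof (rule Lim_measure_decseq)
    show "decseq (\<lambda>n. {..S n})" using S(2) by (auto simp: decseq_def)
    show "\<And>i. emeasure N {..S i} \<noteq> \<infinity>" using has_laplace_finite(1)[OF assms] by (simp add: less_top)
    show "range (\<lambda>n. {..S n}) \<subseteq> sets N" unfolding has_laplaceD(1)[OF assms] by auto
  qed
qed simp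

lemma has_laplace_poly:
  assumes "has_laplace N f"
  shows "has_bochner_integral N (\<lambda>x. exp (- x) * (\<Sum>j\<le>n::nat. c j * exp (- x) ^ j))
           (\<Sum>j\<le>n. c j * f (real (Suc j)))"
proof -
  have "has_bochner_integral N (\<lambda>x. \<Sum>j\<le>n. c j * exp (- real (Suc j) * x)) (\<Sum>j\<le>n. c j * f (real (Suc j)))"
    by (intro has_bochner_integral_sum has_bochner_integral_mult_right has_laplace_bochner[OF assms]) auto
  also have "(\<lambda>x. \<Sum>j\<le>n. c j * exp (- real (Suc j) * x)) = (\<lambda>x. exp (- x) * (\<Sum>j\<le>n. c j * exp (- x) ^ j))"
    by (auto simp: sum_distrib_left fun_eq_iff exp_of_nat_mult[symmetric] algebra_simps exp_add[symmetric]
        intro!: sum.cong)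
  finally show ?thesis .
qed

lemma has_laplace_integral_approx:
  fixes g p :: "real \<Rightarrow> real"
  assumes N: "has_laplace N f" and p: "integrable N (\<lambda>x. exp (-x) * p (exp (-x)))"
    and [measurable]: "g \<in> borel_measurable borel"
    and le: "\<And>y. y \<in> {0..1} \<Longrightarrow> \<bar>g y - p y\<bar> \<le> e"
  shows "integrable N (\<lambda>x. exp (-x) * g (exp (-x)))"
    and "\<bar>(\<integral>x. exp (-x) * g (exp (-x)) \<partial>N) - (\<integral>x. exp (-x) * p (exp (-x)) \<partial>N)\<bar> \<le> e * f 1"
proof -
  note L = has_laplaceD[OF N]
  have [measurable_cong]: "sets N = sets borel" using L(1) .
  have e1: "has_bochner_integral N (\<lambda>x. exp (- x)) (f 1)"
    using has_laplace_bochner[OF N, of 1] by simp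
  then have e: "has_bochner_integral N (\<lambda>x. e * exp (- x)) (e * f 1)"
    by (rule has_bochner_integral_mult_right)
  have AEle: "AE x in N. \<bar>exp (-x) * g (exp (-x)) - exp (-x) * p (exp (-x))\<bar> \<le> e * exp (-x)"
    using L(2)
  proof eventually_elim
    case (elim x)
    have "\<bar>exp (-x) * g (exp (-x)) - exp (-x) * p (exp (-x))\<bar> = exp (-x) * \<bar>g (exp (-x)) - p (exp (-x))\<bar>"
      by (simp add: abs_mult right_diff_distrib[symmetric])
    also have "\<dots> \<le> exp (-x) * e" using elim by (intro mult_left_mono le) auto
    finally show ?case by (simp add: mult.commute)
  qed
  have pm: "(\<lambda>x. exp (-x) * p (exp (-x))) \<in> borel_measurable N" using p by auto
  have d: "integrable N (\<lambda>x. exp (-x) * g (exp (-x)) - exp (-x) * p (exp (-x)))"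
  proof (rule Bochner_Integration.integrable_bound[where f="\<lambda>x. e * exp (-x)"])
    show "integrable N (\<lambda>x. e * exp (-x))" using e by (auto simp: has_bochner_integral_iff)
    show "(\<lambda>x. exp (-x) * g (exp (-x)) - exp (-x) * p (exp (-x))) \<in> borel_measurable N"
      by (intro borel_measurable_diff pm) measurable
    show "AE x in N. norm (exp (-x) * g (exp (-x)) - exp (-x) * p (exp (-x))) \<le> norm (e * exp (-x))"
      using AEle by eventually_elim auto
  qed
  from Bochner_Integration.integrable_add[OF d p]
  show g: "integrable N (\<lambda>x. exp (-x) * g (exp (-x)))" by simp
  have "\<bar>(\<integral>x. exp (-x) * g (exp (-x)) \<partial>N) - (\<integral>x. exp (-x) * p (exp (-x)) \<partial>N)\<bar>
      = \<bar>\<integral>x. exp (-x) * g (exp (-x)) - exp (-x) * p (exp (-x)) \<partial>N\<bar>"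
    by (simp add: g p)
  also have "\<dots> \<le> (\<integral>x. \<bar>exp (-x) * g (exp (-x)) - exp (-x) * p (exp (-x))\<bar> \<partial>N)"
    using integral_norm_bound[of N "\<lambda>x. exp (-x) * g (exp (-x)) - exp (-x) * p (exp (-x))"] by simp
  also have "\<dots> \<le> (\<integral>x. e * exp (- x) \<partial>N)"
    using AEle by (intro integral_mono_AE) (use d e in \<open>auto simp: has_bochner_integral_iff\<close>)
  also have "\<dots> = e * f 1" using e by (auto simp: has_bochner_integral_iff)
  finally show "\<bar>(\<integral>x. exp (-x) * g (exp (-x)) \<partial>N) - (\<integral>x. exp (-x) * p (exp (-x)) \<partial>N)\<bar> \<le> e * f 1" .
qed

text \<open>Under \<open>y = exp (- x)\<close> the numbers \<open>f k\<close>, \<open>k \<ge> 1\<close>, are the moments of the finite measure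
  \<open>exp (- x) N(dx)\<close> on \<open>[0, 1]\<close>.  Convergence of moments on a compact interval implies
  weak convergence, by polynomial approximation.\<close>

lemma laplace_weak_convergence:
  fixes N :: "'i \<Rightarrow> real measure"
  assumes N: "\<forall>\<^sub>F i in F. has_laplace (N i) (f i)" and N0: "has_laplace N0 f0"
    and lim: "\<And>k::nat. 0 < k \<Longrightarrow> ((\<lambda>i. f i (real k)) \<longlongrightarrow> f0 (real k)) F"
    and g: "continuous_on {0..1} g" and [measurable]: "g \<in> borel_measurable borel"
  shows "((\<lambda>i. \<integral>x. exp (-x) * g (exp (-x)) \<partial>N i) \<longlongrightarrow> (\<integral>x. exp (-x) * g (exp (-x)) \<partial>N0)) F"
proof (rule tendstoI)
  fix e :: real assume e: "e > 0"
  have f01: "f0 1 \<ge> 0" using has_laplaceD(4)[OF N0, of 1] by simp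
  define d where "d = e / (2 * f0 1 + 3)"
  have d: "d > 0" using e f01 by (simp add: d_def)
  obtain p where p: "real_polynomial_function p" "\<And>y. y \<in> {0..1} \<Longrightarrow> \<bar>g y - p y\<bar> < d"
    using Stone_Weierstrass_real_polynomial_function[OF _ g d] by auto
  obtain c and n::nat where pc: "p = (\<lambda>y. \<Sum>j\<le>n. c j * y ^ j)"
    using p(1) by (auto simp: real_polynomial_function_iff_sum)
  define P where "P = (\<lambda>f. \<Sum>j\<le>n. c j * (f (real (Suc j)) :: real))"
  have near: "\<bar>(\<integral>x. exp (-x) * g (exp (-x)) \<partial>N) - P f\<bar> \<le> d * f 1" if "has_laplace N f" for N f
    using has_laplace_integral_approx(2)[OF that, of p g d] has_laplace_poly[OF that, of c n] p(2)
    by (force simp: pc P_def has_bochner_integral_iff less_imp_le)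
  have "((\<lambda>i. P (f i)) \<longlongrightarrow> P f0) F"
    unfolding P_def by (intro tendsto_intros lim) auto
  then have 1: "\<forall>\<^sub>F i in F. dist (P (f i)) (P f0) < d" using d by (rule tendstoD)
  have "((\<lambda>i. f i 1) \<longlongrightarrow> f0 1) F" using lim[of 1] by simp
  then have 2: "\<forall>\<^sub>F i in F. dist (f i 1) (f0 1) < 1" by (rule tendstoD) simp
  show "\<forall>\<^sub>F i in F. dist (\<integral>x. exp (-x) * g (exp (-x)) \<partial>N i) (\<integral>x. exp (-x) * g (exp (-x)) \<partial>N0) < e"
    using 1 2 N
  proof eventually_elim
    case (elim i)
    have "d * f i 1 \<le> d * (f0 1 + 1)" using elim(2) d by (intro mult_left_mono) (auto simp: dist_real_def)
    moreover have "d * (f0 1 + 1) + d + d * f0 1 < e"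
    proof -
      have "d * (2 * f0 1 + 3) = e" using f01 by (simp add: d_def)
      then show ?thesis using d by (simp add: algebra_simps)
    qed
    ultimately show ?case using near[OF elim(3)] near[OF N0] elim(1)
      unfolding dist_real_def by linarith
  qed
qed

text \<open>A continuity theorem for Laplace transforms.  Convergence at the positive integers suffices, because it
  amounts to convergence of moments.  Stating it with two points \<open>a < b\<close> avoids any condition on atoms of the limit.\<close>

theorem laplace_continuity:
  fixes N :: "'i \<Rightarrow> real measure"
  assumes N: "\<forall>\<^sub>F i in F. has_laplace (N i) (f i)" and N0: "has_laplace N0 f0"
    and lim: "\<And>k::nat. 0 < k \<Longrightarrow> ((\<lambda>i. f i (real k)) \<longlongrightarrow> f0 (real k)) F"
    and ab: "a < b" and e: "0 < e"
  shows "\<forall>\<^sub>F i in F. measure (N i) {..a} \<le> measure N0 {..b} + e \<and> measure N0 {..a} \<le> measure (N i) {..b} + e"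
proof -
  \<comment> \<open>The test function \<open>exp (- x) * g (exp (- x))\<close> is \<open>1\<close> up to \<open>a\<close>, \<open>0\<close> from \<open>b\<close> on and linear
  in between; truncating at \<open>exp (-b)\<close> keeps \<open>g\<close> continuous at \<open>y = 0\<close>.\<close>
  define m where "m = (\<lambda>y. max y (exp (-b)))"
  define g where "g = (\<lambda>y. max 0 (min 1 ((b + ln (m y)) / (b - a))) / m y)"
  have mpos: "m y > 0" for y by (auto simp: m_def less_max_iff_disj)
  have cont: "continuous_on UNIV g"
    unfolding g_def using mpos ab unfolding m_def
    by (intro continuous_intros) (auto simp: less_max_iff_disj max_def)
  then have [measurable]: "g \<in> borel_measurable borel" by (rule borel_measurable_continuous_onI)
  have g1: "indicator {..a} x \<le> exp (-x) * g (exp (-x))" for x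
  proof (cases "x \<le> a")
    case True
    then have "m (exp (-x)) = exp (-x)" using ab by (auto simp: m_def)
    with True ab show ?thesis by (simp add: g_def field_simps)
  qed (use mpos[of "exp(-x)"] in \<open>auto simp: g_def less_imp_le\<close>)
  have g2: "exp (-x) * g (exp (-x)) \<le> indicator {..b} x" for x
  proof (cases "x \<le> b")
    case True
    then have "m (exp (-x)) = exp (-x)" by (auto simp: m_def)
    with True show ?thesis by (simp add: g_def)
  next
    case False
    then have "m (exp (-x)) = exp (-b)" by (auto simp: m_def)
    with False show ?thesis by (simp add: g_def)
  qed
  have gint: "integrable N (\<lambda>x. exp (-x) * g (exp (-x)))" if "has_laplace N f" for N f
  proof -
    have [measurable_cong]: "sets N = sets borel" using has_laplaceD(1)[OF that] .
    have nn: "0 \<le> exp (-x) * g (exp (-x))" for x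
      using order_trans[OF _ g1[of x], of 0] by (auto simp: indicator_def split: if_splits)
    show ?thesis
    proof (rule Bochner_Integration.integrable_bound[OF has_laplace_integrable_indicator(1)[OF that, of b]])
      show "AE x in N. norm (exp (-x) * g (exp (-x))) \<le> norm (indicator {..b} x :: real)"
        using g2 nn by (auto simp: abs_of_nonneg)
    qed measurable
  qed
  have lo: "measure N {..a} \<le> (\<integral>x. exp (-x) * g (exp (-x)) \<partial>N)"
    and hi: "(\<integral>x. exp (-x) * g (exp (-x)) \<partial>N) \<le> measure N {..b}" if "has_laplace N f" for N f
    unfolding has_laplace_integrable_indicator(2)[OF that, symmetric]
    by (intro integral_mono gint[OF that] has_laplace_integrable_indicator(1)[OF that] g1 g2)+
  have "\<forall>\<^sub>F i in F. dist (\<integral>x. exp (-x) * g (exp (-x)) \<partial>N i) (\<integral>x. exp (-x) * g (exp (-x)) \<partial>N0) < e"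
    using laplace_weak_convergence[OF N N0 lim, of g] cont e
    by (intro tendstoD) (auto intro: continuous_on_subset)
  then show ?thesis using N
  proof eventually_elim
    case (elim i)
    then show ?case using lo[OF elim(2)] hi[OF elim(2)] lo[OF N0] hi[OF N0]
      unfolding dist_real_def by linarith
  qed
qed

section \<open>Karamata's Tauberian theorem\<close>

lemma has_laplace_scale:
  assumes "has_laplace N f" and r: "r > 0" and c: "c \<ge> 0"
  shows "has_laplace (scale_measure (ennreal c) (distr N borel (\<lambda>x. x / r))) (\<lambda>u. c * f (u / r))"
    and "measure (scale_measure (ennreal c) (distr N borel (\<lambda>x. x / r))) {..a} = c * measure N {..r * a}"
proof -
  note L = has_laplaceD[OF assms(1)]
  have [measurable_cong]: "sets N = sets borel" using L(1) .
  have AE: "AE x in distr N borel (\<lambda>x. x / r). 0 \<le> x"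
    using L(2) r by (subst AE_distr_iff) auto
  have "AE x in scale_measure (ennreal c) (distr N borel (\<lambda>x. x / r)). 0 \<le> x"
    using AE by (auto simp: eventually_ae_filter null_sets_def emeasure_scale_measure space_scale_measure)
  moreover have "(\<integral>\<^sup>+x. ennreal (exp (- u * x)) \<partial>scale_measure (ennreal c) (distr N borel (\<lambda>x. x / r)))
      = ennreal (c * f (u / r))" if u: "u > 0" for u
  proof -
    have "(\<integral>\<^sup>+x. ennreal (exp (- u * x)) \<partial>scale_measure (ennreal c) (distr N borel (\<lambda>x. x / r)))
       = ennreal c * (\<integral>\<^sup>+x. ennreal (exp (- (u / r) * x)) \<partial>N)"
      by (subst nn_integral_scale_measure) (auto simp: nn_integral_distr)
    also have "\<dots> = ennreal (c * f (u / r))"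
      using L(4,5)[of "u / r"] u r c by (simp add: ennreal_mult)
    finally show ?thesis .
  qed
  ultimately show "has_laplace (scale_measure (ennreal c) (distr N borel (\<lambda>x. x / r))) (\<lambda>u. c * f (u / r))"
    using L(4) r c by (auto simp: has_laplace_def)
  have "(\<lambda>x. x / r) -` {..a} \<inter> space N = {..r * a}" using r L(3) by (auto simp: field_simps)
  then show "measure (scale_measure (ennreal c) (distr N borel (\<lambda>x. x / r))) {..a} = c * measure N {..r * a}"
    using c by (simp add: measure_distr)
qed

text \<open>The limit measure in Karamata's theorem; its transform is a rescaled Gamma integral.\<close>

lemma has_laplace_power:
  fixes \<rho> :: real
  assumes \<rho>: "\<rho> > 0"
  defines "K \<equiv> density lborel (\<lambda>x. ennreal (indicator {0..} x * x powr (\<rho> - 1) / Gamma \<rho>))"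
  shows "has_laplace K (\<lambda>u. u powr (- \<rho>))"
    and "a \<ge> 0 \<Longrightarrow> measure K {..a} = a powr \<rho> / Gamma (1 + \<rho>)"
proof -
  have G: "Gamma \<rho> > 0" using \<rho> by (rule Gamma_real_pos)
  have "(\<integral>\<^sup>+x. ennreal (exp (- u * x)) \<partial>K) = ennreal (u powr (- \<rho>))" if u: "u > 0" for u
  proof -
    let ?g = "\<lambda>t. ennreal (indicator {0..} t * t powr (\<rho> - 1) / exp t)"
    have "(\<integral>\<^sup>+x. ennreal (exp (- u * x)) \<partial>K) =
       (\<integral>\<^sup>+x. ennreal (u powr (1 - \<rho>) / Gamma \<rho>) * ?g (0 + u * x) \<partial>lborel)"
      unfolding K_def
    proof (subst nn_integral_density, measurable, intro nn_integral_cong)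
      fix x :: real
      show "ennreal (indicat_real {0..} x * x powr (\<rho> - 1) / Gamma \<rho>) * ennreal (exp (- u * x)) =
        ennreal (u powr (1 - \<rho>) / Gamma \<rho>) * ennreal (indicat_real {0..} (0 + u * x) * (0 + u * x) powr (\<rho> - 1)
            / exp (0 + u * x))"
      proof (cases "x \<ge> 0")
        case True
        have "u powr (1 - \<rho>) * u powr (\<rho> - 1) = 1" using u by (simp flip: powr_add)
        then show ?thesis using True u G
          by (simp add: powr_mult exp_minus field_simps flip: ennreal_mult)
      next
        case False
        then have "\<not> 0 \<le> u * x" using u by (simp add: zero_le_mult_iff)
        then show ?thesis using False by simp
      qed
    qed
    also have "\<dots> = ennreal (u powr (1 - \<rho>) / Gamma \<rho>) * (\<integral>\<^sup>+x. ?g (0 + u * x) \<partial>lborel)"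
      by (rule nn_integral_cmult) measurable
    also have "(\<integral>\<^sup>+x. ?g (0 + u * x) \<partial>lborel) = ennreal (1 / u) * ennreal (Gamma \<rho>)"
    proof -
      have "ennreal (Gamma \<rho>) = ennreal u * (\<integral>\<^sup>+x. ?g (0 + u * x) \<partial>lborel)"
        using nn_integral_real_affine[of ?g u 0] Gamma_conv_nn_integral_real[OF \<rho>] u by simp
      then have "ennreal (1 / u) * ennreal (Gamma \<rho>) = ennreal (1 / u * u) * (\<integral>\<^sup>+x. ?g (0 + u * x) \<partial>lborel)"
        using u by (subst ennreal_mult) (auto simp: mult.assoc)
      then show ?thesis using u by simp
    qed
    also have "ennreal (u powr (1 - \<rho>) / Gamma \<rho>) * (ennreal (1 / u) * ennreal (Gamma \<rho>)) = ennreal (u powr (- \<rho>))"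
      using u G by (simp add: powr_diff powr_minus field_simps flip: ennreal_mult)
    finally show ?thesis .
  qed
  moreover have "AE x in K. 0 \<le> x"
    unfolding K_def by (subst AE_density) (auto simp: indicator_def)
  moreover have "sets K = sets borel" by (simp add: K_def)
  ultimately show "has_laplace K (\<lambda>u. u powr (- \<rho>))" by (auto simp: has_laplace_def)
  assume a: "a \<ge> 0"
  have "emeasure K {..a} = (\<integral>\<^sup>+x. ennreal (indicator {0..a} x * (x powr (\<rho> - 1) / Gamma \<rho>)) \<partial>lborel)"
    unfolding K_def by (subst emeasure_density) (auto intro!: nn_integral_cong simp: indicator_def)
  also have "\<dots> = ennreal (a powr \<rho> / \<rho> / Gamma \<rho>)"
  proof (rule nn_integral_has_integral_lebesgue)
    show "((\<lambda>x. x powr (\<rho> - 1) / Gamma \<rho>) has_integral a powr \<rho> / \<rho> / Gamma \<rho>) {0..a}"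
      using has_integral_divide[OF has_integral_powr_from_0[of "\<rho> - 1" a], of "Gamma \<rho>"] \<rho> a by simp
  qed (use G in auto)
  finally have "measure K {..a} = a powr \<rho> / \<rho> / Gamma \<rho>"
    using G \<rho> by (intro measure_eq_emeasure_eq_ennreal) auto
  then show "measure K {..a} = a powr \<rho> / Gamma (1 + \<rho>)"
    using \<rho> Gamma_plus1[of \<rho>] by (simp add: add.commute nonpos_Ints_def field_simps)
qed

text \<open>The measures may vary along the filter, and only the rescaled transforms at integers enter: this
  is what allows a second parameter (the time step) to vary together with the scale \<open>r\<close>.  The
  rescaled measures converge to the power-law measure by the continuity theorem, and its
  distribution function is continuous.\<close>

theorem karamata_tauberian:
  fixes N :: "'i \<Rightarrow> real measure" and c r :: "'i \<Rightarrow> real"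
  assumes N: "\<forall>\<^sub>F i in F. has_laplace (N i) (f i) \<and> 0 < r i \<and> 0 \<le> c i"
    and lim: "\<And>k::nat. 0 < k \<Longrightarrow> ((\<lambda>i. c i * f i (real k / r i)) \<longlongrightarrow> real k powr (- \<rho>)) F"
    and \<rho>: "\<rho> > 0" and a: "a > 0"
  shows "((\<lambda>i. c i * measure (N i) {..r i * a}) \<longlongrightarrow> a powr \<rho> / Gamma (1 + \<rho>)) F"
proof (rule tendstoI)
  fix e :: real assume e: "e > 0"
  define G where "G = (\<lambda>a::real. a powr \<rho> / Gamma (1 + \<rho>))"
  define K where "K = density lborel (\<lambda>x. ennreal (indicator {0..} x * x powr (\<rho> - 1) / Gamma \<rho>))"
  note K = has_laplace_power[OF \<rho>, folded K_def]
  define N' where "N' = (\<lambda>i. scale_measure (ennreal (c i)) (distr (N i) borel (\<lambda>x. x / r i)))"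
  have "Gamma (1 + \<rho>) \<noteq> 0" using \<rho> Gamma_real_pos[of "1 + \<rho>"] by linarith
  then have "isCont G a" unfolding G_def using a by (intro continuous_intros) auto
  then obtain d where d: "d > 0" "\<And>x. \<bar>x - a\<bar> < d \<Longrightarrow> \<bar>G x - G a\<bar> < e / 2"
    using e unfolding continuous_at_eps_delta dist_real_def
    by (metis half_gt_zero)
  define \<delta> where "\<delta> = min (d / 2) (a / 2)"
  have \<delta>: "\<delta> > 0" "\<delta> < d" "\<delta> < a" using d a by (auto simp: \<delta>_def)
  have N': "\<forall>\<^sub>F i in F. has_laplace (N' i) (\<lambda>u. c i * f i (u / r i))"
    using N by eventually_elim (auto simp: N'_def intro!: has_laplace_scale(1))
  have e2: "e / 2 > 0" using e by simp
  have "\<forall>\<^sub>F i in F. measure (N' i) {..a} \<le> measure K {..a + \<delta>} + e / 2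
      \<and> measure K {..a} \<le> measure (N' i) {..a + \<delta>} + e / 2"
    "\<forall>\<^sub>F i in F. measure (N' i) {..a - \<delta>} \<le> measure K {..a} + e / 2
      \<and> measure K {..a - \<delta>} \<le> measure (N' i) {..a} + e / 2"
    using laplace_continuity[OF N' K(1) _ _ e2] lim \<delta> by auto
  with N show "\<forall>\<^sub>F i in F. dist (c i * measure (N i) {..r i * a}) (a powr \<rho> / Gamma (1 + \<rho>)) < e"
  proof eventually_elim
    case (elim i)
    have "measure (N' i) {..a} = c i * measure (N i) {..r i * a}"
      unfolding N'_def using elim(1) by (intro has_laplace_scale(2)[of _ "f i"]) auto
    moreover have "\<bar>G (a + \<delta>) - G a\<bar> < e / 2" "\<bar>G (a - \<delta>) - G a\<bar> < e / 2"
      using d(2) \<delta> by auto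
    moreover have "measure K {..a + \<delta>} = G (a + \<delta>)" "measure K {..a - \<delta>} = G (a - \<delta>)"
      using K(2) \<delta> a by (auto simp: G_def)
    ultimately have "\<bar>c i * measure (N i) {..r i * a} - G a\<bar> < e"
      using elim(2,3) by linarith
    then show ?case by (simp add: dist_real_def G_def)
  qed
qed

text \<open>Markov's inequality bounds the distribution function from above by the Laplace transform; the converse
  bound needs control of the mass beyond \<open>x\<close>.  At the argument \<open>4 / x\<close> that mass contributes at most
  \<open>exp (- 2)\<close> times the transform at \<open>2 / x\<close>, and halving the argument at most doubles the transform.\<close>

lemma has_laplace_measure_ge:
  assumes N: "has_laplace N f" and x: "x > 0"
    and dbl: "\<And>u. u > 0 \<Longrightarrow> f u \<le> 2 * f (2 * u)"
  shows "(1/4 - exp (-2) / 2) * f (1 / x) \<le> measure N {..x}"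
proof -
  note L = has_laplaceD[OF N]
  have 1: "has_bochner_integral N (\<lambda>y. exp (- (4 / x) * y)) (f (4 / x))"
    and 2: "has_bochner_integral N (\<lambda>y. exp (- 2) * exp (- (2 / x) * y)) (exp (-2) * f (2 / x))"
    using x by (intro has_laplace_bochner[OF N] has_bochner_integral_mult_right; simp)+
  have 3: "has_bochner_integral N (indicator {..x}) (measure N {..x})"
    using has_laplace_integrable_indicator[OF N] by (auto simp: has_bochner_integral_iff)
  have "f (4 / x) \<le> measure N {..x} + exp (-2) * f (2 / x)"
  proof -
    note 4 = has_bochner_integral_add[OF 3 2]
    have "AE y in N. exp (- (4 / x) * y) \<le> indicator {..x} y + exp (- 2) * exp (- (2 / x) * y)"
      using L(2)
    proof eventually_elim
      case (elim y)
      show ?case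
      proof (cases "y \<le> x")
        case True
        have "exp (- (4 / x) * y) \<le> exp 0" using elim x by (subst exp_le_cancel_iff) simp
        moreover have "0 \<le> exp (- 2) * exp (- (2 / x) * y)" by simp
        ultimately have "exp (- (4 / x) * y) \<le> 1 + exp (- 2) * exp (- (2 / x) * y)"
          unfolding exp_zero by linarith
        then show ?thesis using True by simp
      next
        case False
        then have "- (4 / x) * y \<le> - 2 + - (2 / x) * y" using x by (simp add: field_simps)
        then show ?thesis using False by (simp flip: exp_add)
      qed
    qed
    from integral_mono_AE[OF integrable.intros[OF 1] integrable.intros[OF 4] this]
    show ?thesis
      unfolding has_bochner_integral_integral_eq[OF 1] has_bochner_integral_integral_eq[OF 4] .
  qed
  moreover have "f (2 / x) \<le> 2 * f (4 / x)" and 5: "f (1 / x) \<le> 2 * f (2 / x)"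
    using dbl[of "2 / x"] dbl[of "1 / x"] x by auto
  moreover have 6: "exp (-2 :: real) \<le> 1 / 2"
    using exp_ge_add_one_self[of 2] by (simp add: exp_minus field_simps)
  ultimately have "(1/2 - exp (-2)) * f (2 / x) \<le> measure N {..x}"
    unfolding left_diff_distrib by linarith
  moreover have "(1/2 - exp (-2)) * (f (1 / x) / 2) \<le> (1/2 - exp (-2)) * f (2 / x)"
    using 5 6 by (intro mult_left_mono) auto
  ultimately have "(1/2 - exp (-2)) * (f (1 / x) / 2) \<le> measure N {..x}" by linarith
  then show ?thesis by (simp add: algebra_simps)
qed

section \<open>Concave distribution functions\<close>

lemma powser_higher_deriv_0:
  fixes c :: "nat \<Rightarrow> real" and g :: "real \<Rightarrow> real" and K :: real
  assumes "K > 0" "\<And>z. norm z < K \<Longrightarrow> (\<lambda>n. c n * z ^ n) sums g z"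
  shows "(deriv ^^ k) g 0 = fact k * c k"
  using assms(2)
proof (induction k arbitrary: c g)
  case 0
  have "(\<lambda>n. c n * 0 ^ n) sums g 0" using 0[of 0] assms(1) by simp
  from sums_unique2[OF this powser_sums_zero] show ?case by simp
next
  case (Suc k)
  have "(g has_field_derivative deriv g z) (at z)" if z: "norm z < K" for z
  proof -
    have "((\<lambda>z. \<Sum>n. c n * z ^ n) has_field_derivative (\<Sum>n. diffs c n * z ^ n)) (at z)"
      using Suc.prems by (intro termdiffs_strong'[OF _ z]) (auto simp: sums_iff)
    moreover have "\<forall>\<^sub>F z in nhds z. (\<Sum>n. c n * z ^ n) = g z"
    proof -
      have "(\<Sum>n. c n * y ^ n) = g y" if "y \<in> ball 0 K" for y
        using Suc.prems[of y] that by (simp add: sums_iff)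
      then show ?thesis using eventually_nhds_in_open[of "ball 0 K" z] z
        by (auto elim!: eventually_mono)
    qed
    ultimately have "(g has_field_derivative (\<Sum>n. diffs c n * z ^ n)) (at z)"
      by (subst (asm) DERIV_cong_ev[OF refl _ refl])
    then show ?thesis using DERIV_imp_deriv by force
  qed
  then have "(\<lambda>n. diffs c n * z ^ n) sums deriv g z" if "norm z < K" for z
    using that Suc.prems by (intro termdiffs_sums_strong[where f=g]) auto
  from Suc.IH[OF this] show ?case
    by (simp add: funpow_Suc_right diffs_def del: funpow.simps)
qed

text \<open>The substitution \<open>x = n (1 - z)\<close> turns Taylor coefficients at \<open>z = 0\<close> into derivatives at \<open>x = n\<close>.\<close>

lemma higher_deriv_affine:
  fixes P :: "real \<Rightarrow> real"
  assumes P: "\<And>k x. x > 0 \<Longrightarrow> (deriv ^^ k) P differentiable (at x)" and n: "n > 0" and z: "z < 1"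
  shows "(deriv ^^ k) (\<lambda>z. P (n * (1 - z))) z = (- n) ^ k * (deriv ^^ k) P (n * (1 - z))"
  using z
proof (induction k arbitrary: z)
  case (Suc k)
  have "(deriv ^^ Suc k) (\<lambda>z. P (n * (1 - z))) z = deriv (\<lambda>z. (- n) ^ k * (deriv ^^ k) P (n * (1 - z))) z"
    using eventually_nhds_in_open[of "{..<1}" z] Suc
    by (auto intro!: deriv_cong_ev elim!: eventually_mono)
  also have "\<dots> = (- n) ^ k * (deriv ((deriv ^^ k) P) (n * (1 - z)) * (- n))"
  proof (rule DERIV_imp_deriv)
    have "((deriv ^^ k) P has_field_derivative deriv ((deriv ^^ k) P) (n * (1 - z))) (at (n * (1 - z)))"
      using P[of "n * (1 - z)" k] n Suc.prems
      by (metis DERIV_deriv_iff_real_differentiable diff_gt_0_iff_gt mult_pos_pos)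
    then show "((\<lambda>z. (- n) ^ k * (deriv ^^ k) P (n * (1 - z))) has_field_derivative
       (- n) ^ k * (deriv ((deriv ^^ k) P) (n * (1 - z)) * (- n))) (at z)"
      by (auto intro!: derivative_eq_intros DERIV_chain2[where f="(deriv ^^ k) P"])
  qed
  finally show ?case by simp
qed simp

text \<open>The weights are mixtures of Poisson probabilities with mean \<open>n x\<close>.  Placing the mass
  \<open>post_widder_weight N n k\<close> at \<open>k / n\<close> therefore spreads each point \<open>x\<close> of \<open>N\<close> over a Poisson
  distribution with mean \<open>x\<close> and variance \<open>x / n\<close>.\<close>

definition post_widder_weight :: "real measure \<Rightarrow> real \<Rightarrow> nat \<Rightarrow> real" where
  "post_widder_weight N n k = (\<integral>x. exp (- n * x) * ((n * x) ^ k / fact k) \<partial>N)"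

lemma power_fact_le_exp: "(y::real) ^ k / fact k \<le> exp y" if "y \<ge> 0"
proof -
  have "(\<lambda>i. y ^ i / fact i) sums exp y" using exp_converges[of y] by (simp add: field_simps)
  then show ?thesis using sum_le_suminf[of "\<lambda>i. y ^ i / fact i" "{k}"] that by (auto simp: sums_iff)
qed

lemma post_widder_integrable:
  assumes N: "has_laplace N f" and n: "n > 0"
  shows "integrable N (\<lambda>x. exp (- n * x) * ((n * x) ^ k / fact k))" "post_widder_weight N n k \<ge> 0"
proof -
  note L = has_laplaceD[OF N]
  have [measurable_cong]: "sets N = sets borel" using L(1) .
  have "integrable N (\<lambda>x. exp (- (n / 2) * x))"
    using has_laplace_bochner[OF N, of "n / 2"] n by (auto simp: has_bochner_integral_iff)
  then have i: "integrable N (\<lambda>x. 2 ^ k * exp (- (n / 2) * x))" by (rule integrable_mult_right)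
  show "integrable N (\<lambda>x. exp (- n * x) * ((n * x) ^ k / fact k))"
  proof (rule Bochner_Integration.integrable_bound[OF i])
    show "AE x in N. norm (exp (- n * x) * ((n * x) ^ k / fact k)) \<le> norm (2 ^ k * exp (- (n / 2) * x))"
      using L(2)
    proof eventually_elim
      case (elim x)
      have "(n * x) ^ k / fact k = 2 ^ k * ((n * x / 2) ^ k / fact k)" by (simp add: power_divide)
      also have "\<dots> \<le> 2 ^ k * exp (n * x / 2)"
        using elim n by (intro mult_left_mono power_fact_le_exp) auto
      finally have "exp (- n * x) * ((n * x) ^ k / fact k) \<le> exp (- n * x) * (2 ^ k * exp (n * x / 2))"
        by (rule mult_left_mono) simp
      also have "\<dots> = 2 ^ k * exp (- (n / 2) * x)" by (simp add: field_simps flip: exp_add)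
      finally show ?case using elim n by simp
    qed
  qed measurable
  show "post_widder_weight N n k \<ge> 0"
    unfolding post_widder_weight_def using L(2)
        by (intro integral_nonneg_AE) (auto elim!: eventually_mono simp: n less_imp_le)
qed

lemma post_widder_power_series:
  assumes N: "has_laplace N f" and n: "n > 0" and z: "\<bar>z\<bar> < 1"
  shows "(\<lambda>k. post_widder_weight N n k * z ^ k) sums f (n * (1 - z))"
proof -
  note L = has_laplaceD[OF N]
  define F where "F = (\<lambda>k x. exp (- n * x) * ((n * x) ^ k / fact k) * z ^ k)"
  have exps: "(\<lambda>k. exp (- n * x) * ((n * x) ^ k / fact k) * w ^ k) sums exp (- (n * (1 - w)) * x)" for x w :: real
  proof -
    have "(\<lambda>k. exp (- n * x) * ((n * w * x) ^ k /\<^sub>R fact k)) sums (exp (- n * x) * exp (n * w * x))"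
      by (intro sums_mult exp_converges)
    then show ?thesis by (simp add: power_mult_distrib field_simps flip: exp_add)
  qed
  have int: "integrable N (F k)" "integrable N (\<lambda>x. norm (F k x))" for k
    unfolding F_def by (intro integrable_mult_left integrable_norm post_widder_integrable(1)[OF N n])+
  have nF: "AE x in N. \<forall>k. norm (F k x) = exp (- n * x) * ((n * x) ^ k / fact k) * \<bar>z\<bar> ^ k"
    using L(2) by eventually_elim (use n in \<open>auto simp: F_def abs_mult power_abs\<close>)
  have b: "has_bochner_integral N (\<lambda>x. exp (- (n * (1 - \<bar>z\<bar>)) * x)) (f (n * (1 - \<bar>z\<bar>)))"
    using n z by (intro has_laplace_bochner[OF N]) auto
  have "(\<lambda>k. integral\<^sup>L N (F k)) sums (\<integral>x. (\<Sum>k. F k x) \<partial>N)"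
  proof (rule sums_integral[OF int(1)])
    show "AE x in N. summable (\<lambda>k. norm (F k x))"
      using nF by eventually_elim (use exps[of _ "\<bar>z\<bar>"] in \<open>auto simp: sums_iff\<close>)
    show "summable (\<lambda>k. \<integral>x. norm (F k x) \<partial>N)"
    proof (rule summableI_nonneg_bounded)
      fix m
      have "(\<Sum>k<m. \<integral>x. norm (F k x) \<partial>N) = (\<integral>x. (\<Sum>k<m. norm (F k x)) \<partial>N)"
        using int by (subst Bochner_Integration.integral_sum) auto
      also have "\<dots> \<le> (\<integral>x. exp (- (n * (1 - \<bar>z\<bar>)) * x) \<partial>N)"
      proof (rule integral_mono_AE)
        show "AE x in N. (\<Sum>k<m. norm (F k x)) \<le> exp (- (n * (1 - \<bar>z\<bar>)) * x)"
          using nF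
        proof eventually_elim
          case (elim x)
          have "summable (\<lambda>k. norm (F k x))" "(\<Sum>k. norm (F k x)) = exp (- (n * (1 - \<bar>z\<bar>)) * x)"
            using elim exps[of x "\<bar>z\<bar>"] by (auto simp: sums_iff)
          then show ?case using sum_le_suminf[of "\<lambda>k. norm (F k x)" "{..<m}"] by auto
        qed
      qed (use int b in \<open>auto simp: has_bochner_integral_iff\<close>)
      finally show "(\<Sum>k<m. \<integral>x. norm (F k x) \<partial>N) \<le> (\<integral>x. exp (- (n * (1 - \<bar>z\<bar>)) * x) \<partial>N)" .
    qed simp
  qed
  moreover have "(\<lambda>x. \<Sum>k. F k x) = (\<lambda>x. exp (- (n * (1 - z)) * x))"
    using exps[of _ z] by (auto simp: F_def sums_iff fun_eq_iff)
  moreover have "integral\<^sup>L N (F k) = post_widder_weight N n k * z ^ k" for k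
    unfolding F_def post_widder_weight_def by (rule integral_mult_left_zero)
  moreover have "(\<integral>x. exp (- (n * (1 - z)) * x) \<partial>N) = f (n * (1 - z))"
    using has_laplace_bochner[OF N, of "n * (1 - z)"] n z by (auto simp: has_bochner_integral_iff)
  ultimately show ?thesis by simp
qed

text \<open>By the power series above, \<open>(1 - z) * (\<Sum>k. w k * z ^ k)\<close> equals \<open>P (n * (1 - z)) / n\<close> for
  \<open>P x = x * f x\<close>.  Comparing Taylor coefficients, \<open>w (k + 1) - w k\<close> is a positive
  multiple of \<open>(-1) ^ (k + 1)\<close> times a derivative of \<open>P\<close> at \<open>n\<close>, hence nonpositive.\<close>

lemma post_widder_decreasing:
  assumes N: "has_laplace N f" and n: "n > 0"
    and diff: "\<And>k x. x > 0 \<Longrightarrow> (deriv ^^ k) (\<lambda>x. x * f x) differentiable (at x)"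
    and sign: "\<And>k x. 1 \<le> k \<Longrightarrow> x > 0 \<Longrightarrow> (-1) ^ k * (deriv ^^ k) (\<lambda>x. x * f x) x \<le> 0"
  shows "decseq (post_widder_weight N n)"
proof (rule decseq_SucI)
  fix k
  define w where "w = post_widder_weight N n"
  define c where "c = (\<lambda>j. n * (w j - (case j of 0 \<Rightarrow> 0 | Suc i \<Rightarrow> w i)))"
  let ?g = "\<lambda>z. (\<lambda>x. x * f x) (n * (1 - z))"
  have "(\<lambda>j. c j * z ^ j) sums ?g z" if z: "norm z < 1" for z
  proof -
    have s: "(\<lambda>j. w j * z ^ j) sums f (n * (1 - z))"
      unfolding w_def using post_widder_power_series[OF N n] z by simp
    have "(\<lambda>j. z * (w j * z ^ j)) sums (z * f (n * (1 - z)))" by (intro sums_mult s)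
    then have "(\<lambda>j. (case Suc j of 0 \<Rightarrow> 0 | Suc i \<Rightarrow> w i) * z ^ Suc j) sums (z * f (n * (1 - z)))"
      by (simp add: mult_ac)
    then have "(\<lambda>j. (case j of 0 \<Rightarrow> 0 | Suc i \<Rightarrow> w i) * z ^ j) sums (z * f (n * (1 - z)))"
      by (subst (asm) sums_Suc_iff) simp
    from sums_mult[OF sums_diff[OF s this], of n] show ?thesis
      by (simp add: c_def algebra_simps)
  qed
  then have "(deriv ^^ Suc k) ?g 0 = fact (Suc k) * c (Suc k)"
    by (intro powser_higher_deriv_0[where K=1]) auto
  moreover have "(deriv ^^ Suc k) ?g 0 = (- n) ^ Suc k * (deriv ^^ Suc k) (\<lambda>x. x * f x) n"
    using higher_deriv_affine[OF diff n, of 0 "Suc k"] by simp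
  moreover have "(- n) ^ Suc k = n ^ Suc k * (-1) ^ Suc k" by (metis mult.commute mult_minus1 power_mult_distrib)
  ultimately have "fact (Suc k) * c (Suc k) = n ^ Suc k * ((-1) ^ Suc k * (deriv ^^ Suc k) (\<lambda>x. x * f x) n)"
    by (metis mult.assoc)
  also have "\<dots> \<le> 0" using sign[of "Suc k" n] n
    by (intro mult_nonneg_nonpos[of "n ^ Suc k"]) (simp_all del: funpow.simps power_Suc)
  finally have "c (Suc k) \<le> 0"
    using fact_gt_zero[of "Suc k", where 'a = real] by (simp add: mult_le_0_iff not_le del: fact_Suc)
  then show "post_widder_weight N n (Suc k) \<le> post_widder_weight N n k"
    using n by (simp add: c_def w_def mult_le_0_iff)
qed

definition post_widder_measure :: "real measure \<Rightarrow> real \<Rightarrow> real measure" where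
  "post_widder_measure N n =
     distr (density (count_space UNIV) (\<lambda>k. ennreal (post_widder_weight N n k))) borel (\<lambda>k. real k / n)"

lemma post_widder_measure_laplace:
  assumes N: "has_laplace N f" and n: "n > 0"
  shows "has_laplace (post_widder_measure N n) (\<lambda>u. f (n * (1 - exp (- u / n))))"
  unfolding has_laplace_def
proof (intro conjI allI impI)
  show "sets (post_widder_measure N n) = sets borel" by (simp add: post_widder_measure_def)
  show "AE x in post_widder_measure N n. 0 \<le> x"
    unfolding post_widder_measure_def using n by (subst AE_distr_iff) auto
  fix u :: real assume u: "u > 0"
  have ex: "\<bar>exp (- u / n)\<bar> < 1" using u n by simp
  show "0 \<le> f (n * (1 - exp (- u / n)))" using ex n by (intro has_laplaceD(4)[OF N]) auto
  have s: "(\<lambda>k. post_widder_weight N n k * exp (- u / n) ^ k) sums f (n * (1 - exp (- u / n)))"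
    by (rule post_widder_power_series[OF N n ex])
  have "(\<integral>\<^sup>+x. ennreal (exp (- u * x)) \<partial>post_widder_measure N n)
     = (\<integral>\<^sup>+k. ennreal (post_widder_weight N n k) * ennreal (exp (- u * (real k / n))) \<partial>count_space UNIV)"
    unfolding post_widder_measure_def by (simp add: nn_integral_distr nn_integral_density)
  also have "\<dots> = (\<Sum>k. ennreal (post_widder_weight N n k * exp (- u / n) ^ k))"
    using post_widder_integrable(2)[OF N n]
    by (simp add: nn_integral_count_space_nat ennreal_mult mult_ac flip: exp_of_nat_mult)
  also have "\<dots> = ennreal (f (n * (1 - exp (- u / n))))"
    using s post_widder_integrable(2)[OF N n] by (subst suminf_ennreal2) (auto simp: sums_iff)
  finally show "(\<integral>\<^sup>+x. ennreal (exp (- u * x)) \<partial>post_widder_measure N n) = ennreal (f (n * (1 - exp (- u / n))))" .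
qed

lemma post_widder_measure_atMost:
  assumes N: "has_laplace N f" and n: "n > 0" and x: "x \<ge> 0"
  shows "measure (post_widder_measure N n) {..x} = (\<Sum>k\<le>nat \<lfloor>n * x\<rfloor>. post_widder_weight N n k)"
proof -
  let ?w = "post_widder_weight N n"
  have le: "real k / n \<le> x \<longleftrightarrow> k \<le> nat \<lfloor>n * x\<rfloor>" for k
    using n x by (simp add: le_nat_iff le_floor_iff field_simps)
  have "emeasure (post_widder_measure N n) {..x} = (\<integral>\<^sup>+k. ennreal (?w k) * indicator {k. k
      \<le> nat \<lfloor>n * x\<rfloor>} k \<partial>count_space UNIV)"
    unfolding post_widder_measure_def by (simp add: emeasure_distr emeasure_density le vimage_def)
  also have "\<dots> = (\<Sum>k\<le>nat \<lfloor>n * x\<rfloor>. ennreal (?w k))"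
    unfolding nn_integral_count_space_nat
    by (subst suminf_finite[of "{..nat \<lfloor>n * x\<rfloor>}"]) (auto simp: indicator_def)
  also have "\<dots> = ennreal (\<Sum>k\<le>nat \<lfloor>n * x\<rfloor>. ?w k)"
    using post_widder_integrable(2)[OF N n] by (intro sum_ennreal) auto
  finally show ?thesis
    using post_widder_integrable(2)[OF N n] by (intro measure_eq_emeasure_eq_ennreal sum_nonneg) auto
qed

text \<open>Decreasing weights make the distribution function concave on the lattice of mesh \<open>1 / n\<close>; the
  terms \<open>1 / n\<close> account for rounding to that lattice.\<close>

lemma post_widder_slopes:
  assumes N: "has_laplace N f" and n: "n > 0"
    and dec: "decseq (post_widder_weight N n)"
    and pqs: "0 \<le> p" "p \<le> q" "q \<le> s" "n * (q - p) \<ge> 1"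
  defines "W \<equiv> \<lambda>x. measure (post_widder_measure N n) {..x}"
  shows "(W s - W q) * (q - p - 1 / n) \<le> (W q - W p) * (s - q + 1 / n)"
proof -
  let ?w = "post_widder_weight N n"
  define K where "K = (\<lambda>x. nat \<lfloor>n * x\<rfloor>)"
  have Kmono: "K p \<le> K q" "K q \<le> K s"
    using pqs n by (auto simp: K_def intro!: nat_mono floor_mono)
  have split: "W y - W x = (\<Sum>k\<in>{K x<..K y}. ?w k)" if "0 \<le> x" "x \<le> y" "K x \<le> K y" for x y
  proof -
    have "{..K y} = {..K x} \<union> {K x<..K y}" using that(3) by auto
    then have "sum ?w {..K y} = sum ?w {..K x} + sum ?w {K x<..K y}"
      by (simp add: sum.union_disjoint ivl_disj_int)
    then show ?thesis using that by (simp add: W_def K_def post_widder_measure_atMost[OF N n])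
  qed
  have up: "W s - W q \<le> real (K s - K q) * ?w (K q)"
    using split[of q s] pqs Kmono sum_bounded_above[of "{K q<..K s}" ?w "?w (K q)"] decseqD[OF dec]
    by auto
  have low: "W q - W p \<ge> real (K q - K p) * ?w (K q)"
    using split[of p q] pqs Kmono sum_bounded_below[of "{K p<..K q}" "?w (K q)" ?w] decseqD[OF dec]
    by auto
  have Kr: "n * x - 1 \<le> real (K x)" "real (K x) \<le> n * x" if "x \<ge> 0" for x
    using that n by (auto simp: K_def)
  have w0: "?w (K q) \<ge> 0" by (rule post_widder_integrable(2)[OF N n])
  have nonneg: "0 \<le> q - p - 1 / n" using pqs n by (simp add: field_simps)
  have nonneg': "0 \<le> s - q + 1 / n" using pqs n by (intro add_nonneg_nonneg) auto
  have "(W s - W q) * (q - p - 1 / n) \<le> (real (K s - K q) * ?w (K q)) * (q - p - 1 / n)"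
    by (intro mult_right_mono up nonneg)
  also have "\<dots> \<le> (n * (s - q + 1 / n) * ?w (K q)) * (q - p - 1 / n)"
    using Kr(2)[of s] Kr(1)[of q] pqs n Kmono
    by (intro mult_right_mono nonneg nonneg' w0) (simp add: of_nat_diff algebra_simps)
  also have "\<dots> = (n * (q - p - 1 / n)) * ?w (K q) * (s - q + 1 / n)" by (simp add: mult_ac)
  also have "\<dots> \<le> real (K q - K p) * ?w (K q) * (s - q + 1 / n)"
    using Kr(2)[of p] Kr(1)[of q] pqs n Kmono
    by (intro mult_right_mono nonneg nonneg' w0) (simp add: of_nat_diff algebra_simps)
  also have "\<dots> \<le> (W q - W p) * (s - q + 1 / n)"
    by (intro mult_right_mono low nonneg')
  finally show ?thesis .
qed

text \<open>The Laplace transforms of the lattice approximations converge, because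
  \<open>n * (1 - exp (- u / n))\<close> tends to \<open>u\<close>; hence concavity passes to the limit.  The continuity
  theorem compares shifted arguments, and the shift \<open>d\<close> is removed by right-continuity.\<close>

lemma laplace_concave_slopes:
  assumes N: "has_laplace N f"
    and diff: "\<And>k x. x > 0 \<Longrightarrow> (deriv ^^ k) (\<lambda>x. x * f x) differentiable (at x)"
    and sign: "\<And>k x. 1 \<le> k \<Longrightarrow> x > 0 \<Longrightarrow> (-1) ^ k * (deriv ^^ k) (\<lambda>x. x * f x) x \<le> 0"
    and pqs: "0 < p" "p < q" "q < s"
  defines "U \<equiv> \<lambda>x. measure N {..x}"
  shows "(U s - U q) * (q - p) \<le> (U q - U p) * (s - q)"
proof -
  define n where "n = (\<lambda>m. real (Suc m))"
  define W where "W = (\<lambda>m x. measure (post_widder_measure N (n m)) {..x})"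
  have n: "n m > 0" for m by (simp add: n_def)
  have isCont_f: "isCont f u" if "u > 0" for u
  proof -
    have "isCont (\<lambda>x. x * f x) u" using diff[OF that, of 0] differentiable_imp_continuous_within by auto
    then have "isCont (\<lambda>x. x * f x / x) u" using that by (intro isCont_divide continuous_ident) auto
    moreover have "\<forall>\<^sub>F x in nhds u. x * f x / x = f x"
      by (rule eventually_mono[OF eventually_nhds_in_open[of "{0<..}" u]]) (use that in auto)
    ultimately show ?thesis by (subst (asm) isCont_cong)
  qed
  have lim: "(\<lambda>m. f (n m * (1 - exp (- u / n m)))) \<longlonglongrightarrow> f u" if "u > 0" for u
  proof (rule isCont_tendsto_compose[OF isCont_f[OF that]])
    show "(\<lambda>m. n m * (1 - exp (- u / n m))) \<longlonglongrightarrow> u" unfolding n_def by real_asymp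
  qed
  have main: "(U s - U (q + 2 * d) - 2 * d) * (q - p) \<le> (U (q + 2 * d) - U p + 2 * d) * (s - q)"
    if d: "d > 0" for d
  proof -
    have ev: "\<forall>\<^sub>F m in sequentially. W m a \<le> U b + d \<and> U a \<le> W m b + d" if "a < b" for a b
      unfolding W_def U_def
      by (rule laplace_continuity[where f="\<lambda>m u. f (n m * (1 - exp (- u / n m)))", OF _ N _ that d])
         (use post_widder_measure_laplace[OF N n] lim in auto)
    define A where "A = U s - U (q + 2 * d) - 2 * d"
    define B where "B = U (q + 2 * d) - U p + 2 * d"
    have pts: "q + d < q + 2 * d" "s < s + d" "p < p + d" using d by auto
    have "\<forall>\<^sub>F m in sequentially. 1 / (q - p) \<le> n m" unfolding n_def by real_asymp
    then have ineq: "\<forall>\<^sub>F m in sequentially. A * (q - p - 1 / n m) \<le> B * (s - q + 1 / n m)"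
      using ev[OF pts(1)] ev[OF pts(2)] ev[OF pts(3)]
    proof eventually_elim
      case (elim m)
      have 1: "n m * (q - p) \<ge> 1" using elim(1) pqs by (simp add: field_simps)
      have nonneg: "0 \<le> q - p - 1 / n m" using 1 n[of m] by (simp add: field_simps)
      have nonneg': "0 \<le> s - q + 1 / n m" using n[of m] pqs by (intro add_nonneg_nonneg) auto
      have "A * (q - p - 1 / n m) \<le> (W m (s + d) - W m (q + d)) * (q - p - 1 / n m)"
        using elim d by (intro mult_right_mono nonneg) (auto simp: A_def)
      also have "\<dots> \<le> (W m (q + d) - W m (p + d)) * (s - q + 1 / n m)"
        using post_widder_slopes[OF N n post_widder_decreasing[OF N n diff sign], of "p + d" "q + d" "s
            + d" m] pqs d 1
        unfolding W_def by (simp add: algebra_simps)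
      also have "\<dots> \<le> B * (s - q + 1 / n m)"
        using elim d by (intro mult_right_mono nonneg') (auto simp: B_def)
      finally show ?case .
    qed
    have "(\<lambda>m. 1 / n m) \<longlonglongrightarrow> 0" unfolding n_def by real_asymp
    then have "(\<lambda>m. A * (q - p - 1 / n m)) \<longlonglongrightarrow> A * (q - p - 0)" "(\<lambda>m. B * (s - q + 1 / n m)) \<longlonglongrightarrow> B * (s - q + 0)"
      by (intro tendsto_intros; simp)+
    from tendsto_le[OF _ this(2,1) ineq] show ?thesis by (simp add: A_def B_def)
  qed
  have rc: "(U \<longlongrightarrow> U q) (at_right q)" using has_laplace_right_cont[OF N, of q] by (simp add: U_def)
  have "((\<lambda>d. U (q + 2 * d)) \<longlongrightarrow> U q) (at_right 0)"
  proof (rule filterlim_compose[OF rc])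
    show "filterlim (\<lambda>d. q + 2 * d) (at_right q) (at_right 0)" by real_asymp
  qed
  then have "((\<lambda>d. (U s - U (q + 2 * d) - 2 * d) * (q - p)) \<longlongrightarrow> (U s - U q - 2 * 0) * (q - p)) (at_right 0)"
    "((\<lambda>d. (U (q + 2 * d) - U p + 2 * d) * (s - q)) \<longlongrightarrow> (U q - U p + 2 * 0) * (s - q)) (at_right 0)"
    by (intro tendsto_intros; simp)+
  note lims = this
  have "\<forall>\<^sub>F d in at_right 0. (U s - U (q + 2 * d) - 2 * d) * (q - p)
      \<le> (U (q + 2 * d) - U p + 2 * d) * (s - q)"
    using eventually_at_right_less[of 0] by eventually_elim (rule main)
  from tendsto_le[OF _ lims(2,1) this] show ?thesis by simp
qed

text \<open>The density appears as a supergradient of the concave distribution function.  The two inequalities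
  say that it is decreasing and that its integrals are the increments of the distribution function.\<close>

lemma laplace_monotone_density:
  assumes N: "has_laplace N f"
    and diff: "\<And>k x. x > 0 \<Longrightarrow> (deriv ^^ k) (\<lambda>x. x * f x) differentiable (at x)"
    and sign: "\<And>k x. 1 \<le> k \<Longrightarrow> x > 0 \<Longrightarrow> (-1) ^ k * (deriv ^^ k) (\<lambda>x. x * f x) x \<le> 0"
  shows "\<exists>v. \<forall>a b. 0 < a \<longrightarrow> a < b \<longrightarrow>
     v b * (b - a) \<le> measure N {..b} - measure N {..a} \<and> measure N {..b} - measure N {..a} \<le> v a * (b - a)"
proof -
  define U where "U = (\<lambda>x. measure N {..x})"
  have "convex_on {0<..} (\<lambda>x. - U x)"
  proof (rule convex_on_linorderI)
    fix t x y :: real assume t: "0 < t" "t < 1" and xy: "x \<in> {0<..}" "y \<in> {0<..}" "x < y"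
    define q where "q = (1 - t) *\<^sub>R x + t *\<^sub>R y"
    have q: "q - x = t * (y - x)" "y - q = (1 - t) * (y - x)" by (simp_all add: q_def algebra_simps)
    have "0 < q - x" "0 < y - q" unfolding q using t xy by auto
    then have "(U y - U q) * (q - x) \<le> (U q - U x) * (y - q)"
      unfolding U_def using xy by (intro laplace_concave_slopes[OF N diff sign]) auto
    then have "((U y - U q) * t) * (y - x) \<le> ((U q - U x) * (1 - t)) * (y - x)" by (simp add: q mult_ac)
    then have "(U y - U q) * t \<le> (U q - U x) * (1 - t)" using xy by (simp add: mult_le_cancel_right)
    then show "- U ((1 - t) *\<^sub>R x + t *\<^sub>R y) \<le> (1 - t) * - U x + t * - U y"
      unfolding q_def[symmetric] by (simp add: algebra_simps)
  qed simp
  note cv = convex_le_Inf_differential[OF this]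
  define v where "v = (\<lambda>x. - Inf ((\<lambda>t. (- U x - - U t) / (x - t)) ` ({x<..} \<inter> {0<..})))"
  have "U y \<le> U x + v x * (y - x)" if "x > 0" "y > 0" for x y
    using cv[of x y] that by (simp add: v_def interior_open)
  then have "v b * (b - a) \<le> U b - U a \<and> U b - U a \<le> v a * (b - a)" if "0 < a" "a < b" for a b
    using that by (smt (verit, ccfv_SIG) mult_minus_right minus_diff_eq)
  then show ?thesis unfolding U_def by blast
qed

section \<open>Path properties of killed subordinators\<close>

text \<open>Independence of increments is applied to the partition \<open>0, s, s + h\<close>, and \<open>X 0 = 0\<close> almost surely.\<close>

lemma levy_increment_independent:
  assumes levy: "levy_process M X" and s: "0 < s" and h: "0 < h"
  shows "distr M (borel \<Otimes>\<^sub>M borel) (\<lambda>\<omega>. (X s \<omega>, X (s + h) \<omega> - X s \<omega>)) = distr M borel (X s) \<Otimes>\<^sub>M distr M borel (X h)"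
proof -
  interpret prob_space M using levy by (simp add: levy_process_def)
  have X[measurable]: "X r \<in> borel_measurable M" if "0 \<le> r" for r
    using levy that by (simp add: levy_process_def)
  have X0: "AE \<omega> in M. X 0 \<omega> = 0" using levy by (simp add: levy_process_def)
  have [measurable]: "X s \<in> borel_measurable M" "X h \<in> borel_measurable M" "X (s + h) \<in> borel_measurable M"
    "X 0 \<in> borel_measurable M" using s h by auto
  define t where "t = (\<lambda>n::nat. if n = 0 then 0 else if n = 1 then s else s + h)"
  have "0 \<le> t 0 \<and> (\<forall>i<2. t i < t (Suc i))"
    using s h by (auto simp: t_def less_2_cases_iff)
  moreover have "\<forall>n (t::nat \<Rightarrow> real). 0 \<le> t 0 \<and> (\<forall>i<n. t i < t (Suc i)) \<longrightarrow>
        indep_vars (\<lambda>_. borel) (\<lambda>i \<omega>. X (t (Suc i)) \<omega> - X (t i) \<omega>) {..<n}"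
    using levy by (simp add: levy_process_def)
  ultimately have ind: "indep_vars (\<lambda>_. borel) (\<lambda>i \<omega>. X (t (Suc i)) \<omega> - X (t i) \<omega>) {..<2}"
    by blast
  have stat: "distr M borel (\<lambda>\<omega>. X (s + h) \<omega> - X s \<omega>) = distr M borel (X h)"
    using levy s h by (simp add: levy_process_def)
  have "distr M borel (X s) \<Otimes>\<^sub>M distr M borel (X h)
      = distr M (borel \<Otimes>\<^sub>M borel) (\<lambda>\<omega>. (X s \<omega>, X (s + h) \<omega> - X s \<omega>))"
  proof (rule pair_measure_eqI)
    interpret Xs: prob_space "distr M borel (X s)" by (rule prob_space_distr) measurable
    interpret Xh: prob_space "distr M borel (X h)" by (rule prob_space_distr) measurable
    show "sigma_finite_measure (distr M borel (X s))" "sigma_finite_measure (distr M borel (X h))"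
      by unfold_locales
    show "sets (distr M borel (X s) \<Otimes>\<^sub>M distr M borel (X h))
       = sets (distr M (borel \<Otimes>\<^sub>M borel) (\<lambda>\<omega>. (X s \<omega>, X (s + h) \<omega> - X s \<omega>)))"
      by (simp cong: sets_pair_measure_cong)
    fix A B assume "A \<in> sets (distr M borel (X s))" "B \<in> sets (distr M borel (X h))"
    then have [measurable]: "A \<in> sets borel" "B \<in> sets borel" by auto
    let ?Y = "\<lambda>i \<omega>. X (t (Suc i)) \<omega> - X (t i) \<omega>"
    let ?C = "\<lambda>i::nat. if i = 0 then A else B"
    have two: "{..<2} = {0, 1::nat}" by auto
    have eq: "emeasure M {\<omega>\<in>space M. X s \<omega> - X 0 \<omega> \<in> A} = emeasure M {\<omega>\<in>space M. X s \<omega> \<in> A}"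
      using X0 by (intro emeasure_eq_AE) auto
    have eq2: "emeasure M {\<omega>\<in>space M. X s \<omega> - X 0 \<omega> \<in> A \<and> X (s + h) \<omega> - X s \<omega> \<in> B}
        = emeasure M {\<omega>\<in>space M. X s \<omega> \<in> A \<and> X (s + h) \<omega> - X s \<omega> \<in> B}"
      using X0 by (intro emeasure_eq_AE) auto
    have eq3: "emeasure M {\<omega>\<in>space M. X (s + h) \<omega> - X s \<omega> \<in> B} = emeasure M {\<omega>\<in>space M. X h \<omega> \<in> B}"
      using arg_cong[OF stat, of "\<lambda>D. emeasure D B"] by (simp add: emeasure_distr vimage_def Int_def conj_commute)
    have "prob (\<Inter>i\<in>{..<2}. ?Y i -` ?C i \<inter> space M) = (\<Prod>i<2. prob (?Y i -` ?C i \<inter> space M))"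
      by (rule indep_varsD[OF ind]) (auto simp: two)
    moreover have "(\<Inter>i\<in>{..<2}. ?Y i -` ?C i \<inter> space M) = {\<omega>\<in>space M. X s \<omega> - X 0 \<omega> \<in> A \<and> X (s + h) \<omega> - X s \<omega> \<in> B}"
      by (auto simp: two t_def)
    moreover have "(\<Prod>i<2. prob (?Y i -` ?C i \<inter> space M))
       = prob {\<omega>\<in>space M. X s \<omega> - X 0 \<omega> \<in> A} * prob {\<omega>\<in>space M. X (s + h) \<omega> - X s \<omega> \<in> B}"
      by (simp add: two t_def vimage_def Int_def conj_commute)
    ultimately have "emeasure M {\<omega>\<in>space M. X s \<omega> - X 0 \<omega> \<in> A \<and> X (s + h) \<omega> - X s \<omega> \<in> B}
       = emeasure M {\<omega>\<in>space M. X s \<omega> - X 0 \<omega> \<in> A} * emeasure M {\<omega>\<in>space M. X (s + h) \<omega> - X s \<omega> \<in> B}"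
      by (simp add: emeasure_eq_measure ennreal_mult)
    then show "emeasure (distr M borel (X s)) A * emeasure (distr M borel (X h)) B =
       emeasure (distr M (borel \<Otimes>\<^sub>M borel) (\<lambda>\<omega>. (X s \<omega>, X (s + h) \<omega> - X s \<omega>))) (A \<times> B)"
      unfolding eq eq2 eq3 by (simp add: emeasure_distr vimage_def Int_def conj_commute conj_left_commute)
  qed
  then show ?thesis by simp
qed

lemma levy_markov:
  assumes levy: "levy_process M X" and s: "0 < s" and h: "0 < h"
  shows "emeasure M {\<omega>\<in>space M. X s \<omega> \<le> x \<and> X (s + h) \<omega> \<le> t}
    = (\<integral>\<^sup>+b. emeasure M {\<omega>\<in>space M. X s \<omega> \<le> x \<and> X s \<omega> + b \<le> t} \<partial>distr M borel (X h))"
proof -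
  interpret prob_space M using levy by (simp add: levy_process_def)
  have [measurable]: "X s \<in> borel_measurable M" "X h \<in> borel_measurable M" "X (s + h) \<in> borel_measurable M"
    using levy s h by (auto simp: levy_process_def)
  interpret Xs: prob_space "distr M borel (X s)" by (rule prob_space_distr) measurable
  interpret Xh: prob_space "distr M borel (X h)" by (rule prob_space_distr) measurable
  interpret pair_sigma_finite "distr M borel (X s)" "distr M borel (X h)" ..
  define C where "C = {p :: real \<times> real. fst p \<le> x \<and> fst p + snd p \<le> t}"
  have C: "C \<in> sets (borel \<Otimes>\<^sub>M borel)"
  proof -
    have "{p \<in> space (borel \<Otimes>\<^sub>M borel). fst p \<le> x \<and> fst p + snd p \<le> t} \<in> sets (borel \<Otimes>\<^sub>M borel)" by measurable
    then show ?thesis by (simp add: C_def space_pair_measure)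
  qed
  have "emeasure M {\<omega>\<in>space M. X s \<omega> \<le> x \<and> X (s + h) \<omega> \<le> t}
     = emeasure (distr M (borel \<Otimes>\<^sub>M borel) (\<lambda>\<omega>. (X s \<omega>, X (s + h) \<omega> - X s \<omega>))) C"
    using C by (subst emeasure_distr) (auto simp: C_def intro!: arg_cong[where f="emeasure M"])
  also have "\<dots> = (\<integral>\<^sup>+b. emeasure (distr M borel (X s)) ((\<lambda>a. (a, b)) -` C) \<partial>distr M borel (X h))"
    unfolding levy_increment_independent[OF assms] using C
    by (intro emeasure_pair_measure_alt2) (simp cong: sets_pair_measure_cong)
  also have "\<dots> = (\<integral>\<^sup>+b. emeasure M {\<omega>\<in>space M. X s \<omega> \<le> x \<and> X s \<omega> + b \<le> t} \<partial>distr M borel (X h))"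
  proof (intro nn_integral_cong)
    fix b
    have "(\<lambda>a. (a, b)) -` C \<in> sets borel" using C by (rule measurable_sets_borel[rotated]) measurable
    then show "emeasure (distr M borel (X s)) ((\<lambda>a. (a, b)) -` C) = emeasure M {\<omega>\<in>space M. X s \<omega> \<le> x \<and> X s \<omega> + b \<le> t}"
      by (subst emeasure_distr) (auto simp: C_def intro!: arg_cong[where f="emeasure M"])
  qed
  finally show ?thesis .
qed

text \<open>
  An infinite lifetime describes the process that is not killed, so that no case distinction is needed
  from here on.\<close>

lemma killed_subordinator_lifetime:
  assumes "killed_subordinator M \<tau>"
  obtains X \<zeta> where "levy_process M X" "\<And>s \<omega>. 0 \<le> s \<Longrightarrow> \<omega> \<in> space M \<Longrightarrow> 0 \<le> X s \<omega>"
    and "\<And>s \<omega>. 0 \<le> s \<Longrightarrow> \<omega> \<in> space M \<Longrightarrow> \<tau> s \<omega> = (if ereal s < \<zeta> \<omega> then ennreal (X s \<omega>) else \<infinity>)"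
    and "\<And>s. 0 \<le> s \<Longrightarrow> {\<omega>\<in>space M. ereal s < \<zeta> \<omega>} \<in> sets M"
    and "\<And>s h. 0 \<le> s \<Longrightarrow> 0 \<le> h \<Longrightarrow> emeasure M {\<omega>\<in>space M. ereal (s + h) < \<zeta> \<omega>}
        = emeasure M {\<omega>\<in>space M. ereal s < \<zeta> \<omega>} * emeasure M {\<omega>\<in>space M. ereal h < \<zeta> \<omega>}"
    and "\<And>u s r C. 0 \<le> u \<Longrightarrow> 0 \<le> s \<Longrightarrow> 0 \<le> r \<Longrightarrow> C \<in> sets (borel \<Otimes>\<^sub>M borel) \<Longrightarrow>
        emeasure M {\<omega>\<in>space M. ereal u < \<zeta> \<omega> \<and> (X s \<omega>, X r \<omega>) \<in> C}
        = emeasure M {\<omega>\<in>space M. ereal u < \<zeta> \<omega>} * emeasure M {\<omega>\<in>space M. (X s \<omega>, X r \<omega>) \<in> C}"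
proof -
  obtain X where X: "levy_process M X" "\<And>s \<omega>. 0 \<le> s \<Longrightarrow> \<omega> \<in> space M \<Longrightarrow> 0 \<le> X s \<omega>"
    and alt: "((\<forall>s\<ge>0. \<forall>\<omega>\<in>space M. \<tau> s \<omega> = ennreal (X s \<omega>)) \<or>
        (\<exists>q T. 0 < q \<and> distributed M lborel T (exponential_density q) \<and> indep_of_process M T X \<and>
          (\<forall>s\<ge>0. \<forall>\<omega>\<in>space M. \<tau> s \<omega> = (if s < T \<omega> then ennreal (X s \<omega>) else \<infinity>))))"
    using assms unfolding killed_subordinator_def by blast
  interpret prob_space M using X(1) by (simp add: levy_process_def)
  from alt show ?thesis
  proof (elim disjE exE conjE)
    assume "\<forall>s\<ge>0. \<forall>\<omega>\<in>space M. \<tau> s \<omega> = ennreal (X s \<omega>)"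
    then show ?thesis using X by (intro that[of X "\<lambda>_. \<infinity>"]) (auto simp: emeasure_space_1)
  next
    fix q T assume q: "0 < q" and T: "distributed M lborel T (exponential_density q)"
      and ind: "indep_of_process M T X"
      and tau: "\<forall>s\<ge>0. \<forall>\<omega>\<in>space M. \<tau> s \<omega> = (if s < T \<omega> then ennreal (X s \<omega>) else \<infinity>)"
    have [measurable]: "T \<in> borel_measurable M" using T by (auto simp: distributed_def)
    have gt: "emeasure M {\<omega>\<in>space M. u < T \<omega>} = ennreal (exp (- u * q))" if "0 \<le> u" for u
      using exponential_distributedD_gt[OF T that q] by (simp add: emeasure_eq_measure)
    show ?thesis
    proof (rule that[of X "\<lambda>\<omega>. ereal (T \<omega>)", OF X])
      fix s h :: real assume "0 \<le> s" "0 \<le> h"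
      then show "emeasure M {\<omega>\<in>space M. ereal (s + h) < ereal (T \<omega>)}
        = emeasure M {\<omega>\<in>space M. ereal s < ereal (T \<omega>)} * emeasure M {\<omega>\<in>space M. ereal h < ereal (T \<omega>)}"
        by (simp add: gt ennreal_mult[symmetric] exp_add[symmetric] algebra_simps)
    next
      fix u s r :: real and C :: "(real \<times> real) set"
      assume u: "0 \<le> u" "0 \<le> s" "0 \<le> r" and C: "C \<in> sets (borel \<Otimes>\<^sub>M borel)"
      \<comment> \<open>Survival beyond \<open>u\<close> is an event of the killing time, the other event is determined by two coordinates
  of the process.\<close>
      let ?A = "T -` {u<..} \<inter> space M"
      let ?f = "\<lambda>\<omega>. \<lambda>s\<in>{0..}. X s \<omega>"
      let ?D = "{f \<in> space (\<Pi>\<^sub>M s\<in>{0..}. borel). (f s, f r) \<in> C}"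
      have A: "?A \<in> sets (vimage_algebra (space M) T borel)" by (rule in_vimage_algebra) simp
      have "?D \<in> sets (\<Pi>\<^sub>M s\<in>{0..}. borel)"
      proof -
        have "(\<lambda>f. (f s, f r)) \<in> (\<Pi>\<^sub>M s\<in>{0..}. borel) \<rightarrow>\<^sub>M borel \<Otimes>\<^sub>M borel"
          using u by (intro measurable_Pair measurable_component_singleton) auto
        from measurable_sets[OF this C] show ?thesis by (simp add: vimage_def Int_def conj_commute)
      qed
      then have B: "?f -` ?D \<inter> space M \<in> sets (vimage_algebra (space M) ?f (\<Pi>\<^sub>M s\<in>{0..}. borel))"
        by (rule in_vimage_algebra)
      have "prob (?A \<inter> (?f -` ?D \<inter> space M)) = prob ?A * prob (?f -` ?D \<inter> space M)"
        using ind A B unfolding indep_of_process_def by (intro indep_setD)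
      moreover have "?A \<inter> (?f -` ?D \<inter> space M) = {\<omega>\<in>space M. ereal u < ereal (T \<omega>) \<and> (X s \<omega>, X r \<omega>) \<in> C}"
        "?A = {\<omega>\<in>space M. ereal u < ereal (T \<omega>)}"
        "?f -` ?D \<inter> space M = {\<omega>\<in>space M. (X s \<omega>, X r \<omega>) \<in> C}"
        using u by (auto simp: space_PiM)
      ultimately show "emeasure M {\<omega>\<in>space M. ereal u < ereal (T \<omega>) \<and> (X s \<omega>, X r \<omega>) \<in> C}
        = emeasure M {\<omega>\<in>space M. ereal u < ereal (T \<omega>)} * emeasure M {\<omega>\<in>space M. (X s \<omega>, X r \<omega>) \<in> C}"
        by (simp add: emeasure_eq_measure ennreal_mult)
    qed (use tau in auto)
  qed
qed

definition killed_exp :: "real \<Rightarrow> ennreal \<Rightarrow> ennreal" where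
  "killed_exp u z = (if z = \<infinity> then 0 else ennreal (exp (- u * enn2real z)))"

lemma killed_exp_measurable [measurable]: "killed_exp u \<in> borel_measurable borel"
  unfolding killed_exp_def by measurable

lemma killed_exp_simps [simp]: "killed_exp u \<infinity> = 0" "x \<ge> 0 \<Longrightarrow> killed_exp u (ennreal x) = ennreal (exp (- u * x))"
  by (auto simp: killed_exp_def)

text \<open>The properties of a possibly killed subordinator on which everything below rests.  Killing is
  absorbed into the value \<open>\<infinity>\<close>: the Markov property compares \<open>\<tau> (s + h)\<close> with the sum of \<open>\<tau> s\<close> and an
  independent copy of \<open>\<tau> h\<close>, and \<open>\<infinity>\<close> is absorbing both for the process and for addition.
  Paths are right-continuous for every \<open>\<omega>\<close> but increasing only for almost every \<open>\<omega>\<close>.\<close>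

locale subordinator = prob_space M for M :: "'w measure" +
  fixes \<tau> :: "real \<Rightarrow> 'w \<Rightarrow> ennreal" and \<Phi> :: "real \<Rightarrow> real"
  assumes meas: "0 \<le> s \<Longrightarrow> \<tau> s \<in> borel_measurable M"
    and right_cont: "\<omega> \<in> space M \<Longrightarrow> 0 \<le> s \<Longrightarrow> ((\<lambda>r. \<tau> r \<omega>) \<longlongrightarrow> \<tau> s \<omega>) (at_right s)"
    and increasing: "AE \<omega> in M. \<forall>s r. 0 \<le> s \<longrightarrow> s \<le> r \<longrightarrow> \<tau> s \<omega> \<le> \<tau> r \<omega>"
    and markov: "0 < s \<Longrightarrow> 0 < h \<Longrightarrow> 0 \<le> x \<Longrightarrow> 0 \<le> t \<Longrightarrow>
       emeasure M {\<omega>\<in>space M. \<tau> s \<omega> \<le> ennreal x \<and> \<tau> (s + h) \<omega> \<le> ennreal t}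
       = (\<integral>\<^sup>+\<omega>'. emeasure M {\<omega>\<in>space M. \<tau> s \<omega> \<le> ennreal x \<and> \<tau> s \<omega> + \<tau> h \<omega>' \<le> ennreal t} \<partial>M)"
    and laplace: "0 < u \<Longrightarrow> 0 < s \<Longrightarrow> (\<integral>\<^sup>+\<omega>. killed_exp u (\<tau> s \<omega>) \<partial>M) = ennreal (exp (- \<Phi> u * s))"
    and nonzero: "\<exists>u>0. \<Phi> u \<noteq> 0"

text \<open>Increments are almost surely nonnegative for countably many pairs of rational times, and
  right-continuity extends this to all times.\<close>

lemma levy_increasing:
  assumes levy: "levy_process M X" and nonneg: "\<And>s \<omega>. 0 \<le> s \<Longrightarrow> \<omega> \<in> space M \<Longrightarrow> 0 \<le> X s \<omega>"
  shows "AE \<omega> in M. \<forall>s r. 0 \<le> s \<longrightarrow> s \<le> r \<longrightarrow> X s \<omega> \<le> X r \<omega>"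
proof -
  have X: "X r \<in> borel_measurable M" if "0 \<le> r" for r
    using levy that by (simp add: levy_process_def)
  have "AE \<omega> in M. X p \<omega> \<le> X (p + h) \<omega>" if "0 \<le> p" "0 \<le> h" for p h
  proof -
    have [measurable]: "X p \<in> borel_measurable M" "X h \<in> borel_measurable M" "X (p + h) \<in> borel_measurable M"
      using that X by auto
    have "AE x in distr M borel (X h). 0 \<le> x"
      using nonneg[OF that(2)] by (subst AE_distr_iff) auto
    also have "distr M borel (X h) = distr M borel (\<lambda>\<omega>. X (p + h) \<omega> - X p \<omega>)"
      using levy that by (simp add: levy_process_def)
    finally show ?thesis by (subst (asm) AE_distr_iff) auto
  qed
  from this[of "real_of_rat p" "real_of_rat (q - p)" for p q]
  have "AE \<omega> in M. 0 \<le> p \<longrightarrow> p \<le> q \<longrightarrow> X (real_of_rat p) \<omega> \<le> X (real_of_rat q) \<omega>" for p q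
    by (cases "0 \<le> p \<and> p \<le> q") (auto simp flip: of_rat_add)
  then have "AE \<omega> in M. \<forall>p q. 0 \<le> p \<longrightarrow> p \<le> q \<longrightarrow> X (real_of_rat p) \<omega> \<le> X (real_of_rat q) \<omega>"
    by (simp add: AE_all_countable)
  then show ?thesis
  proof (rule AE_mp, intro AE_I2 impI allI)
    fix \<omega> s r assume \<omega>: "\<omega> \<in> space M" and rat: "\<forall>p q. 0 \<le> p \<longrightarrow> p \<le> q \<longrightarrow> X (real_of_rat p) \<omega> \<le> X (real_of_rat q) \<omega>"
      and sr: "0 \<le> s" "(s::real) \<le> r"
    have rc: "((\<lambda>r. X r \<omega>) \<longlongrightarrow> X s \<omega>) (at_right s)" if "0 \<le> s" for s
      using levy \<omega> that by (auto simp: levy_process_def cadlag_def continuous_within)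
    show "X s \<omega> \<le> X r \<omega>"
    proof (rule ccontr)
      assume "\<not> X s \<omega> \<le> X r \<omega>"
      then have less: "X r \<omega> < X s \<omega>" by simp
      define m where "m = (X r \<omega> + X s \<omega>) / 2"
      have m: "X r \<omega> < m" "m < X s \<omega>" using less by (auto simp: m_def)
      have "s < r" using less sr by (cases "s = r") auto
      obtain b where b: "b > s" "\<And>p. s < p \<Longrightarrow> p < b \<Longrightarrow> m < X p \<omega>"
        using order_tendstoD(1)[OF rc[OF sr(1)] m(2)] by (auto simp: eventually_at_right_field)
      obtain c where c: "c > r" "\<And>p. r < p \<Longrightarrow> p < c \<Longrightarrow> X p \<omega> < m"
        using order_tendstoD(2)[OF rc m(1)] sr by (auto simp: eventually_at_right_field)
      obtain p where p: "s < real_of_rat p" "real_of_rat p < min b r"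
        using of_rat_dense[of s "min b r"] b \<open>s < r\<close> by auto
      obtain q where q: "r < real_of_rat q" "real_of_rat q < c"
        using of_rat_dense[of r c] c by auto
      have "0 < real_of_rat p" using order.strict_trans1[OF sr(1) p(1)] .
      moreover have "real_of_rat p < real_of_rat q" using p(2) q(1) by linarith
      ultimately have "0 \<le> p" "p \<le> q" by (simp_all add: of_rat_less)
      then have "X (real_of_rat p) \<omega> \<le> X (real_of_rat q) \<omega>" using rat by blast
      with b(2)[of "real_of_rat p"] c(2)[of "real_of_rat q"] p q show False by auto
    qed
  qed
qed

text \<open>The Markov property of the killed process combines that of the Levy process with the
  lack of memory of the lifetime, which is independent of the Levy process.\<close>

lemma killed_subordinator_imp_subordinator:
  assumes sub: "killed_subordinator M \<tau>" and lap: "has_laplace_exponent M \<tau> \<Phi>" and nz: "\<exists>u>0. \<Phi> u \<noteq> 0"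
  shows "subordinator M \<tau> \<Phi>"
proof -
  obtain X \<zeta> where X: "levy_process M X" "\<And>s \<omega>. 0 \<le> s \<Longrightarrow> \<omega> \<in> space M \<Longrightarrow> 0 \<le> X s \<omega>"
    and tau: "\<And>s \<omega>. 0 \<le> s \<Longrightarrow> \<omega> \<in> space M \<Longrightarrow> \<tau> s \<omega> = (if ereal s < \<zeta> \<omega> then ennreal (X s \<omega>) else \<infinity>)"
    and A: "\<And>s. 0 \<le> s \<Longrightarrow> {\<omega>\<in>space M. ereal s < \<zeta> \<omega>} \<in> sets M"
    and mult: "\<And>s h. 0 \<le> s \<Longrightarrow> 0 \<le> h \<Longrightarrow> emeasure M {\<omega>\<in>space M. ereal (s + h) < \<zeta> \<omega>}
        = emeasure M {\<omega>\<in>space M. ereal s < \<zeta> \<omega>} * emeasure M {\<omega>\<in>space M. ereal h < \<zeta> \<omega>}"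
    and ind: "\<And>u s r C. 0 \<le> u \<Longrightarrow> 0 \<le> s \<Longrightarrow> 0 \<le> r \<Longrightarrow> C \<in> sets (borel \<Otimes>\<^sub>M borel) \<Longrightarrow>
        emeasure M {\<omega>\<in>space M. ereal u < \<zeta> \<omega> \<and> (X s \<omega>, X r \<omega>) \<in> C}
        = emeasure M {\<omega>\<in>space M. ereal u < \<zeta> \<omega>} * emeasure M {\<omega>\<in>space M. (X s \<omega>, X r \<omega>) \<in> C}"
    by (rule killed_subordinator_lifetime[OF sub]) blast
  interpret prob_space M using X(1) by (simp add: levy_process_def)
  have Xm: "X r \<in> borel_measurable M" if "0 \<le> r" for r
    using X(1) that by (simp add: levy_process_def)
  have meas: "\<tau> s \<in> borel_measurable M" if "0 \<le> s" for s
  proof -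
    have [measurable]: "X s \<in> borel_measurable M" "Measurable.pred M (\<lambda>\<omega>. ereal s < \<zeta> \<omega>)"
      using A[OF that] Xm[OF that] by (auto simp: pred_def)
    have "(\<lambda>\<omega>. if ereal s < \<zeta> \<omega> then ennreal (X s \<omega>) else \<infinity>) \<in> borel_measurable M" by measurable
    then show ?thesis using tau[OF that] by (subst measurable_cong)
  qed
  have X_inc: "AE \<omega> in M. \<forall>s r. 0 \<le> s \<longrightarrow> s \<le> r \<longrightarrow> X s \<omega> \<le> X r \<omega>"
    by (rule levy_increasing[OF X(1)]) (rule X(2))
  show ?thesis
  proof
    show "\<tau> s \<in> borel_measurable M" if "0 \<le> s" for s by (rule meas[OF that])
    show "((\<lambda>r. \<tau> r \<omega>) \<longlongrightarrow> \<tau> s \<omega>) (at_right s)" if \<omega>: "\<omega> \<in> space M" and s: "0 \<le> s" for \<omega> s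
    proof (cases "ereal s < \<zeta> \<omega>")
      case True
      have "((\<lambda>r. ennreal (X r \<omega>)) \<longlongrightarrow> ennreal (X s \<omega>)) (at_right s)"
        using X(1) \<omega> s by (intro tendsto_ennrealI) (auto simp: levy_process_def cadlag_def continuous_within)
      moreover have "\<forall>\<^sub>F r in at_right s. ennreal (X r \<omega>) = \<tau> r \<omega>"
      proof -
        obtain b where b: "s < b" "ereal b < \<zeta> \<omega>"
          using ereal_dense2[OF True] by auto
        then have "\<forall>\<^sub>F r in at_right s. r < b" by (auto simp: eventually_at_right_field)
        with eventually_at_right_less[of s] show ?thesis
        proof eventually_elim
          case (elim r)
          then have "ereal r < ereal b" by simp
          then have "ereal r < \<zeta> \<omega>" using b(2) by (rule less_trans)
          then show ?case using tau[of r \<omega>] elim s \<omega> by simp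
        qed
      qed
      ultimately show ?thesis using True tau[OF s \<omega>] by (auto elim: Lim_transform_eventually)
    next
      case False
      have "\<forall>\<^sub>F r in at_right s. \<tau> s \<omega> = \<tau> r \<omega>"
        using eventually_at_right_less[of s]
      proof eventually_elim
        case (elim r)
        then have "\<not> ereal r < \<zeta> \<omega>" using False by (meson ereal_less_eq(3) less_imp_le order_le_less_trans)
        then show ?case using tau[of r \<omega>] tau[OF s \<omega>] False elim s \<omega> by simp
      qed
      then show ?thesis by (rule Lim_transform_eventually[OF tendsto_const])
    qed
    show "AE \<omega> in M. \<forall>s r. 0 \<le> s \<longrightarrow> s \<le> r \<longrightarrow> \<tau> s \<omega> \<le> \<tau> r \<omega>"
      using X_inc AE_space
    proof eventually_elim
      case (elim \<omega>)
      show ?case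
      proof (intro allI impI)
        fix s r :: real assume sr: "0 \<le> s" "s \<le> r"
        then have "ereal s \<le> ereal r" by simp
        then have "ereal r < \<zeta> \<omega> \<Longrightarrow> ereal s < \<zeta> \<omega>" by (rule order_le_less_trans)
        then show "\<tau> s \<omega> \<le> \<tau> r \<omega>"
          using elim(1) sr tau[of s \<omega>] tau[of r \<omega>] elim(2) by (auto intro!: ennreal_leI)
      qed
    qed
    show "(\<integral>\<^sup>+\<omega>. killed_exp u (\<tau> s \<omega>) \<partial>M) = ennreal (exp (- \<Phi> u * s))" if u: "0 < u" and s: "0 < s" for u s
    proof -
      have [measurable]: "\<tau> s \<in> borel_measurable M" using meas s by simp
      have "integrable M (\<lambda>\<omega>. if \<tau> s \<omega> = \<infinity> then 0 else exp (- u * enn2real (\<tau> s \<omega>)))"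
        using u by (intro integrable_const_bound[where B=1]) auto
      then have "(\<integral>\<^sup>+\<omega>. ennreal (if \<tau> s \<omega> = \<infinity> then 0 else exp (- u * enn2real (\<tau> s \<omega>))) \<partial>M) =
        ennreal (\<integral>\<omega>. (if \<tau> s \<omega> = \<infinity> then 0 else exp (- u * enn2real (\<tau> s \<omega>))) \<partial>M)"
        by (intro nn_integral_eq_integral) auto
      also have "(\<integral>\<omega>. (if \<tau> s \<omega> = \<infinity> then 0 else exp (- u * enn2real (\<tau> s \<omega>))) \<partial>M) = exp (- \<Phi> u * s)"
        using lap u s by (simp add: has_laplace_exponent_def)
      finally show ?thesis
        by (simp add: killed_exp_def if_distrib[of ennreal] cong: if_cong)
    qed
    show "\<exists>u>0. \<Phi> u \<noteq> 0" by (rule nz)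
    show "emeasure M {\<omega>\<in>space M. \<tau> s \<omega> \<le> ennreal x \<and> \<tau> (s + h) \<omega> \<le> ennreal t}
       = (\<integral>\<^sup>+\<omega>'. emeasure M {\<omega>\<in>space M. \<tau> s \<omega> \<le> ennreal x \<and> \<tau> s \<omega> + \<tau> h \<omega>' \<le> ennreal t} \<partial>M)"
      if s: "0 < s" and h: "0 < h" and x: "0 \<le> x" and t: "0 \<le> t" for s h x t
    proof -
      have [measurable]: "X s \<in> borel_measurable M" "X h \<in> borel_measurable M" "X (s + h) \<in> borel_measurable M"
        using Xm s h by auto
      define a where "a = (\<lambda>r. emeasure M {\<omega>\<in>space M. ereal r < \<zeta> \<omega>})"
      define p where "p = (\<lambda>b. emeasure M {\<omega>\<in>space M. X s \<omega> \<le> x \<and> X s \<omega> + b \<le> t})"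
      have pm[measurable]: "p \<in> borel_measurable borel" unfolding p_def by measurable
      have "emeasure M {\<omega>\<in>space M. \<tau> s \<omega> \<le> ennreal x \<and> \<tau> (s + h) \<omega> \<le> ennreal t}
        = emeasure M {\<omega>\<in>space M. ereal (s + h) < \<zeta> \<omega> \<and> (X s \<omega>, X (s + h) \<omega>) \<in> {..x} \<times> {..t}}"
      proof (rule arg_cong[where f="emeasure M"], rule Collect_cong, rule conj_cong[OF refl])
        fix \<omega> assume \<omega>: "\<omega> \<in> space M"
        have "ereal s < ereal (s + h)" using h by simp
        then have "ereal (s + h) < \<zeta> \<omega> \<Longrightarrow> ereal s < \<zeta> \<omega>" by (rule less_trans)
        then show "(\<tau> s \<omega> \<le> ennreal x \<and> \<tau> (s + h) \<omega> \<le> ennreal t) =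
          (ereal (s + h) < \<zeta> \<omega> \<and> (X s \<omega>, X (s + h) \<omega>) \<in> {..x} \<times> {..t})"
          using tau[of s \<omega>] tau[of "s + h" \<omega>] s h \<omega> x t X(2)[of s \<omega>] X(2)[of "s + h" \<omega>]
          by (auto simp: ennreal_le_iff top_unique)
      qed
      also have "\<dots> = a (s + h) * emeasure M {\<omega>\<in>space M. (X s \<omega>, X (s + h) \<omega>) \<in> {..x} \<times> {..t}}"
        unfolding a_def using s h by (intro ind) auto
      also have "emeasure M {\<omega>\<in>space M. (X s \<omega>, X (s + h) \<omega>) \<in> {..x} \<times> {..t}}
        = (\<integral>\<^sup>+b. p b \<partial>distr M borel (X h))"
        using levy_markov[OF X(1) s h, of x t] by (simp add: p_def)
      also have "a (s + h) = a s * a h" using mult[of s h] s h by (simp add: a_def)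
      finally have lhs: "emeasure M {\<omega>\<in>space M. \<tau> s \<omega> \<le> ennreal x \<and> \<tau> (s + h) \<omega> \<le> ennreal t}
        = a s * (a h * (\<integral>\<^sup>+b. p b \<partial>distr M borel (X h)))" by (simp add: mult.assoc)
      let ?A = "{\<omega>\<in>space M. ereal h < \<zeta> \<omega>}"
      have Am[measurable]: "?A \<in> sets M" using A[of h] h by simp
      \<comment> \<open>Conditionally on survival up to time \<open>h\<close>, the law of \<open>X h\<close> is unchanged.\<close>
      have dist: "distr (density M (indicator ?A)) borel (X h) = scale_measure (a h) (distr M borel (X h))"
      proof (rule measure_eqI)
        fix B assume "B \<in> sets (distr (density M (indicator ?A)) borel (X h))"
        then have [measurable]: "B \<in> sets borel" by simp
        have "emeasure (distr (density M (indicator ?A)) borel (X h)) B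
            = (\<integral>\<^sup>+\<omega>. indicator ?A \<omega> * indicator (X h -` B \<inter> space M) \<omega> \<partial>M)"
          by (simp add: emeasure_distr emeasure_density)
        also have "\<dots> = (\<integral>\<^sup>+\<omega>. indicator (?A \<inter> (X h -` B \<inter> space M)) \<omega> \<partial>M)"
          by (simp add: indicator_inter_arith)
        also have "\<dots> = emeasure M (?A \<inter> (X h -` B \<inter> space M))"
          by (rule nn_integral_indicator) measurable
        also have "?A \<inter> (X h -` B \<inter> space M) = {\<omega>\<in>space M. ereal h < \<zeta> \<omega> \<and> (X h \<omega>, X h \<omega>) \<in> B \<times> UNIV}" by auto
        also have "emeasure M \<dots> = a h * emeasure M {\<omega>\<in>space M. (X h \<omega>, X h \<omega>) \<in> B \<times> UNIV}"
          unfolding a_def using h by (intro ind) auto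
        also have "{\<omega>\<in>space M. (X h \<omega>, X h \<omega>) \<in> B \<times> UNIV} = X h -` B \<inter> space M" by auto
        finally show "emeasure (distr (density M (indicator ?A)) borel (X h)) B
            = emeasure (scale_measure (a h) (distr M borel (X h))) B"
          by (simp add: emeasure_distr)
      qed simp
      have "(\<integral>\<^sup>+\<omega>'. emeasure M {\<omega>\<in>space M. \<tau> s \<omega> \<le> ennreal x \<and> \<tau> s \<omega> + \<tau> h \<omega>' \<le> ennreal t} \<partial>M)
        = (\<integral>\<^sup>+\<omega>'. a s * (indicator ?A \<omega>' * p (X h \<omega>')) \<partial>M)"
      proof (intro nn_integral_cong)
        fix \<omega>' assume \<omega>': "\<omega>' \<in> space M"
        show "emeasure M {\<omega>\<in>space M. \<tau> s \<omega> \<le> ennreal x \<and> \<tau> s \<omega> + \<tau> h \<omega>' \<le> ennreal t}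
            = a s * (indicator ?A \<omega>' * p (X h \<omega>'))"
        proof (cases "ereal h < \<zeta> \<omega>'")
          case True
          let ?b = "X h \<omega>'"
          let ?C = "{p \<in> space (borel \<Otimes>\<^sub>M borel). fst p \<le> x \<and> fst p + ?b \<le> t}"
          have C: "?C \<in> sets (borel \<Otimes>\<^sub>M borel)" by measurable
          have b: "?b \<ge> 0" "\<tau> h \<omega>' = ennreal ?b" using X(2)[of h \<omega>'] tau[of h \<omega>'] h \<omega>' True by auto
          have "{\<omega>\<in>space M. \<tau> s \<omega> \<le> ennreal x \<and> \<tau> s \<omega> + \<tau> h \<omega>' \<le> ennreal t}
             = {\<omega>\<in>space M. ereal s < \<zeta> \<omega> \<and> (X s \<omega>, X s \<omega>) \<in> ?C}"
          proof (rule Collect_cong, rule conj_cong[OF refl])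
            fix \<omega> assume \<omega>: "\<omega> \<in> space M"
            show "(\<tau> s \<omega> \<le> ennreal x \<and> \<tau> s \<omega> + \<tau> h \<omega>' \<le> ennreal t) = (ereal s < \<zeta> \<omega> \<and> (X s \<omega>, X s \<omega>) \<in> ?C)"
              using tau[of s \<omega>] s \<omega> x t X(2)[of s \<omega>] b
              by (auto simp: ennreal_le_iff space_pair_measure top_unique simp flip: ennreal_plus)
          qed
          also have "emeasure M \<dots> = a s * emeasure M {\<omega>\<in>space M. (X s \<omega>, X s \<omega>) \<in> ?C}"
            unfolding a_def using s by (intro ind[OF _ _ _ C]) auto
          also have "{\<omega>\<in>space M. (X s \<omega>, X s \<omega>) \<in> ?C} = {\<omega>\<in>space M. X s \<omega> \<le> x \<and> X s \<omega> + ?b \<le> t}"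
            by (auto simp: space_pair_measure)
          finally show ?thesis using True \<omega>' by (simp add: p_def)
        next
          case False
          then have "\<tau> h \<omega>' = \<infinity>" using tau[of h \<omega>'] h \<omega>' by simp
          then show ?thesis using False by (simp add: top_unique)
        qed
      qed
      also have "\<dots> = a s * (\<integral>\<^sup>+\<omega>'. indicator ?A \<omega>' * p (X h \<omega>') \<partial>M)"
        by (rule nn_integral_cmult) measurable
      also have "(\<integral>\<^sup>+\<omega>'. indicator ?A \<omega>' * p (X h \<omega>') \<partial>M) = (\<integral>\<^sup>+b. p b \<partial>distr (density M (indicator ?A)) borel (X h))"
        by (simp add: nn_integral_distr nn_integral_density)
      also have "\<dots> = a h * (\<integral>\<^sup>+b. p b \<partial>distr M borel (X h))"
        unfolding dist by (rule nn_integral_scale_measure) simp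
      finally show ?thesis using lhs by simp
    qed
  qed
qed

section \<open>The undershoot as a random variable\<close>

lemma rat_nonnegI: "0 \<le> (s::real) \<Longrightarrow> s < real_of_rat q \<Longrightarrow> 0 \<le> q"
  by (metis less_imp_le order_le_less_trans zero_less_of_rat_iff)

text \<open>Suprema and infima of a right-continuous function over intervals open on the right can be taken over
  rational points.  This makes the limit superior and the limit inferior at the passage time countable
  expressions, which is needed because the undershoot must be measurable on all of the probability
  space, including the null set on which the path is not increasing.\<close>

lemma right_cont_less_rat:
  fixes f :: "real \<Rightarrow> 'a::linorder_topology"
  assumes "(f \<longlongrightarrow> f s) (at_right s)" "c < f s" "ereal s < P"
  obtains q :: rat where "s < real_of_rat q" "ereal (real_of_rat q) < P" "c < f (real_of_rat q)"
proof -
  obtain b where b: "s < b" "\<And>x. s < x \<Longrightarrow> x < b \<Longrightarrow> c < f x"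
    using order_tendstoD(1)[OF assms(1,2)] by (auto simp: eventually_at_right_field)
  obtain z where z: "ereal s < ereal z" "ereal z < P" using ereal_dense2[OF assms(3)] by auto
  obtain q where q: "s < real_of_rat q" "real_of_rat q < min b z"
    using of_rat_dense[of s "min b z"] b z by auto
  then have "ereal (real_of_rat q) < ereal z" by simp
  then have "ereal (real_of_rat q) < P" using z(2) by (rule less_trans)
  then show thesis using q b(2) by (intro that[of q]) auto
qed

lemma right_cont_greater_rat:
  fixes f :: "real \<Rightarrow> 'a::linorder_topology"
  assumes "(f \<longlongrightarrow> f s) (at_right s)" "f s < c" "ereal s < P"
  obtains q :: rat where "s < real_of_rat q" "ereal (real_of_rat q) < P" "f (real_of_rat q) < c"
proof -
  obtain b where b: "s < b" "\<And>x. s < x \<Longrightarrow> x < b \<Longrightarrow> f x < c"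
    using order_tendstoD(2)[OF assms(1,2)] by (auto simp: eventually_at_right_field)
  obtain z where z: "ereal s < ereal z" "ereal z < P" using ereal_dense2[OF assms(3)] by auto
  obtain q where q: "s < real_of_rat q" "real_of_rat q < min b z"
    using of_rat_dense[of s "min b z"] b z by auto
  then have "ereal (real_of_rat q) < ereal z" by simp
  then have "ereal (real_of_rat q) < P" using z(2) by (rule less_trans)
  then show thesis using q b(2) by (intro that[of q]) auto
qed

lemma at_left_ereal_rat:
  fixes P :: ereal
  assumes "0 < P" "eventually Q (at_left P)"
  obtains r :: rat where "0 \<le> r" "ereal (real_of_rat r) < P" "\<And>x. real_of_rat r < x \<Longrightarrow> ereal x < P \<Longrightarrow> Q (ereal x)"
proof -
  obtain b where b: "b < P" "\<And>y. b < y \<Longrightarrow> y < P \<Longrightarrow> Q y"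
    using assms eventually_at_left[of 0 P Q] by auto
  obtain z where z: "max b 0 < ereal z" "ereal z < P" using ereal_dense2[of "max b 0" P] b assms by auto
  obtain z' where z': "ereal z < ereal z'" "ereal z' < P" using ereal_dense2[OF z(2)] by auto
  obtain r where r: "z < real_of_rat r" "real_of_rat r < z'"
    using of_rat_dense[of z z'] z' by auto
  show thesis
  proof (rule that[of r])
    have "0 \<le> z" using z(1) by auto
    then show "0 \<le> r" using r(1) by (rule rat_nonnegI)
    have "ereal (real_of_rat r) < ereal z'" using r by simp
    then show "ereal (real_of_rat r) < P" using z'(2) by (rule less_trans)
    fix x assume x: "real_of_rat r < x" "ereal x < P"
    have "ereal z < ereal x" using x r by simp
    moreover have "b < ereal z" using z(1) by simp
    ultimately have "b < ereal x" by (rule less_trans[rotated])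
    then show "Q (ereal x)" using b x by auto
  qed
qed

lemma at_left_ereal_nontrivial:
  fixes P :: ereal assumes "0 < P" shows "at_left P \<noteq> bot"
proof
  assume "at_left P = bot"
  then obtain r :: rat where r: "ereal (real_of_rat r) < P"
    "\<And>x. real_of_rat r < x \<Longrightarrow> ereal x < P \<Longrightarrow> False"
    using at_left_ereal_rat[OF assms, of "\<lambda>_. False"] by (auto simp: trivial_limit_def)
  obtain z where "ereal (real_of_rat r) < ereal z" "ereal z < P" using ereal_dense2[OF r(1)] by auto
  then show False using r(2)[of z] by auto
qed

lemma eventually_at_left_ereal_interval:
  fixes P :: ereal assumes "ereal r < P"
  shows "\<forall>\<^sub>F x in at_left P. ereal r < x \<and> x < P"
  using assms by (subst eventually_at_left[OF assms]) auto

lemma Limsup_at_left_rat: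
  fixes f :: "real \<Rightarrow> ennreal"
  assumes P: "0 < P" and rc: "\<And>s. 0 \<le> s \<Longrightarrow> (f \<longlongrightarrow> f s) (at_right s)"
  shows "Limsup (at_left P) (\<lambda>s. f (real_of_ereal s)) =
    (INF r\<in>{0::rat..}. if ereal (real_of_rat r) < P
       then (SUP q\<in>UNIV. if r < q \<and> ereal (real_of_rat q) < P then f (real_of_rat q) else 0) else top)"
    (is "_ = Inf (?g ` _)")
proof (rule antisym)
  show "Limsup (at_left P) (\<lambda>s. f (real_of_ereal s)) \<le> Inf (?g ` {0..})"
  proof (rule INF_greatest)
    fix r :: rat assume r: "r \<in> {0..}"
    show "Limsup (at_left P) (\<lambda>s. f (real_of_ereal s)) \<le> ?g r"
    proof (cases "ereal (real_of_rat r) < P")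
      case True
      have "\<forall>\<^sub>F x in at_left P. f (real_of_ereal x) \<le> ?g r"
        using eventually_at_left_ereal_interval[OF True]
      proof eventually_elim
        case (elim x)
        then obtain s where s: "x = ereal s" by (cases x) auto
        show ?case
        proof (rule dense_le)
          fix c assume c: "c < f (real_of_ereal x)"
          have "0 \<le> real_of_rat r" using r by simp
          moreover have "real_of_rat r < s" using elim s by simp
          ultimately have "0 \<le> s" by (rule order_trans[OF _ less_imp_le])
          then obtain q :: rat where q: "s < real_of_rat q" "ereal (real_of_rat q) < P" "c < f (real_of_rat q)"
            using right_cont_less_rat[OF rc, of s c P] c s elim by auto
          have "real_of_rat r < real_of_rat q" using q(1) elim s by auto
          then have "r < q" by (simp only: of_rat_less)
          then have "f (real_of_rat q) \<le> ?g r"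
            unfolding if_P[OF True] using q(2) by (intro SUP_upper2[of q]) simp_all
          then show "c \<le> ?g r" using q(3) by (auto intro: less_imp_le less_le_trans)
        qed
      qed
      then show ?thesis by (rule Limsup_bounded)
    qed simp
  qed
  show "Inf (?g ` {0..}) \<le> Limsup (at_left P) (\<lambda>s. f (real_of_ereal s))"
    unfolding Limsup_def
  proof (rule INF_greatest)
    fix Q assume "Q \<in> {Q. eventually Q (at_left P)}"
    then obtain r :: rat where r: "0 \<le> r" "ereal (real_of_rat r) < P"
      "\<And>x. real_of_rat r < x \<Longrightarrow> ereal x < P \<Longrightarrow> Q (ereal x)"
      using at_left_ereal_rat[OF P, of Q] by auto
    have "Inf (?g ` {0..}) \<le> ?g r" using r(1) by (intro INF_lower) auto
    also have "\<dots> \<le> (SUP x\<in>Collect Q. f (real_of_ereal x))"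
    proof -
      have "(if r < q \<and> ereal (real_of_rat q) < P then f (real_of_rat q) else 0)
          \<le> (SUP x\<in>Collect Q. f (real_of_ereal x))" for q
        using r(3)[of "real_of_rat q"] by (auto simp: of_rat_less intro!: SUP_upper2[of "ereal (real_of_rat q)"])
      then show ?thesis unfolding if_P[OF r(2)] by (rule SUP_least)
    qed
    finally show "Inf (?g ` {0..}) \<le> (SUP x\<in>Collect Q. f (real_of_ereal x))" .
  qed
qed

lemma Liminf_at_left_rat:
  fixes f :: "real \<Rightarrow> ennreal"
  assumes P: "0 < P" and rc: "\<And>s. 0 \<le> s \<Longrightarrow> (f \<longlongrightarrow> f s) (at_right s)"
  shows "Liminf (at_left P) (\<lambda>s. f (real_of_ereal s)) =
    (SUP r\<in>{0::rat..}. if ereal (real_of_rat r) < P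
       then (INF q\<in>UNIV. if r < q \<and> ereal (real_of_rat q) < P then f (real_of_rat q) else top) else 0)"
    (is "_ = Sup (?g ` _)")
proof (rule antisym)
  show "Sup (?g ` {0..}) \<le> Liminf (at_left P) (\<lambda>s. f (real_of_ereal s))"
  proof (rule SUP_least)
    fix r :: rat assume r: "r \<in> {0..}"
    show "?g r \<le> Liminf (at_left P) (\<lambda>s. f (real_of_ereal s))"
    proof (cases "ereal (real_of_rat r) < P")
      case True
      have "\<forall>\<^sub>F x in at_left P. ?g r \<le> f (real_of_ereal x)"
        using eventually_at_left_ereal_interval[OF True]
      proof eventually_elim
        case (elim x)
        then obtain s where s: "x = ereal s" by (cases x) auto
        show ?case
        proof (rule dense_ge)
          fix c assume c: "f (real_of_ereal x) < c"
          have "0 \<le> real_of_rat r" using r by simp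
          moreover have "real_of_rat r < s" using elim s by simp
          ultimately have "0 \<le> s" by (rule order_trans[OF _ less_imp_le])
          then obtain q :: rat where q: "s < real_of_rat q" "ereal (real_of_rat q) < P" "f (real_of_rat q) < c"
            using right_cont_greater_rat[OF rc, of s c P] c s elim by auto
          have "real_of_rat r < real_of_rat q" using q(1) elim s by auto
          then have "r < q" by (simp only: of_rat_less)
          then have "?g r \<le> f (real_of_rat q)"
            unfolding if_P[OF True] using q(2) by (intro INF_lower2[of q]) simp_all
          then show "?g r \<le> c" using q(3) by (auto intro: less_imp_le le_less_trans)
        qed
      qed
      then show ?thesis by (rule Liminf_bounded)
    qed simp
  qed
  show "Liminf (at_left P) (\<lambda>s. f (real_of_ereal s)) \<le> Sup (?g ` {0..})"
    unfolding Liminf_def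
  proof (rule SUP_least)
    fix Q assume "Q \<in> {Q. eventually Q (at_left P)}"
    then obtain r :: rat where r: "0 \<le> r" "ereal (real_of_rat r) < P"
      "\<And>x. real_of_rat r < x \<Longrightarrow> ereal x < P \<Longrightarrow> Q (ereal x)"
      using at_left_ereal_rat[OF P, of Q] by auto
    have "(INF x\<in>Collect Q. f (real_of_ereal x)) \<le> ?g r"
    proof -
      have "(INF x\<in>Collect Q. f (real_of_ereal x)) \<le> (if r < q
          \<and> ereal (real_of_rat q) < P then f (real_of_rat q) else top)" for q
        using r(3)[of "real_of_rat q"] by (auto simp: of_rat_less intro!: INF_lower2[of "ereal (real_of_rat q)"])
      then show ?thesis unfolding if_P[OF r(2)] by (rule INF_greatest)
    qed
    also have "?g r \<le> Sup (?g ` {0..})" using r(1) by (intro SUP_upper) auto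
    finally show "(INF x\<in>Collect Q. f (real_of_ereal x)) \<le> Sup (?g ` {0..})" .
  qed
qed

text \<open>If the limit does not exist, \<open>Lim\<close> still has a fixed value, the same one for every such function.\<close>

lemma Lim_eq_Limsup_Liminf:
  fixes f :: "'a \<Rightarrow> 'b::{complete_linorder, linorder_topology}"
  assumes "F \<noteq> bot"
  shows "Lim F f = (if Limsup F f = Liminf F f then Limsup F f else (THE x. False))"
proof (cases "Limsup F f = Liminf F f")
  case True
  then have "(f \<longlongrightarrow> Limsup F f) F" using tendsto_iff_Liminf_eq_Limsup[of F f] assms by auto
  then show ?thesis using True assms by (simp add: tendsto_Lim)
next
  case False
  then have "\<not> (f \<longlongrightarrow> l) F" for l using tendsto_iff_Liminf_eq_Limsup[of F f l] assms by auto
  then show ?thesis using False by (simp add: t2_space_class.Lim_def)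
qed

abbreviation sojourn :: "(real \<Rightarrow> 'w \<Rightarrow> ennreal) \<Rightarrow> real \<Rightarrow> real \<Rightarrow> real \<Rightarrow> 'w \<Rightarrow> real set" where
  "sojourn \<tau> x t h \<omega> \<equiv> {s. 0 < s \<and> \<tau> s \<omega> \<le> ennreal x \<and> ennreal t < \<tau> (s + h) \<omega>}"

abbreviation launch :: "real \<Rightarrow> real \<Rightarrow> ennreal \<Rightarrow> real set" where
  "launch x t z \<equiv> {y. y \<le> x \<and> ennreal t < ennreal y + z}"

lemma passage_time_nonneg: "0 \<le> passage_time \<tau> t \<omega>"
  unfolding passage_time_def by (rule Inf_greatest) auto

lemma below_passage_time:
  assumes "0 \<le> s" "ereal s < passage_time \<tau> t \<omega>" shows "\<tau> s \<omega> \<le> ennreal t"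
proof (rule ccontr)
  assume "\<not> \<tau> s \<omega> \<le> ennreal t"
  then have "passage_time \<tau> t \<omega> \<le> ereal s" unfolding passage_time_def using assms(1) by (intro Inf_lower) auto
  then show False using assms(2) by simp
qed

lemma above_passage_time:
  assumes "0 \<le> s" "passage_time \<tau> t \<omega> < ereal s" and inc: "\<forall>s r. 0 \<le> s \<longrightarrow> s \<le> r \<longrightarrow> \<tau> s \<omega> \<le> \<tau> r \<omega>"
  shows "ennreal t < \<tau> s \<omega>"
proof -
  obtain r where r: "0 \<le> r" "ennreal t < \<tau> r \<omega>" "ereal r < ereal s"
    using assms(2) unfolding passage_time_def Inf_less_iff by auto
  then have "\<tau> r \<omega> \<le> \<tau> s \<omega>" using inc by auto
  then show ?thesis using r by auto
qed

lemma undershoot_le_iff: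
  assumes L: "passage_time \<tau> t \<omega> = ereal l" "0 < l"
    and inc: "\<forall>s r. 0 \<le> s \<longrightarrow> s \<le> r \<longrightarrow> \<tau> s \<omega> \<le> \<tau> r \<omega>"
  shows "undershoot \<tau> t \<omega> \<le> c \<longleftrightarrow> (\<forall>s. 0 \<le> s \<longrightarrow> s < l \<longrightarrow> \<tau> s \<omega> \<le> c)"
proof -
  define S where "S = (SUP s\<in>{0..<l}. \<tau> s \<omega>)"
  have "((\<lambda>s. \<tau> (real_of_ereal s) \<omega>) \<longlongrightarrow> S) (at_left (ereal l))"
  proof (rule order_tendstoI)
    fix a assume "a < S"
    then obtain s where s: "0 \<le> s" "s < l" "a < \<tau> s \<omega>" by (auto simp: S_def less_SUP_iff)
    then have "ereal s < ereal l" by simp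
    from eventually_at_left_ereal_interval[OF this]
    show "\<forall>\<^sub>F x in at_left (ereal l). a < \<tau> (real_of_ereal x) \<omega>"
    proof eventually_elim
      case (elim x)
      then obtain y where y: "x = ereal y" by (cases x) auto
      then have "\<tau> s \<omega> \<le> \<tau> y \<omega>" using inc elim s by auto
      then show ?case using s y by auto
    qed
  next
    fix a assume a: "S < a"
    have "ereal 0 < ereal l" using L by simp
    from eventually_at_left_ereal_interval[OF this]
    show "\<forall>\<^sub>F x in at_left (ereal l). \<tau> (real_of_ereal x) \<omega> < a"
    proof eventually_elim
      case (elim x)
      then obtain y where y: "x = ereal y" by (cases x) auto
      then have "\<tau> y \<omega> \<le> S" unfolding S_def using elim by (intro SUP_upper) auto
      then show ?case using a y by auto
    qed
  qed
  moreover have "at_left (ereal l) \<noteq> bot" using L by (intro at_left_ereal_nontrivial) simp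
  ultimately have "undershoot \<tau> t \<omega> = S"
    using L by (simp add: undershoot_def tendsto_Lim)
  then show ?thesis by (auto simp: S_def SUP_le_iff)
qed

text \<open>The key pathwise fact.  The set \<open>S h\<close> lies in \<open>[l - h, l]\<close>, where \<open>l\<close> is the passage
  time.  If the path is at most \<open>x\<close> before time \<open>l\<close>, then \<open>S h\<close> contains the open interval from
  \<open>l - h\<close> to \<open>l\<close> for small \<open>h\<close>; otherwise it exceeds \<open>x\<close> at some time before \<open>l\<close>, and \<open>S h\<close> is empty for small \<open>h\<close>.\<close>

lemma undershoot_sojourn:
  assumes L: "passage_time \<tau> t \<omega> = ereal l" "0 < l"
    and inc: "\<forall>s r. 0 \<le> s \<longrightarrow> s \<le> r \<longrightarrow> \<tau> s \<omega> \<le> \<tau> r \<omega>"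
    and x: "0 \<le> x" "x \<le> t"
  defines "S \<equiv> \<lambda>h. (sojourn \<tau> x t h \<omega>)"
  shows "h > 0 \<Longrightarrow> S h \<in> sets borel \<Longrightarrow> emeasure lborel (S h) \<le> ennreal h"
    and "\<exists>d>0. \<forall>h. 0 < h \<longrightarrow> h < d \<longrightarrow> S h \<in> sets borel \<longrightarrow>
       emeasure lborel (S h) = (if undershoot \<tau> t \<omega> \<le> ennreal x then ennreal h else 0)"
proof -
  have lo: "\<tau> s \<omega> \<le> ennreal t" if "0 \<le> s" "s < l" for s
    using below_passage_time[of s \<tau> t \<omega>] that L by simp
  have hi: "ennreal t < \<tau> s \<omega>" if "0 \<le> s" "l < s" for s
    using above_passage_time[of s \<tau> t \<omega>] that L inc by simp
  have xt: "ennreal x \<le> ennreal t" using x by (simp add: ennreal_le_iff)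
  have sub: "S h \<subseteq> {l - h..l}" if "h > 0" for h
  proof
    fix s assume s: "s \<in> S h"
    have "s \<le> l" using s hi[of s] xt by (force simp: S_def)
    moreover have "l \<le> s + h" using s lo[of "s + h"] that by (force simp: S_def not_less)
    ultimately show "s \<in> {l - h..l}" by simp
  qed
  show le: "emeasure lborel (S h) \<le> ennreal h" if "h > 0" "S h \<in> sets borel" for h
    using emeasure_mono[OF sub[OF that(1)], of lborel] that by simp
  show "\<exists>d>0. \<forall>h. 0 < h \<longrightarrow> h < d \<longrightarrow> S h \<in> sets borel \<longrightarrow>
       emeasure lborel (S h) = (if undershoot \<tau> t \<omega> \<le> ennreal x then ennreal h else 0)"
  proof (cases "undershoot \<tau> t \<omega> \<le> ennreal x")
    case True
    then have x': "\<tau> s \<omega> \<le> ennreal x" if "0 \<le> s" "s < l" for s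
      using undershoot_le_iff[OF L inc] that by blast
    show ?thesis
    proof (intro exI[of _ l] conjI allI impI)
      fix h assume h: "0 < h" "h < l" "S h \<in> sets borel"
      have "{l - h<..<l} \<subseteq> S h" using x' hi h by (auto simp: S_def)
      then have "emeasure lborel {l - h<..<l} \<le> emeasure lborel (S h)" using h by (intro emeasure_mono) auto
      then have "ennreal h \<le> emeasure lborel (S h)" using h by simp
      then show "emeasure lborel (S h) = (if undershoot \<tau> t \<omega> \<le> ennreal x then ennreal h else 0)"
        using le[OF h(1,3)] True by simp
    qed (use L in auto)
  next
    case False
    then obtain s0 where s0: "0 \<le> s0" "s0 < l" "\<not> \<tau> s0 \<omega> \<le> ennreal x"
      using undershoot_le_iff[OF L inc] by blast
    show ?thesis
    proof (intro exI[of _ "l - s0"] conjI allI impI)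
      fix h assume h: "0 < h" "h < l - s0" "S h \<in> sets borel"
      have "S h = {}"
      proof (rule equals0I)
        fix s assume s: "s \<in> S h"
        have "s < s0"
        proof (rule ccontr)
          assume "\<not> s < s0"
          then have "\<tau> s0 \<omega> \<le> \<tau> s \<omega>" using inc s0 by auto
          then show False using s s0 by (auto simp: S_def)
        qed
        then show False using lo[of "s + h"] s h by (force simp: S_def)
      qed
      then show "emeasure lborel (S h) = (if undershoot \<tau> t \<omega> \<le> ennreal x then ennreal h else 0)"
        using False by simp
    qed (use s0 in auto)
  qed
qed

context subordinator begin

lemma passage_time_measurable [measurable]: "passage_time \<tau> t \<in> borel_measurable M"
proof (rule borel_measurableI_less)
  fix y :: ereal
  have "{\<omega> \<in> space M. passage_time \<tau> t \<omega> < y}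
    = {\<omega> \<in> space M. \<exists>q\<in>{0::rat..}. ereal (real_of_rat q) < y \<and> ennreal t < \<tau> (real_of_rat q) \<omega>}"
  proof (rule Collect_cong, rule conj_cong[OF refl], rule iffI)
    fix \<omega> assume \<omega>: "\<omega> \<in> space M" and "passage_time \<tau> t \<omega> < y"
    then obtain s where s: "0 \<le> s" "ennreal t < \<tau> s \<omega>" "ereal s < y"
      unfolding passage_time_def Inf_less_iff by auto
    obtain q where q: "s < real_of_rat q" "ereal (real_of_rat q) < y" "ennreal t < \<tau> (real_of_rat q) \<omega>"
      using right_cont_less_rat[OF right_cont[OF \<omega> s(1)] s(2,3)] by auto
    have "0 \<le> q" using s(1) q(1) by (rule rat_nonnegI)
    then show "\<exists>q\<in>{0::rat..}. ereal (real_of_rat q) < y \<and> ennreal t < \<tau> (real_of_rat q) \<omega>" using q by auto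
  next
    fix \<omega> assume "\<exists>q\<in>{0::rat..}. ereal (real_of_rat q) < y \<and> ennreal t < \<tau> (real_of_rat q) \<omega>"
    then obtain q :: rat where "0 \<le> q" "ereal (real_of_rat q) < y" "ennreal t < \<tau> (real_of_rat q) \<omega>" by auto
    then show "passage_time \<tau> t \<omega> < y"
      unfolding passage_time_def Inf_less_iff by (intro bexI[of _ "ereal (real_of_rat q)"]) auto
  qed
  moreover have "{\<omega> \<in> space M. \<exists>q\<in>{0::rat..}. ereal (real_of_rat q) < y \<and> ennreal t < \<tau> (real_of_rat q) \<omega>} \<in> sets M"
  proof -
    have "{\<omega> \<in> space M. ereal (real_of_rat q) < y \<and> ennreal t < \<tau> (real_of_rat q) \<omega>} \<in> sets M" if "q \<in> {0..}" for q
    proof -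
      have [measurable]: "\<tau> (real_of_rat q) \<in> borel_measurable M" using that by (intro meas) simp
      show ?thesis by measurable
    qed
    then have "(\<Union>q\<in>{0::rat..}. {\<omega> \<in> space M. ereal (real_of_rat q) < y \<and> ennreal t < \<tau> (real_of_rat q) \<omega>}) \<in> sets M"
      by (rule sets.countable_UN''[OF countableI_type])
    also have "(\<Union>q\<in>{0::rat..}. {\<omega> \<in> space M. ereal (real_of_rat q) < y \<and> ennreal t < \<tau> (real_of_rat q) \<omega>})
      = {\<omega> \<in> space M. \<exists>q\<in>{0::rat..}. ereal (real_of_rat q) < y \<and> ennreal t < \<tau> (real_of_rat q) \<omega>}" by blast
    finally show ?thesis .
  qed
  ultimately show "{\<omega> \<in> space M. passage_time \<tau> t \<omega> < y} \<in> sets M" by (rule ssubst)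
qed

lemma undershoot_measurable [measurable]: "undershoot \<tau> t \<in> borel_measurable M"
proof -
  have m: "(\<lambda>\<omega>. \<tau> (real_of_rat q) \<omega>) \<in> borel_measurable M" if "0 \<le> q" for q
    using that by (intro meas) simp
  define P where "P = passage_time \<tau> t"
  have [measurable]: "P \<in> borel_measurable M" by (simp add: P_def)
  define ls where "ls = (\<lambda>\<omega>. INF r\<in>{0::rat..}. if ereal (real_of_rat r) < P \<omega>
       then (SUP q\<in>UNIV. if r < q \<and> ereal (real_of_rat q) < P \<omega> then \<tau> (real_of_rat q) \<omega> else 0) else top)"
  define li where "li = (\<lambda>\<omega>. SUP r\<in>{0::rat..}. if ereal (real_of_rat r) < P \<omega>
       then (INF q\<in>UNIV. if r < q \<and> ereal (real_of_rat q) < P \<omega> then \<tau> (real_of_rat q) \<omega> else top) else 0)"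
  have inner: "(\<lambda>\<omega>. if r < q \<and> ereal (real_of_rat q) < P \<omega> then \<tau> (real_of_rat q) \<omega> else c) \<in> borel_measurable M"
    if "r \<in> {0..}" for r q c
  proof (cases "r < q")
    case True
    then have [measurable]: "\<tau> (real_of_rat q) \<in> borel_measurable M" using that by (intro m) auto
    show ?thesis by measurable
  qed simp
  have [measurable]: "ls \<in> borel_measurable M"
    unfolding ls_def
  proof (rule borel_measurable_INF)
    fix r :: rat assume "r \<in> {0..}"
    then have [measurable]: "(\<lambda>\<omega>. SUP q\<in>UNIV. if r < q \<and> ereal (real_of_rat q) < P \<omega> then \<tau> (real_of_rat q) \<omega> else 0)
        \<in> borel_measurable M" by (intro borel_measurable_SUP inner) auto
    show "(\<lambda>\<omega>. if ereal (real_of_rat r) < P \<omega> then (SUP q\<in>UNIV. if r < q \<and> ereal (real_of_rat q) < P \<omega>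
        then \<tau> (real_of_rat q) \<omega> else 0) else top) \<in> borel_measurable M" by measurable
  qed simp
  have [measurable]: "li \<in> borel_measurable M"
    unfolding li_def
  proof (rule borel_measurable_SUP)
    fix r :: rat assume "r \<in> {0..}"
    then have [measurable]: "(\<lambda>\<omega>. INF q\<in>UNIV. if r < q \<and> ereal (real_of_rat q) < P \<omega> then \<tau> (real_of_rat q) \<omega>
        else top)
        \<in> borel_measurable M" by (intro borel_measurable_INF inner) auto
    show "(\<lambda>\<omega>. if ereal (real_of_rat r) < P \<omega> then (INF q\<in>UNIV. if r < q \<and> ereal (real_of_rat q) < P \<omega>
        then \<tau> (real_of_rat q) \<omega> else top) else 0) \<in> borel_measurable M" by measurable
  qed simp
  have eq: "undershoot \<tau> t \<omega> = (if P \<omega> = 0 then 0 else if ls \<omega> = li \<omega> then ls \<omega> else (THE x. False))"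
    if \<omega>: "\<omega> \<in> space M" for \<omega>
  proof (cases "P \<omega> = 0")
    case True
    then show ?thesis by (simp add: undershoot_def P_def)
  next
    case False
    then have P: "0 < P \<omega>" using passage_time_nonneg[of \<tau> t \<omega>] by (simp add: P_def)
    have "undershoot \<tau> t \<omega> = Lim (at_left (P \<omega>)) (\<lambda>s. \<tau> (real_of_ereal s) \<omega>)"
      using False by (simp add: undershoot_def P_def)
    also have "\<dots> = (if ls \<omega> = li \<omega> then ls \<omega> else (THE x. False))"
    proof -
      have "Limsup (at_left (P \<omega>)) (\<lambda>s. \<tau> (real_of_ereal s) \<omega>) = ls \<omega>"
        unfolding ls_def by (rule Limsup_at_left_rat[OF P, of "\<lambda>s. \<tau> s \<omega>"]) (rule right_cont[OF \<omega>])
      moreover have "Liminf (at_left (P \<omega>)) (\<lambda>s. \<tau> (real_of_ereal s) \<omega>) = li \<omega>"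
        unfolding li_def by (rule Liminf_at_left_rat[OF P, of "\<lambda>s. \<tau> s \<omega>"]) (rule right_cont[OF \<omega>])
      ultimately show ?thesis by (simp add: Lim_eq_Limsup_Liminf[OF at_left_ereal_nontrivial[OF P]])
    qed
    finally show ?thesis using False by simp
  qed
  have "(\<lambda>\<omega>. if P \<omega> = 0 then 0 else if ls \<omega> = li \<omega> then ls \<omega> else (THE x. False)) \<in> borel_measurable M"
    by measurable
  then show ?thesis by (subst measurable_cong[OF eq])
qed

text \<open>A right-continuous process is the limit of its values at the next lattice time, which are
  jointly measurable.\<close>

lemma joint_measurable: "(\<lambda>p. \<tau> (max 0 (fst p)) (snd p)) \<in> borel_measurable (borel \<Otimes>\<^sub>M M)"
proof (rule borel_measurable_LIMSEQ_order)
  \<comment> \<open>The first point of the lattice of mesh \<open>1 / (m + 1)\<close> strictly to the right of \<open>s\<close>.\<close>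
  define r where "r = (\<lambda>(m::nat) (s::real). (real_of_int \<lfloor>real (Suc m) * max 0 s\<rfloor> + 1) / real (Suc m))"
  define F where "F = (\<lambda>m (p :: real \<times> 'w). \<tau> (r m (fst p)) (snd p))"
  show "F m \<in> borel_measurable (borel \<Otimes>\<^sub>M M)" for m
  proof -
    define G where "G = (\<lambda>(i::int) (p :: real \<times> 'w). \<tau> (max 0 ((real_of_int i + 1) / real (Suc m))) (snd p))"
    have [measurable]: "\<tau> (max 0 s) \<in> borel_measurable M" for s by (rule meas) simp
    have "G i \<in> borel_measurable (borel \<Otimes>\<^sub>M M)" for i unfolding G_def by measurable
    then have "(\<lambda>p. G \<lfloor>real (Suc m) * max 0 (fst p)\<rfloor> p) \<in> borel_measurable (borel \<Otimes>\<^sub>M M)"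
      by (rule measurable_compose_countable) measurable
    moreover have "G \<lfloor>real (Suc m) * max 0 (fst p)\<rfloor> p = F m p" for p
      by (simp add: G_def F_def r_def del: of_nat_Suc)
    ultimately show ?thesis by simp
  qed
  show "(\<lambda>m. F m p) \<longlonglongrightarrow> \<tau> (max 0 (fst p)) (snd p)" if "p \<in> space (borel \<Otimes>\<^sub>M M)" for p
  proof -
    define s where "s = max 0 (fst p)"
    have gt: "s < r m (fst p)" "r m (fst p) \<le> s + 1 / real (Suc m)" for m
      unfolding r_def s_def[symmetric]
      by (simp_all add: field_simps del: of_nat_Suc) linarith+
    have lim: "(\<lambda>m. s + 1 / real (Suc m)) \<longlonglongrightarrow> s" by real_asymp
    have "(\<lambda>m. r m (fst p)) \<longlonglongrightarrow> s"
      by (rule tendsto_sandwich[OF _ _ tendsto_const lim])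
        (intro always_eventually allI less_imp_le gt(1), intro always_eventually allI gt(2))
    moreover have "\<And>m. r m (fst p) \<noteq> s" using gt(1) by (metis less_irrefl)
    ultimately have "filterlim (\<lambda>m. r m (fst p)) (at_right s) sequentially"
      using gt(1) by (simp add: filterlim_at)
    moreover have "((\<lambda>r. \<tau> r (snd p)) \<longlongrightarrow> \<tau> s (snd p)) (at_right s)"
      using that by (intro right_cont) (auto simp: space_pair_measure s_def)
    ultimately show ?thesis unfolding F_def s_def[symmetric] by (rule filterlim_compose[rotated])
  qed
qed

end

section \<open>Potential measure and tail measure\<close>

lemma nn_integral_exp_killed:
  assumes u: "u > 0"
  shows "(\<integral>\<^sup>+z. (if 0 < z \<and> ennreal z < T then ennreal (exp (- u * z)) else 0) \<partial>lborel)
    = ennreal (1 / u) * (1 - killed_exp u T)"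
proof (cases T)
  case (real r)
  have "(\<integral>\<^sup>+z. (if 0 < z \<and> ennreal z < T then ennreal (exp (- u * z)) else 0) \<partial>lborel)
     = (\<integral>\<^sup>+z. ennreal (exp (- u * z)) * indicator {0..r} z \<partial>lborel)"
  proof (rule nn_integral_cong_AE)
    have "AE z in lborel. z \<noteq> 0 \<and> z \<noteq> r" by (intro AE_conjI AE_lborel_singleton)
    then show "AE z in lborel. (if 0 < z \<and> ennreal z < T then ennreal (exp (- u * z)) else 0)
       = ennreal (exp (- u * z)) * indicator {0..r} z"
      by eventually_elim (auto simp: real ennreal_less_iff indicator_def)
  qed
  also have "\<dots> = ennreal (- exp (- u * r) / u - - exp (- u * 0) / u)"
    by (rule nn_integral_FTC_Icc) (use u real in \<open>auto intro!: derivative_eq_intros\<close>)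
  also have "\<dots> = ennreal (1 / u) * (1 - killed_exp u T)"
  proof -
    have "exp (- u * r) \<le> 1" using u real by simp
    then have "1 - killed_exp u T = ennreal (1 - exp (- u * r))"
      using real by (simp add: ennreal_minus flip: ennreal_1)
    then show ?thesis using u by (simp add: diff_divide_distrib flip: ennreal_mult')
  qed
  finally show ?thesis .
next
  case top
  have "(\<integral>\<^sup>+z. (if 0 < z \<and> ennreal z < T then ennreal (exp (- u * z)) else 0) \<partial>lborel)
     = (\<integral>\<^sup>+z. ennreal (exp (- u * z)) * indicator {0..} z \<partial>lborel)"
  proof (rule nn_integral_cong_AE)
    show "AE z in lborel. (if 0 < z \<and> ennreal z < T then ennreal (exp (- u * z)) else 0)
       = ennreal (exp (- u * z)) * indicator {0..} z"
      using AE_lborel_singleton[of 0] by eventually_elim (auto simp: top indicator_def)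
  qed
  also have "\<dots> = ennreal (0 - - exp (- u * 0) / u)"
  proof (rule nn_integral_FTC_atLeast)
    show "((\<lambda>z. - exp (- u * z) / u) \<longlongrightarrow> 0) at_top" using u by real_asymp
  qed (use u in \<open>auto intro!: derivative_eq_intros\<close>)
  finally show ?thesis using top by (simp add: killed_exp_def)
qed

lemma emeasure_truncated_interval:
  assumes b: "b \<ge> 0"
  shows "emeasure lborel {z::real. 0 < z \<and> ennreal z < T \<and> z \<le> b} = min T (ennreal b)"
proof (cases T)
  case (real r)
  then have "{z::real. 0 < z \<and> ennreal z < T \<and> z \<le> b} = (if r \<le> b then {0<..<r} else {0<..b})"
    by (auto simp: ennreal_less_iff)
  then show ?thesis using real b by (simp add: min_def ennreal_le_iff)
next
  case top
  then have "{z::real. 0 < z \<and> ennreal z < T \<and> z \<le> b} = {0<..b}" by auto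
  then show ?thesis using top b by simp
qed

context subordinator begin

definition trajectory :: "real \<Rightarrow> 'w \<Rightarrow> ennreal" where "trajectory s = \<tau> (max 0 s)"

lemma trajectory_eq: "0 \<le> s \<Longrightarrow> trajectory s = \<tau> s"
  by (simp add: trajectory_def)

lemma trajectory_measurable [measurable (raw)]:
  assumes "f \<in> borel_measurable N" "g \<in> measurable N M"
  shows "(\<lambda>x. trajectory (f x) (g x)) \<in> borel_measurable N"
  using measurable_compose[OF measurable_Pair[OF assms] joint_measurable] by (simp add: trajectory_def)

sublocale time: pair_sigma_finite lborel M ..

lemma expectation_killed_exp:
  assumes "0 < u" "0 < s"
  shows "integrable M (\<lambda>\<omega>. enn2real (killed_exp u (trajectory s \<omega>)))"
    and "expectation (\<lambda>\<omega>. enn2real (killed_exp u (trajectory s \<omega>))) = exp (- \<Phi> u * s)"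
proof -
  have le1: "killed_exp u z \<le> 1" for z
    using assms(1) by (auto simp: killed_exp_def simp flip: ennreal_1 intro!: ennreal_leI)
  then have le: "enn2real (killed_exp u z) \<le> 1" for z
    using enn2real_mono[OF le1[of z]] by simp
  show "integrable M (\<lambda>\<omega>. enn2real (killed_exp u (trajectory s \<omega>)))"
    using le by (intro integrable_const_bound[where B=1]) auto
  have "expectation (\<lambda>\<omega>. enn2real (killed_exp u (trajectory s \<omega>)))
      = enn2real (\<integral>\<^sup>+\<omega>. ennreal (enn2real (killed_exp u (trajectory s \<omega>))) \<partial>M)"
    by (rule integral_eq_nn_integral) auto
  also have "(\<integral>\<^sup>+\<omega>. ennreal (enn2real (killed_exp u (trajectory s \<omega>))) \<partial>M) = (\<integral>\<^sup>+\<omega>. killed_exp u (trajectory s \<omega>) \<partial>M)"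
    by (intro nn_integral_cong) (auto simp: killed_exp_def)
  finally show "expectation (\<lambda>\<omega>. enn2real (killed_exp u (trajectory s \<omega>))) = exp (- \<Phi> u * s)"
    using laplace[OF assms] assms by (simp add: trajectory_eq)
qed

lemma \<Phi>_mono:
  assumes "0 < u" "u \<le> v" shows "\<Phi> u \<le> \<Phi> v"
proof -
  have "enn2real (killed_exp v z) \<le> enn2real (killed_exp u z)" for z
    using assms by (auto simp: killed_exp_def mult_right_mono)
  then have "exp (- \<Phi> v * 1) \<le> exp (- \<Phi> u * 1)"
    unfolding expectation_killed_exp(2)[OF assms(1) zero_less_one, symmetric]
      expectation_killed_exp(2)[OF order_less_le_trans[OF assms] zero_less_one, symmetric]
    using assms by (intro integral_mono expectation_killed_exp) auto
  then show ?thesis by simp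
qed

lemma \<Phi>_nonneg:
  assumes "0 < u" shows "0 \<le> \<Phi> u"
proof -
  have "enn2real (killed_exp u z) \<le> 1" for z
    using assms by (auto simp: killed_exp_def)
  then have "expectation (\<lambda>\<omega>. enn2real (killed_exp u (trajectory 1 \<omega>))) \<le> expectation (\<lambda>_. 1)"
    using assms by (intro integral_mono expectation_killed_exp) auto
  then show ?thesis using expectation_killed_exp(2)[OF assms, of 1] by (simp add: prob_space)
qed

text \<open>Jensen's inequality: the square of the mean of \<open>exp (- u \<tau>)\<close> is at most the mean of its square.\<close>

lemma \<Phi>_double:
  assumes "0 < u" shows "\<Phi> (2 * u) \<le> 2 * \<Phi> u"
proof -
  let ?Y = "\<lambda>\<omega>. enn2real (killed_exp u (trajectory 1 \<omega>))"
  have sq: "(?Y \<omega>)\<^sup>2 = enn2real (killed_exp (2 * u) (trajectory 1 \<omega>))" for \<omega>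
    by (auto simp: killed_exp_def power2_eq_square simp flip: exp_add)
  have "0 \<le> variance ?Y" by (rule variance_positive)
  also have "variance ?Y = expectation (\<lambda>\<omega>. (?Y \<omega>)\<^sup>2) - (expectation ?Y)\<^sup>2"
  proof (rule variance_eq)
    show "integrable M ?Y" using assms by (intro expectation_killed_exp) auto
    show "integrable M (\<lambda>\<omega>. (?Y \<omega>)\<^sup>2)" unfolding sq using assms by (intro expectation_killed_exp) auto
  qed
  also have "\<dots> = exp (- \<Phi> (2 * u)) - exp (- \<Phi> u * 2)"
    unfolding sq using expectation_killed_exp(2)[of u 1] expectation_killed_exp(2)[of "2 * u" 1] assms
    by (simp add: power2_eq_square flip: exp_add)
  finally show ?thesis by simp
qed

lemma \<Phi>_pos:
  assumes "0 < u" shows "0 < \<Phi> u"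
proof -
  obtain v where v: "0 < v" "\<Phi> v \<noteq> 0" using nonzero by auto
  have pow: "\<Phi> (2 ^ n * u) \<le> 2 ^ n * \<Phi> u" for n
  proof (induction n)
    case (Suc n)
    have "\<Phi> (2 ^ Suc n * u) \<le> 2 * \<Phi> (2 ^ n * u)"
      using \<Phi>_double[of "2 ^ n * u"] assms by (simp add: mult.assoc)
    with Suc show ?case by simp
  qed simp
  obtain n where "v / u < 2 ^ n" using real_arch_pow[of 2 "v / u"] by auto
  then have "v \<le> 2 ^ n * u" using assms by (simp add: field_simps)
  then have "\<Phi> v \<le> 2 ^ n * \<Phi> u" using \<Phi>_mono[OF v(1)] pow[of n] by (meson order_trans)
  moreover have "0 < \<Phi> v" using \<Phi>_nonneg[OF v(1)] v(2) by simp
  ultimately have "0 < 2 ^ n * \<Phi> u" by linarith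
  then show ?thesis by (simp add: zero_less_mult_iff)
qed

text \<open>The potential measure, that is, the expected time that the process spends in a set before it is killed.\<close>

definition potential :: "real measure" where
  "potential = distr (density (lborel \<Otimes>\<^sub>M M)
       (\<lambda>p. if 0 < fst p \<and> trajectory (fst p) (snd p) \<noteq> top then 1 else 0))
     borel (\<lambda>p. enn2real (trajectory (fst p) (snd p)))"

lemma sets_potential [measurable_cong, simp]: "sets potential = sets borel"
  by (simp add: potential_def)

lemma nn_integral_potential:
  assumes [measurable]: "g \<in> borel_measurable borel"
  shows "(\<integral>\<^sup>+y. g y \<partial>potential)
    = (\<integral>\<^sup>+s. \<integral>\<^sup>+\<omega>. (if 0 < s \<and> trajectory s \<omega> \<noteq> top then g (enn2real (trajectory s \<omega>)) else 0) \<partial>M \<partial>lborel)"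
proof -
  have "(\<integral>\<^sup>+y. g y \<partial>potential) = (\<integral>\<^sup>+p. (if 0 < fst p \<and> trajectory (fst p) (snd p) \<noteq> top
      then g (enn2real (trajectory (fst p) (snd p))) else 0)
      \<partial>(lborel \<Otimes>\<^sub>M M))"
    unfolding potential_def
    by (simp add: nn_integral_distr nn_integral_density) (auto intro!: nn_integral_cong)
  also have "\<dots> = (\<integral>\<^sup>+s. \<integral>\<^sup>+\<omega>. (if 0 < s \<and> trajectory s \<omega> \<noteq> top then g (enn2real (trajectory s \<omega>)) else 0) \<partial>M \<partial>lborel)"
    by (subst nn_integral_fst[symmetric]) (simp_all cong: if_cong)
  finally show ?thesis .
qed

lemma potential_laplace: "has_laplace potential (\<lambda>u. 1 / \<Phi> u)"
  unfolding has_laplace_def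
proof (intro conjI allI impI)
  show "AE x in potential. 0 \<le> x"
    unfolding potential_def by (subst AE_distr_iff) auto
  fix u :: real assume u: "0 < u"
  note P = \<Phi>_pos[OF u]
  show "0 \<le> 1 / \<Phi> u" using P by simp
  have "(\<integral>\<^sup>+y. ennreal (exp (- u * y)) \<partial>potential)
     = (\<integral>\<^sup>+s. ennreal (exp (- \<Phi> u * s)) * indicator {0..} s \<partial>lborel)"
  proof (subst nn_integral_potential, simp, rule nn_integral_cong_AE)
    show "AE s in lborel. (\<integral>\<^sup>+\<omega>. (if 0 < s \<and> trajectory s \<omega> \<noteq> top then ennreal (exp (- u
        * enn2real (trajectory s \<omega>))) else 0) \<partial>M)
       = ennreal (exp (- \<Phi> u * s)) * indicator {0..} s"
      using AE_lborel_singleton[of 0]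
    proof eventually_elim
      case (elim s)
      show ?case
      proof (cases "0 < s")
        case True
        then have "(\<integral>\<^sup>+\<omega>. (if 0 < s \<and> trajectory s \<omega> \<noteq> top then ennreal (exp (- u * enn2real (trajectory s \<omega>)))
            else 0) \<partial>M)
           = (\<integral>\<^sup>+\<omega>. killed_exp u (\<tau> s \<omega>) \<partial>M)"
          by (intro nn_integral_cong) (auto simp: killed_exp_def trajectory_eq)
        then show ?thesis using laplace[OF u True] True by simp
      qed (use elim in auto)
    qed
  qed
  also have "\<dots> = ennreal (0 - - exp (- \<Phi> u * 0) / \<Phi> u)"
  proof (rule nn_integral_FTC_atLeast)
    show "((\<lambda>z. - exp (- \<Phi> u * z) / \<Phi> u) \<longlongrightarrow> 0) at_top" using P by real_asymp
  qed (use P in \<open>auto intro!: derivative_eq_intros\<close>)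
  finally show "(\<integral>\<^sup>+y. ennreal (exp (- u * y)) \<partial>potential) = ennreal (1 / \<Phi> u)" by simp
qed simp

definition tail :: "real \<Rightarrow> real \<Rightarrow> real" where
  "tail h z = prob {\<omega> \<in> space M. ennreal z < trajectory h \<omega>}"

text \<open>The measure with density \<open>tail h z / h\<close> at \<open>z > 0\<close>, written as an image measure.\<close>

definition tail_measure :: "real \<Rightarrow> real measure" where
  "tail_measure h = scale_measure (ennreal (1 / h)) (distr (density (lborel \<Otimes>\<^sub>M M)
       (\<lambda>p. if 0 < fst p \<and> ennreal (fst p) < trajectory h (snd p) then 1 else 0)) borel fst)"

lemma nn_integral_tail_measure:
  assumes [measurable]: "g \<in> borel_measurable borel"
  shows "(\<integral>\<^sup>+z. g z \<partial>tail_measure h)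
    = ennreal (1 / h) * (\<integral>\<^sup>+\<omega>. \<integral>\<^sup>+z. (if 0 < z \<and> ennreal z < trajectory h \<omega> then g z else 0) \<partial>lborel \<partial>M)"
proof -
  have "(\<integral>\<^sup>+z. g z \<partial>tail_measure h) = ennreal (1 / h) *
     (\<integral>\<^sup>+p. (if 0 < fst p \<and> ennreal (fst p) < trajectory h (snd p) then g (fst p) else 0) \<partial>(lborel \<Otimes>\<^sub>M M))"
    unfolding tail_measure_def
    by (subst nn_integral_scale_measure)
      (auto simp: nn_integral_distr nn_integral_density intro!: arg_cong2[where f=times] nn_integral_cong)
  also have "(\<integral>\<^sup>+p. (if 0 < fst p \<and> ennreal (fst p) < trajectory h (snd p) then g (fst p) else 0) \<partial>(lborel \<Otimes>\<^sub>M M))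
     = (\<integral>\<^sup>+\<omega>. \<integral>\<^sup>+z. (if 0 < z \<and> ennreal z < trajectory h \<omega> then g z else 0) \<partial>lborel \<partial>M)"
    by (subst time.nn_integral_snd[symmetric]) (simp_all cong: if_cong)
  finally show ?thesis .
qed

lemma tail_measure_laplace:
  assumes h: "0 < h"
  shows "has_laplace (tail_measure h) (\<lambda>u. (1 - exp (- \<Phi> u * h)) / (h * u))"
  unfolding has_laplace_def
proof (intro conjI allI impI)
  show "sets (tail_measure h) = sets borel" by (simp add: tail_measure_def)
  have "AE x in distr (density (lborel \<Otimes>\<^sub>M M)
       (\<lambda>p. if 0 < fst p \<and> ennreal (fst p) < trajectory h (snd p) then 1 else 0)) borel fst. 0 \<le> x"
    by (subst AE_distr_iff) (auto simp: AE_density)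
  then show "AE x in tail_measure h. 0 \<le> x"
    by (auto simp: tail_measure_def eventually_ae_filter null_sets_def emeasure_scale_measure space_scale_measure)
  fix u :: real assume u: "0 < u"
  have 0: "0 \<le> 1 - exp (- \<Phi> u * h)" using \<Phi>_pos[OF u] h by simp
  then show "0 \<le> (1 - exp (- \<Phi> u * h)) / (h * u)" using u h by simp
  have le: "killed_exp u z \<le> 1" for z
    using u by (auto simp: killed_exp_def simp flip: ennreal_1 intro!: ennreal_leI)
  have "(\<integral>\<^sup>+\<omega>. killed_exp u (trajectory h \<omega>) \<partial>M) = ennreal (exp (- \<Phi> u * h))"
    using laplace[OF u h] h by (simp add: trajectory_eq)
  then have "(\<integral>\<^sup>+\<omega>. 1 - killed_exp u (trajectory h \<omega>) \<partial>M) = 1 - ennreal (exp (- \<Phi> u * h))"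
    using le by (subst nn_integral_diff) (auto simp: emeasure_space_1)
  also have "\<dots> = ennreal (1 - exp (- \<Phi> u * h))" using 0 by (simp add: ennreal_minus flip: ennreal_1)
  finally have e: "(\<integral>\<^sup>+\<omega>. 1 - killed_exp u (trajectory h \<omega>) \<partial>M) = ennreal (1 - exp (- \<Phi> u * h))" .
  have "(\<integral>\<^sup>+z. ennreal (exp (- u * z)) \<partial>tail_measure h)
     = ennreal (1 / h) * (\<integral>\<^sup>+\<omega>. ennreal (1 / u) * (1 - killed_exp u (trajectory h \<omega>)) \<partial>M)"
    unfolding nn_integral_exp_killed[OF u, symmetric] by (rule nn_integral_tail_measure) simp
  also have "\<dots> = ennreal (1 / h) * (ennreal (1 / u) * ennreal (1 - exp (- \<Phi> u * h)))"
    by (subst nn_integral_cmult) (auto simp: e)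
  also have "\<dots> = ennreal ((1 - exp (- \<Phi> u * h)) / (h * u))"
    using u h 0 by (simp flip: ennreal_mult)
  finally show "(\<integral>\<^sup>+z. ennreal (exp (- u * z)) \<partial>tail_measure h) = ennreal ((1 - exp (- \<Phi> u * h)) / (h * u))" .
qed

lemma tail_measure_atMost:
  assumes h: "0 < h" and b: "0 \<le> b"
  shows "(\<integral>\<^sup>+\<omega>. min (trajectory h \<omega>) (ennreal b) \<partial>M) = ennreal (h * measure (tail_measure h) {..b})"
proof -
  note L = tail_measure_laplace[OF h]
  have [measurable_cong]: "sets (tail_measure h) = sets borel" using has_laplaceD(1)[OF L] .
  have "emeasure (tail_measure h) {..b} = (\<integral>\<^sup>+z. indicator {..b} z \<partial>tail_measure h)"
    by (subst nn_integral_indicator) auto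
  also have "\<dots> = ennreal (1 / h) * (\<integral>\<^sup>+\<omega>. \<integral>\<^sup>+z. (if 0 < z \<and> ennreal z < trajectory h \<omega> then indicator {..b} z
      else 0) \<partial>lborel \<partial>M)"
    by (rule nn_integral_tail_measure) simp
  also have "(\<integral>\<^sup>+\<omega>. \<integral>\<^sup>+z. (if 0 < z \<and> ennreal z < trajectory h \<omega> then indicator {..b} z else 0) \<partial>lborel \<partial>M)
     = (\<integral>\<^sup>+\<omega>. min (trajectory h \<omega>) (ennreal b) \<partial>M)"
  proof (intro nn_integral_cong)
    fix \<omega>
    have "(\<integral>\<^sup>+z. (if 0 < z \<and> ennreal z < trajectory h \<omega> then indicator {..b} z else 0) \<partial>lborel)
       = (\<integral>\<^sup>+z. indicator {z. 0 < z \<and> ennreal z < trajectory h \<omega> \<and> z \<le> b} z \<partial>lborel)"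
      by (intro nn_integral_cong) (auto simp: indicator_def)
    also have "\<dots> = emeasure lborel {z. 0 < z \<and> ennreal z < trajectory h \<omega> \<and> z \<le> b}"
      by (rule nn_integral_indicator) simp
    also have "\<dots> = min (trajectory h \<omega>) (ennreal b)" by (rule emeasure_truncated_interval[OF b])
    finally show "(\<integral>\<^sup>+z. (if 0 < z \<and> ennreal z < trajectory h \<omega> then indicator {..b} z else 0) \<partial>lborel)
        = min (trajectory h \<omega>) (ennreal b)" .
  qed
  finally have "ennreal (measure (tail_measure h) {..b}) = ennreal (1 / h)
      * (\<integral>\<^sup>+\<omega>. min (trajectory h \<omega>) (ennreal b) \<partial>M)"
    using has_laplace_finite(2)[OF L] by simp
  then have "ennreal h * ennreal (measure (tail_measure h) {..b})
      = ennreal (h * (1 / h)) * (\<integral>\<^sup>+\<omega>. min (trajectory h \<omega>) (ennreal b) \<partial>M)"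
    using h by (subst ennreal_mult) (auto simp: mult.assoc)
  then show ?thesis using h by (simp add: ennreal_mult)
qed

text \<open>The tail is the decreasing density of the tail measure.\<close>

lemma tail_measure_increment:
  assumes h: "0 < h" and ab: "0 \<le> a" "a \<le> b"
  shows "(b - a) * (tail h b / h) \<le> measure (tail_measure h) {..b} - measure (tail_measure h) {..a}"
    and "measure (tail_measure h) {..b} - measure (tail_measure h) {..a} \<le> (b - a) * (tail h a / h)"
proof -
  define J where "J = (\<lambda>b. measure (tail_measure h) {..b})"
  have J: "(\<integral>\<^sup>+\<omega>. min (trajectory h \<omega>) (ennreal b) \<partial>M) = ennreal (h * J b)" if "0 \<le> b" for b
    using tail_measure_atMost[OF h that] by (simp add: J_def)
  have J0: "0 \<le> h * J c" for c using h by (simp add: J_def)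
  have T: "(\<integral>\<^sup>+\<omega>. ennreal (b - a) * indicator {\<omega>\<in>space M. ennreal c < trajectory h \<omega>} \<omega> \<partial>M)
      = ennreal ((b - a) * tail h c)" for c
    using ab by (subst nn_integral_cmult_indicator) (auto simp: tail_def emeasure_eq_measure ennreal_mult)
  have bs: "ennreal a + ennreal (b - a) = ennreal b" using ab by (simp flip: ennreal_plus)
  have "ennreal (h * J a) + ennreal ((b - a) * tail h b)
     = (\<integral>\<^sup>+\<omega>. min (trajectory h \<omega>) (ennreal a) + ennreal (b - a)
         * indicator {\<omega>\<in>space M. ennreal b < trajectory h \<omega>} \<omega> \<partial>M)"
    using ab by (subst nn_integral_add) (auto simp: J T)
  also have "\<dots> \<le> (\<integral>\<^sup>+\<omega>. min (trajectory h \<omega>) (ennreal b) \<partial>M)"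
  proof (rule nn_integral_mono)
    fix \<omega>
    have le: "ennreal a \<le> ennreal b" using ab by (simp add: ennreal_le_iff)
    show "min (trajectory h \<omega>) (ennreal a) + ennreal (b - a)
        * indicator {\<omega>\<in>space M. ennreal b < trajectory h \<omega>} \<omega> \<le> min (trajectory h \<omega>) (ennreal b)"
    proof (cases "ennreal b < trajectory h \<omega> \<and> \<omega> \<in> space M")
      case True
      then have "ennreal a < trajectory h \<omega>" using le by (auto intro: le_less_trans)
      then have "min (trajectory h \<omega>) (ennreal a) = ennreal a" "min (trajectory h \<omega>) (ennreal b) = ennreal b"
        using True by (auto simp: min_def)
      then show ?thesis using True bs by simp
    next
      case False
      then have "ennreal (b - a) * indicator {\<omega>\<in>space M. ennreal b < trajectory h \<omega>} \<omega>
          = 0" by (auto simp: indicator_def)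
      then show ?thesis using le by (auto simp: min_def)
    qed
  qed
  also have "\<dots> = ennreal (h * J b)" using ab by (intro J) simp
  finally have "ennreal (h * J a + (b - a) * tail h b) \<le> ennreal (h * J b)"
    using J0 ab by (subst ennreal_plus) (auto simp: tail_def)
  then have 1: "h * J a + (b - a) * tail h b \<le> h * J b" by (simp add: ennreal_le_iff J0)
  have "ennreal (h * J b) = (\<integral>\<^sup>+\<omega>. min (trajectory h \<omega>) (ennreal b) \<partial>M)" using ab by (intro J[symmetric]) simp
  also have "\<dots> \<le> (\<integral>\<^sup>+\<omega>. min (trajectory h \<omega>) (ennreal a) + ennreal (b - a)
      * indicator {\<omega>\<in>space M. ennreal a < trajectory h \<omega>} \<omega> \<partial>M)"
  proof (rule nn_integral_mono)
    fix \<omega> assume \<omega>: "\<omega> \<in> space M"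
    show "min (trajectory h \<omega>) (ennreal b) \<le> min (trajectory h \<omega>) (ennreal a) + ennreal (b - a)
        * indicator {\<omega>\<in>space M. ennreal a < trajectory h \<omega>} \<omega>"
    proof (cases "ennreal a < trajectory h \<omega>")
      case True
      then have "min (trajectory h \<omega>) (ennreal a) = ennreal a" by (auto simp: min_def)
      then show ?thesis using True bs \<omega> by simp
    next
      case False
      then have "min (trajectory h \<omega>) (ennreal a) = trajectory h \<omega>" by (auto simp: min_def)
      then show ?thesis by (simp add: add_increasing2)
    qed
  qed
  also have "\<dots> = ennreal (h * J a) + ennreal ((b - a) * tail h a)"
    using ab by (subst nn_integral_add) (auto simp: J T)
  finally have "ennreal (h * J b) \<le> ennreal (h * J a + (b - a) * tail h a)"
    using J0 ab by (subst ennreal_plus) (auto simp: tail_def)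
  moreover have "0 \<le> h * J a + (b - a) * tail h a" using J0[of a] ab by (simp add: tail_def)
  ultimately have 2: "h * J b \<le> h * J a + (b - a) * tail h a" by (simp add: ennreal_le_iff)
  show "(b - a) * (tail h b / h) \<le> measure (tail_measure h) {..b} - measure (tail_measure h) {..a}"
    using 1 h by (simp add: J_def field_simps)
  show "measure (tail_measure h) {..b} - measure (tail_measure h) {..a} \<le> (b - a) * (tail h a / h)"
    using 2 h by (simp add: J_def field_simps)
qed

end

section \<open>Crossings within a short time step\<close>

lemma nn_integral_if_emeasure:
  assumes "Measurable.pred M P"
  shows "(\<integral>\<^sup>+\<omega>. (if P \<omega> then 1 else 0) \<partial>M) = emeasure M {\<omega>\<in>space M. P \<omega>}"
proof -
  have "(\<integral>\<^sup>+\<omega>. (if P \<omega> then 1 else 0) \<partial>M) = (\<integral>\<^sup>+\<omega>. indicator {\<omega>\<in>space M. P \<omega>} \<omega> \<partial>M)"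
    by (intro nn_integral_cong) (auto simp: indicator_def)
  then show ?thesis using assms by (simp add: pred_def)
qed

context subordinator begin

definition crossing :: "real \<Rightarrow> real \<Rightarrow> real \<Rightarrow> ennreal" where
  "crossing x t h = (\<integral>\<^sup>+s. \<integral>\<^sup>+\<omega>. (if 0 < s \<and> trajectory s \<omega> \<le> ennreal x \<and> ennreal t < trajectory (s + h) \<omega>
     then 1 else 0) \<partial>M \<partial>lborel)"

lemma markov_crossing:
  assumes s: "0 < s" and h: "0 < h" and x: "0 \<le> x" and t: "0 \<le> t"
  shows "(\<integral>\<^sup>+\<omega>. (if trajectory s \<omega> \<le> ennreal x \<and> ennreal t < trajectory (s + h) \<omega> then 1 else 0) \<partial>M)
    = (\<integral>\<^sup>+\<omega>'. \<integral>\<^sup>+\<omega>. (if trajectory s \<omega> \<le> ennreal x \<and> ennreal t < trajectory s \<omega> + trajectory h \<omega>' then 1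
        else 0) \<partial>M \<partial>M)"
proof -
  define a where "a = emeasure M {\<omega>\<in>space M. trajectory s \<omega> \<le> ennreal x}"
  define b where "b = (\<lambda>\<omega>'. \<integral>\<^sup>+\<omega>. (if trajectory s \<omega> \<le> ennreal x \<and> trajectory s \<omega> + trajectory h \<omega>'
      \<le> ennreal t then 1 else 0) \<partial>M)"
  have [measurable]: "b \<in> borel_measurable M" unfolding b_def by measurable
  have b: "b \<omega>' = emeasure M {\<omega>\<in>space M. trajectory s \<omega> \<le> ennreal x \<and> trajectory s \<omega> + trajectory h \<omega>'
      \<le> ennreal t}" for \<omega>'
    unfolding b_def by (rule nn_integral_if_emeasure) measurable
  have diff: "(\<integral>\<^sup>+\<omega>. (if trajectory s \<omega> \<le> ennreal x \<and> ennreal t < f \<omega> then 1 else 0) \<partial>M)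
     = a - emeasure M {\<omega>\<in>space M. trajectory s \<omega> \<le> ennreal x \<and> f \<omega> \<le> ennreal t}"
    if [measurable]: "f \<in> borel_measurable M" for f
  proof -
    have "(\<integral>\<^sup>+\<omega>. (if trajectory s \<omega> \<le> ennreal x \<and> ennreal t < f \<omega> then 1 else 0) \<partial>M)
       = emeasure M {\<omega>\<in>space M. trajectory s \<omega> \<le> ennreal x \<and> ennreal t < f \<omega>}"
      by (rule nn_integral_if_emeasure) measurable
    also have "{\<omega>\<in>space M. trajectory s \<omega> \<le> ennreal x \<and> ennreal t < f \<omega>}
       = {\<omega>\<in>space M. trajectory s \<omega> \<le> ennreal x} - {\<omega>\<in>space M. trajectory s \<omega> \<le> ennreal x \<and> f \<omega> \<le> ennreal t}"
      by auto
    also have "emeasure M \<dots> = a - emeasure M {\<omega>\<in>space M. trajectory s \<omega> \<le> ennreal x \<and> f \<omega> \<le> ennreal t}"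
      unfolding a_def by (rule emeasure_Diff) auto
    finally show ?thesis .
  qed
  have "emeasure M {\<omega>\<in>space M. trajectory s \<omega> \<le> ennreal x \<and> trajectory (s + h) \<omega> \<le> ennreal t} = (\<integral>\<^sup>+\<omega>'. b \<omega>' \<partial>M)"
    using markov[OF s h x t] s h by (simp add: b trajectory_eq)
  then have "(\<integral>\<^sup>+\<omega>. (if trajectory s \<omega> \<le> ennreal x \<and> ennreal t < trajectory (s + h) \<omega> then 1 else 0) \<partial>M)
     = a - (\<integral>\<^sup>+\<omega>'. b \<omega>' \<partial>M)"
    by (subst diff) auto
  also have "\<dots> = (\<integral>\<^sup>+\<omega>'. a - b \<omega>' \<partial>M)"
  proof (subst nn_integral_diff)
    show "AE \<omega>' in M. b \<omega>' \<le> a" unfolding b a_def by (intro AE_I2 emeasure_mono) auto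
    have "(\<integral>\<^sup>+\<omega>'. b \<omega>' \<partial>M) \<le> (\<integral>\<^sup>+\<omega>'. 1 \<partial>M)" unfolding b by (intro nn_integral_mono emeasure_le_1)
    then show "(\<integral>\<^sup>+\<omega>'. b \<omega>' \<partial>M) \<noteq> \<infinity>" by (auto simp: emeasure_space_1 top_unique)
  qed (simp_all add: emeasure_space_1)
  also have "\<dots> = (\<integral>\<^sup>+\<omega>'. \<integral>\<^sup>+\<omega>. (if trajectory s \<omega> \<le> ennreal x
      \<and> ennreal t < trajectory s \<omega> + trajectory h \<omega>' then 1 else 0) \<partial>M \<partial>M)"
    unfolding b by (intro nn_integral_cong diff[symmetric]) measurable
  finally show ?thesis .
qed

text \<open>Conditioning on the position \<open>y\<close> at time \<open>s\<close> and integrating over \<open>s\<close> replaces time by the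
  potential measure.\<close>

lemma crossing_potential:
  assumes h: "0 < h" and x: "0 \<le> x" and t: "0 \<le> t"
  shows "crossing x t h = (\<integral>\<^sup>+\<omega>'. emeasure potential (launch x t (trajectory h \<omega>')) \<partial>M)"
proof -
  let ?g = "\<lambda>s \<omega>' \<omega>. (if 0 < s \<and> trajectory s \<omega> \<le> ennreal x \<and> ennreal t < trajectory s \<omega> + trajectory h \<omega>'
      then 1 else 0) :: ennreal"
  have "crossing x t h = (\<integral>\<^sup>+s. \<integral>\<^sup>+\<omega>'. \<integral>\<^sup>+\<omega>. ?g s \<omega>' \<omega> \<partial>M \<partial>M \<partial>lborel)"
    unfolding crossing_def
  proof (rule nn_integral_cong)
    fix s :: real
    show "(\<integral>\<^sup>+\<omega>. (if 0 < s \<and> trajectory s \<omega> \<le> ennreal x \<and> ennreal t < trajectory (s + h) \<omega> then 1 else 0) \<partial>M)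
       = (\<integral>\<^sup>+\<omega>'. \<integral>\<^sup>+\<omega>. ?g s \<omega>' \<omega> \<partial>M \<partial>M)"
      using markov_crossing[OF _ h x t, of s] by (cases "0 < s") simp_all
  qed
  also have "\<dots> = (\<integral>\<^sup>+\<omega>'. \<integral>\<^sup>+s. \<integral>\<^sup>+\<omega>. ?g s \<omega>' \<omega> \<partial>M \<partial>lborel \<partial>M)"
    by (rule time.Fubini'[symmetric]) measurable
  also have "\<dots> = (\<integral>\<^sup>+\<omega>'. emeasure potential (launch x t (trajectory h \<omega>')) \<partial>M)"
  proof (rule nn_integral_cong)
    fix \<omega>'
    let ?A = "launch x t (trajectory h \<omega>')"
    have A[measurable]: "?A \<in> sets borel" by measurable
    have "emeasure potential ?A = (\<integral>\<^sup>+y. indicator ?A y \<partial>potential)" by (subst nn_integral_indicator) auto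
    also have "\<dots> = (\<integral>\<^sup>+s. \<integral>\<^sup>+\<omega>. (if 0 < s \<and> trajectory s \<omega> \<noteq> top then indicator ?A (enn2real (trajectory s \<omega>))
        else 0) \<partial>M \<partial>lborel)"
      by (rule nn_integral_potential) measurable
    also have "\<dots> = (\<integral>\<^sup>+s. \<integral>\<^sup>+\<omega>. ?g s \<omega>' \<omega> \<partial>M \<partial>lborel)"
    proof (intro nn_integral_cong)
      fix s \<omega>
      show "(if 0 < s \<and> trajectory s \<omega> \<noteq> top then indicator ?A (enn2real (trajectory s \<omega>)) else 0) = ?g s \<omega>' \<omega>"
        using x by (cases "trajectory s \<omega>") (auto simp: indicator_def ennreal_le_iff top_unique)
    qed
    finally show "(\<integral>\<^sup>+s. \<integral>\<^sup>+\<omega>. ?g s \<omega>' \<omega> \<partial>M \<partial>lborel) = emeasure potential ?A" by simp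
  qed
  finally show ?thesis .
qed

text \<open>By its Laplace transform, the process exceeds \<open>t\<close> at a large time, and does not exceed \<open>t\<close> at a
  small time, with probability tending to one.\<close>

lemma AE_passage_time_finite:
  assumes t: "0 < t"
  shows "AE \<omega> in M. \<exists>l>0. passage_time \<tau> t \<omega> = ereal l"
proof -
  have P: "0 < \<Phi> 1" by (rule \<Phi>_pos) simp
  have laplace1: "(\<integral>\<^sup>+\<omega>. killed_exp 1 (trajectory s \<omega>) \<partial>M) = ennreal (exp (- \<Phi> 1 * s))" if "0 < s" for s
    using laplace[OF zero_less_one that] that by (simp add: trajectory_eq)
  have le1: "killed_exp 1 z \<le> 1" for z
    by (auto simp: killed_exp_def simp flip: ennreal_1 intro!: ennreal_leI)
  have late: "AE \<omega> in M. \<exists>n::nat. \<not> trajectory (Suc n) \<omega> \<le> ennreal t"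
  proof (rule AE_I[of _ _ "{\<omega>\<in>space M. \<forall>n::nat. trajectory (Suc n) \<omega> \<le> ennreal t}"])
    let ?N = "{\<omega>\<in>space M. \<forall>n::nat. trajectory (Suc n) \<omega> \<le> ennreal t}"
    have le: "emeasure M ?N \<le> ennreal (exp t * exp (- \<Phi> 1 * Suc n))" for n
    proof -
      have "emeasure M ?N = (\<integral>\<^sup>+\<omega>. indicator ?N \<omega> \<partial>M)" by (subst nn_integral_indicator) auto
      also have "\<dots> \<le> (\<integral>\<^sup>+\<omega>. ennreal (exp t) * killed_exp 1 (trajectory (Suc n) \<omega>) \<partial>M)"
      proof (rule nn_integral_mono)
        fix \<omega>
        show "indicator ?N \<omega> \<le> ennreal (exp t) * killed_exp 1 (trajectory (Suc n) \<omega>)"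
        proof (cases "\<omega> \<in> ?N")
          case True
          then have *: "trajectory (Suc n) \<omega> \<le> ennreal t" by blast
          then obtain r where r: "trajectory (Suc n) \<omega> = ennreal r" "0 \<le> r"
            by (cases "trajectory (Suc n) \<omega>") (auto simp: top_unique)
          then have "r \<le> t" using * t by (simp add: ennreal_le_iff)
          then have "1 \<le> exp t * exp (- r)" by (simp flip: exp_add)
          then show ?thesis using r True by (simp flip: ennreal_mult ennreal_1 add: ennreal_le_iff)
        qed simp
      qed
      also have "\<dots> = ennreal (exp t) * ennreal (exp (- \<Phi> 1 * Suc n))"
        by (subst nn_integral_cmult) (auto simp: laplace1)
      finally show ?thesis by (simp add: ennreal_mult)
    qed
    have "(\<lambda>n. exp t * exp (- \<Phi> 1 * real (Suc n))) \<longlonglongrightarrow> 0" using P by real_asymp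
    then have "(\<lambda>n. ennreal (exp t * exp (- \<Phi> 1 * real (Suc n)))) \<longlonglongrightarrow> ennreal 0" by (rule tendsto_ennrealI)
    then have "emeasure M ?N \<le> ennreal 0" by (rule LIMSEQ_le_const) (use le in auto)
    then show "emeasure M ?N = 0" by simp
    show "?N \<in> sets M" by measurable
  qed auto
  have early: "AE \<omega> in M. \<exists>n::nat. \<not> ennreal t < trajectory (1 / Suc n) \<omega>"
  proof (rule AE_I[of _ _ "{\<omega>\<in>space M. \<forall>n::nat. ennreal t < trajectory (1 / Suc n) \<omega>}"])
    let ?N = "{\<omega>\<in>space M. \<forall>n::nat. ennreal t < trajectory (1 / Suc n) \<omega>}"
    have t1: "0 < 1 - exp (- t)" using t by simp
    have le: "emeasure M ?N \<le> ennreal (1 / (1 - exp (- t)) * (1 - exp (- \<Phi> 1 * (1 / Suc n))))" for n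
    proof -
      let ?s = "1 / real (Suc n)"
      have 0: "0 \<le> 1 - exp (- \<Phi> 1 * ?s)" using P by simp
      have "emeasure M ?N = (\<integral>\<^sup>+\<omega>. indicator ?N \<omega> \<partial>M)" by (subst nn_integral_indicator) auto
      also have "\<dots> \<le> (\<integral>\<^sup>+\<omega>. ennreal (1 / (1 - exp (- t))) * (1 - killed_exp 1 (trajectory ?s \<omega>)) \<partial>M)"
      proof (rule nn_integral_mono)
        fix \<omega>
        show "indicator ?N \<omega> \<le> ennreal (1 / (1 - exp (- t))) * (1 - killed_exp 1 (trajectory ?s \<omega>))"
        proof (cases "\<omega> \<in> ?N")
          case True
          then have *: "ennreal t < trajectory ?s \<omega>" by blast
          have "ennreal (1 - exp (- t)) \<le> 1 - killed_exp 1 (trajectory ?s \<omega>)"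
          proof (cases "trajectory ?s \<omega>")
            case (real r)
            then have "t \<le> r" using * t by (simp add: ennreal_less_iff)
            then have "ennreal (1 - exp (- t)) \<le> ennreal (1 - exp (- r))" by (intro ennreal_leI) simp
            also have "\<dots> = 1 - killed_exp 1 (trajectory ?s \<omega>)" using real by (simp add: ennreal_minus flip: ennreal_1)
            finally show ?thesis .
          next
            case top
            then show ?thesis using t by (simp add: killed_exp_def flip: ennreal_1)
          qed
          then have "ennreal (1 / (1 - exp (- t))) * ennreal (1 - exp (- t))
             \<le> ennreal (1 / (1 - exp (- t))) * (1 - killed_exp 1 (trajectory ?s \<omega>))"
            by (rule mult_left_mono) simp
          also have "ennreal (1 / (1 - exp (- t))) * ennreal (1 - exp (- t)) = 1"
            using t1 by (simp flip: ennreal_mult ennreal_1)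
          finally show ?thesis using True by simp
        qed simp
      qed
      also have "\<dots> = ennreal (1 / (1 - exp (- t))) * (1 - ennreal (exp (- \<Phi> 1 * ?s)))"
        by (subst nn_integral_cmult, simp, subst nn_integral_diff) (auto simp: laplace1 le1 emeasure_space_1)
      also have "\<dots> = ennreal (1 / (1 - exp (- t)) * (1 - exp (- \<Phi> 1 * ?s)))"
      proof -
        have eq: "1 - ennreal (exp (- \<Phi> 1 * ?s)) = ennreal (1 - exp (- \<Phi> 1 * ?s))"
          using 0 by (simp add: ennreal_minus flip: ennreal_1)
        show ?thesis unfolding eq by (rule ennreal_mult[symmetric]) (use 0 t1 in auto)
      qed
      finally show ?thesis .
    qed
    have "(\<lambda>n. 1 / (1 - exp (- t)) * (1 - exp (- \<Phi> 1 * (1 / real (Suc n))))) \<longlonglongrightarrow> 0" by real_asymp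
    then have "(\<lambda>n. ennreal (1 / (1 - exp (- t)) * (1 - exp (- \<Phi> 1 * (1 / real (Suc n)))))) \<longlonglongrightarrow> ennreal 0"
      by (rule tendsto_ennrealI)
    then have "emeasure M ?N \<le> ennreal 0" by (rule LIMSEQ_le_const) (use le in auto)
    then show "emeasure M ?N = 0" by simp
    show "?N \<in> sets M" by measurable
  qed auto
  show ?thesis
    using late early increasing
  proof eventually_elim
    case (elim \<omega>)
    let ?L = "passage_time \<tau> t \<omega>"
    obtain n :: nat where n: "\<not> trajectory (Suc n) \<omega> \<le> ennreal t" using elim by blast
    then have "?L \<le> ereal (Suc n)"
      using below_passage_time[of "Suc n" \<tau> t \<omega>] by (auto simp: trajectory_eq not_le[symmetric])
    moreover obtain m :: nat where m: "\<not> ennreal t < trajectory (1 / Suc m) \<omega>" using elim by blast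
    then have "ereal (1 / Suc m) \<le> ?L"
      using above_passage_time[of "1 / Suc m" \<tau> t \<omega>] elim(3) by (auto simp: trajectory_eq not_le[symmetric])
    ultimately obtain l where l: "?L = ereal l" "1 / Suc m \<le> l" by (cases ?L) auto
    have "0 < 1 / real (Suc m)" by simp
    then have "0 < l" using l(2) by (rule order_less_le_trans)
    then show ?case using l(1) by blast
  qed
qed

lemma crossing_sojourn:
  assumes h: "0 < h"
  shows "crossing x t h
    = (\<integral>\<^sup>+\<omega>. emeasure lborel (sojourn \<tau> x t h \<omega>) \<partial>M)"
    and "\<omega> \<in> space M \<Longrightarrow> (sojourn \<tau> x t h \<omega>) \<in> sets borel"
    and "(\<lambda>\<omega>. emeasure lborel (sojourn \<tau> x t h \<omega>)) \<in> borel_measurable M"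
proof -
  let ?g = "\<lambda>s \<omega>. (if 0 < s \<and> trajectory s \<omega> \<le> ennreal x \<and> ennreal t < trajectory (s + h) \<omega> then 1 else 0) :: ennreal"
  have eq: "(sojourn \<tau> x t h \<omega>)
     = {s. 0 < s \<and> trajectory s \<omega> \<le> ennreal x \<and> ennreal t < trajectory (s + h) \<omega>}" for \<omega>
    using h by (auto simp: trajectory_eq)
  show sets: "(sojourn \<tau> x t h \<omega>) \<in> sets borel"
    if [measurable]: "\<omega> \<in> space M" for \<omega>
  proof -
    have "{s \<in> space borel. 0 < s \<and> trajectory s \<omega> \<le> ennreal x \<and> ennreal t < trajectory (s + h) \<omega>} \<in> sets borel"
      by measurable
    then show ?thesis by (simp add: eq)
  qed
  have em: "emeasure lborel (sojourn \<tau> x t h \<omega>) = (\<integral>\<^sup>+s. ?g s \<omega> \<partial>lborel)"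
    if "\<omega> \<in> space M" for \<omega>
  proof -
    have "(\<integral>\<^sup>+s. ?g s \<omega> \<partial>lborel) = emeasure lborel {s\<in>space lborel. 0 < s \<and> trajectory s \<omega> \<le> ennreal x
        \<and> ennreal t < trajectory (s + h) \<omega>}"
      using sets[OF that] by (intro nn_integral_if_emeasure) (simp add: pred_def eq)
    then show ?thesis by (simp add: eq)
  qed
  show "(\<lambda>\<omega>. emeasure lborel (sojourn \<tau> x t h \<omega>)) \<in> borel_measurable M"
    by (subst measurable_cong[OF em]) measurable
  have "crossing x t h = (\<integral>\<^sup>+\<omega>. \<integral>\<^sup>+s. ?g s \<omega> \<partial>lborel \<partial>M)"
    unfolding crossing_def by (rule time.Fubini'[symmetric]) measurable
  also have "\<dots> = (\<integral>\<^sup>+\<omega>. emeasure lborel (sojourn \<tau> x t h \<omega>) \<partial>M)"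
    by (intro nn_integral_cong em[symmetric])
  finally show "crossing x t h
    = (\<integral>\<^sup>+\<omega>. emeasure lborel (sojourn \<tau> x t h \<omega>) \<partial>M)" .
qed

lemma AE_sojourn_le:
  assumes t: "0 < t" and x: "0 \<le> x" "x \<le> t" and h: "0 < h"
  shows "AE \<omega> in M. emeasure lborel (sojourn \<tau> x t h \<omega>) \<le> ennreal h"
  using AE_passage_time_finite[OF t] increasing AE_space
proof eventually_elim
  case (elim \<omega>)
  then obtain l where l: "passage_time \<tau> t \<omega> = ereal l" "0 < l" by blast
  show ?case by (rule undershoot_sojourn(1)[OF l elim(2) x h crossing_sojourn(2)[OF h elim(3)]])
qed

lemma crossing_le:
  assumes t: "0 < t" and x: "0 \<le> x" "x \<le> t" and h: "0 < h"
  shows "crossing x t h \<le> ennreal h"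
proof -
  have "crossing x t h \<le> (\<integral>\<^sup>+\<omega>. ennreal h \<partial>M)"
    unfolding crossing_sojourn(1)[OF h] by (rule nn_integral_mono_AE[OF AE_sojourn_le[OF assms]])
  then show ?thesis by (simp add: emeasure_space_1)
qed

text \<open>Dominated convergence applied to \<open>undershoot_sojourn\<close>.\<close>

lemma crossing_limit:
  assumes t: "0 < t" and x: "0 \<le> x" "x \<le> t"
  shows "(\<lambda>n. ennreal (Suc n) * crossing x t (1 / Suc n)) \<longlonglongrightarrow> emeasure M {\<omega>\<in>space M. undershoot \<tau> t \<omega> \<le> ennreal x}"
proof -
  define S where "S = (\<lambda>n \<omega>. (sojourn \<tau> x t (1 / real (Suc n)) \<omega>))"
  have h: "0 < 1 / real (Suc n)" for n by simp
  note [measurable] = crossing_sojourn(3)[OF h]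
  have mS[measurable]: "(\<lambda>\<omega>. emeasure lborel (S n \<omega>)) \<in> borel_measurable M" for n unfolding S_def by measurable
  have hh: "ennreal (real (Suc n)) * ennreal (1 / real (Suc n))
      = 1" for n by (simp flip: ennreal_mult ennreal_1 del: of_nat_Suc)
  let ?I = "\<lambda>\<omega>. indicator {\<omega>\<in>space M. undershoot \<tau> t \<omega> \<le> ennreal x} \<omega> :: ennreal"
  have "(\<lambda>n. \<integral>\<^sup>+\<omega>. ennreal (Suc n) * emeasure lborel (S n \<omega>) \<partial>M) \<longlonglongrightarrow> (\<integral>\<^sup>+\<omega>. ?I \<omega> \<partial>M)"
  proof (rule nn_integral_dominated_convergence[where w="\<lambda>_. 1"])
    fix n
    show "AE \<omega> in M. ennreal (Suc n) * emeasure lborel (S n \<omega>) \<le> 1"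
      using AE_sojourn_le[OF t x h[of n]]
    proof eventually_elim
      case (elim \<omega>)
      then have "ennreal (Suc n) * emeasure lborel (S n \<omega>) \<le> ennreal (Suc n) * ennreal (1 / real (Suc n))"
        unfolding S_def by (intro mult_left_mono) auto
      then show ?case by (simp only: hh)
    qed
  next
    show "AE \<omega> in M. (\<lambda>n. ennreal (Suc n) * emeasure lborel (S n \<omega>)) \<longlonglongrightarrow> ?I \<omega>"
      using AE_passage_time_finite[OF t] increasing AE_space
    proof eventually_elim
      case (elim \<omega>)
      then obtain l where l: "passage_time \<tau> t \<omega> = ereal l" "0 < l" by blast
      obtain d where d: "d > 0" "\<And>h. 0 < h \<Longrightarrow> h < d \<Longrightarrow>
         emeasure lborel (sojourn \<tau> x t h \<omega>) = (if undershoot \<tau> t \<omega> \<le> ennreal x then ennreal h else 0)"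
        using undershoot_sojourn(2)[OF l elim(2) x] crossing_sojourn(2)[OF _ elim(3)] by blast
      have "(\<lambda>n. 1 / real (Suc n)) \<longlonglongrightarrow> 0" by real_asymp
      then have "\<forall>\<^sub>F n in sequentially. 1 / real (Suc n) < d" using d(1) by (rule order_tendstoD)
      then have "\<forall>\<^sub>F n in sequentially. ?I \<omega> = ennreal (Suc n) * emeasure lborel (S n \<omega>)"
      proof eventually_elim
        case (elim n)
        have "emeasure lborel (S n \<omega>) = (if undershoot \<tau> t \<omega> \<le> ennreal x then ennreal (1 / real (Suc n)) else 0)"
          unfolding S_def using d(2)[OF h elim] .
        then show ?case using \<open>\<omega> \<in> space M\<close> hh[of n] by (simp add: indicator_def del: of_nat_Suc)
      qed
      then show ?case by (rule Lim_transform_eventually[OF tendsto_const])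
    qed
  qed (auto simp: emeasure_space_1)
  moreover have "(\<integral>\<^sup>+\<omega>. ennreal (Suc n) * emeasure lborel (S n \<omega>) \<partial>M)
      = ennreal (Suc n) * crossing x t (1 / Suc n)" for n
  proof -
    have "crossing x t (1 / Suc n) = (\<integral>\<^sup>+\<omega>. emeasure lborel (S n \<omega>) \<partial>M)"
      unfolding S_def by (rule crossing_sojourn(1)[OF h])
    then show ?thesis by (simp only:) (rule nn_integral_cmult, measurable)
  qed
  ultimately show ?thesis by simp
qed

abbreviation prob_le :: "real \<Rightarrow> real \<Rightarrow> real" where
  "prob_le t x \<equiv> prob {\<omega>\<in>space M. undershoot \<tau> t \<omega> \<le> ennreal x}"

abbreviation prob_ge :: "real \<Rightarrow> real \<Rightarrow> real" where
  "prob_ge t a \<equiv> prob {\<omega>\<in>space M. ennreal a \<le> undershoot \<tau> t \<omega>}"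

definition rate :: "real \<Rightarrow> real \<Rightarrow> real \<Rightarrow> real" where
  "rate x t h = enn2real (crossing x t h) / h"

lemma rate_limit:
  assumes t: "0 < t" and x: "0 \<le> x" "x \<le> t"
  shows "(\<lambda>n. rate x t (1 / Suc n)) \<longlonglongrightarrow> prob_le t x"
proof -
  have "(\<lambda>n. enn2real (ennreal (Suc n) * crossing x t (1 / Suc n))) \<longlonglongrightarrow> prob_le t x"
    using crossing_limit[OF assms] by (intro tendsto_enn2real) (auto simp only: emeasure_eq_measure measure_nonneg)
  moreover have "enn2real (ennreal (Suc n) * crossing x t (1 / Suc n)) = rate x t (1 / Suc n)" for n
    by (simp add: rate_def enn2real_mult del: of_nat_Suc)
  ultimately show ?thesis by simp
qed

lemma potential_fin: "emeasure potential {..x} = ennreal (measure potential {..x})"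
  by (rule has_laplace_finite(2)[OF potential_laplace])

lemma crossing_eq_rate:
  assumes t: "0 < t" and x: "0 \<le> x" "x \<le> t" and h: "0 < h"
  shows "crossing x t h = ennreal (h * rate x t h)"
proof -
  have "crossing x t h < top" using crossing_le[OF assms] by (rule le_less_trans) simp
  then show ?thesis using h by (simp add: rate_def)
qed

lemma rate_bounds:
  assumes t: "0 < t" and x: "0 \<le> x" "x < t" and h: "0 < h"
  shows "measure potential {..x} * (tail h t / h) \<le> rate x t h"
    and "rate x t h \<le> measure potential {..x} * (tail h (t - x) / h)"
proof -
  define U where "U = measure potential {..x}"
  have r0: "0 \<le> h * rate x t h" using h by (simp add: rate_def)
  have C: "crossing x t h = (\<integral>\<^sup>+\<omega>'. emeasure potential (launch x t (trajectory h \<omega>')) \<partial>M)"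
    using assms by (intro crossing_potential) auto
  have Cr: "crossing x t h = ennreal (h * rate x t h)" using assms by (intro crossing_eq_rate) auto
  have T: "(\<integral>\<^sup>+\<omega>. ennreal U * indicator {\<omega>\<in>space M. ennreal z < trajectory h \<omega>} \<omega> \<partial>M) = ennreal (U * tail h z)" for z
    by (subst nn_integral_cmult_indicator) (auto simp: tail_def emeasure_eq_measure ennreal_mult U_def)
  have "(\<integral>\<^sup>+\<omega>. ennreal U * indicator {\<omega>\<in>space M. ennreal t < trajectory h \<omega>} \<omega> \<partial>M)
      \<le> (\<integral>\<^sup>+\<omega>'. emeasure potential (launch x t (trajectory h \<omega>')) \<partial>M)"
  proof (rule nn_integral_mono)
    fix \<omega>
    show "ennreal U * indicator {\<omega>\<in>space M. ennreal t < trajectory h \<omega>} \<omega>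
        \<le> emeasure potential (launch x t (trajectory h \<omega>))"
    proof (cases "ennreal t < trajectory h \<omega> \<and> \<omega> \<in> space M")
      case True
      then have "ennreal t < ennreal y + trajectory h \<omega>" for y
        using less_le_trans[OF _ add_increasing[OF zero_le order_refl]] by blast
      then have "(launch x t (trajectory h \<omega>)) = {..x}" by auto
      then show ?thesis using True by (simp add: U_def potential_fin)
    qed (auto simp: indicator_def)
  qed
  then have 1: "U * tail h t \<le> h * rate x t h"
    using r0 unfolding T C[symmetric] Cr by (simp add: ennreal_le_iff)
  have "(\<integral>\<^sup>+\<omega>'. emeasure potential (launch x t (trajectory h \<omega>')) \<partial>M)
      \<le> (\<integral>\<^sup>+\<omega>. ennreal U * indicator {\<omega>\<in>space M. ennreal (t - x) < trajectory h \<omega>} \<omega> \<partial>M)"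
  proof (rule nn_integral_mono)
    fix \<omega> assume \<omega>: "\<omega> \<in> space M"
    show "emeasure potential (launch x t (trajectory h \<omega>)) \<le> ennreal U * indicator {\<omega>\<in>space M. ennreal (t
        - x) < trajectory h \<omega>} \<omega>"
    proof (cases "ennreal (t - x) < trajectory h \<omega>")
      case True
      have "emeasure potential (launch x t (trajectory h \<omega>)) \<le> emeasure potential {..x}"
        by (intro emeasure_mono) auto
      then show ?thesis using True \<omega> by (simp add: U_def potential_fin)
    next
      case False
      have "\<not> ennreal t < ennreal y + trajectory h \<omega>" if "y \<le> x" for y
      proof -
        have "ennreal y + trajectory h \<omega> \<le> ennreal x + ennreal (t - x)"
          using that False by (intro add_mono ennreal_leI) auto
        also have "\<dots> = ennreal t" using x by (simp flip: ennreal_plus)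
        finally show ?thesis by simp
      qed
      then have "(launch x t (trajectory h \<omega>)) = {}" by auto
      then show ?thesis by (metis emeasure_empty zero_le)
    qed
  qed
  then have 2: "h * rate x t h \<le> U * tail h (t - x)"
    unfolding T C[symmetric] Cr by (subst (asm) ennreal_le_iff) (auto simp: U_def tail_def)
  show "measure potential {..x} * (tail h t / h) \<le> rate x t h" using 1 h by (simp add: U_def field_simps)
  show "rate x t h \<le> measure potential {..x} * (tail h (t - x) / h)" using 2 h by (simp add: U_def field_simps)
qed

text \<open>For fixed \<open>z = \<tau>(h)\<close> the positions \<open>y \<in> (a, t]\<close> from which a jump of size \<open>z\<close> leads above \<open>t\<close> form the
  interval of length \<open>min z (t - a)\<close> that ends at \<open>t\<close>; its potential measure lies between \<open>v t\<close> and
  \<open>v a\<close> times this length.  The expectation of \<open>min z (t - a)\<close> is given by the tail measure.\<close>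

lemma rate_increment_bounds:
  assumes a: "0 < a" "a < t" and h: "0 < h"
    and v: "\<And>p q. 0 < p \<Longrightarrow> p < q \<Longrightarrow>
      v q * (q - p) \<le> measure potential {..q} - measure potential {..p} \<and>
      measure potential {..q} - measure potential {..p} \<le> v p * (q - p)"
  shows "v t * measure (tail_measure h) {..t - a} \<le> rate t t h - rate a t h"
    and "rate t t h - rate a t h \<le> v a * measure (tail_measure h) {..t - a}"
proof -
  have t: "0 < t" using a by simp
  define U where "U = (\<lambda>x. measure potential {..x})"
  define J where "J = measure (tail_measure h) {..t - a}"
  have J: "(\<integral>\<^sup>+\<omega>. min (trajectory h \<omega>) (ennreal (t - a)) \<partial>M) = ennreal (h * J)"
    unfolding J_def using a by (intro tail_measure_atMost[OF h]) simp
  have J0: "0 \<le> J" by (simp add: J_def)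
  have Uv: "v q * (q - p) \<le> U q - U p" "U q - U p \<le> v p * (q - p)" if "0 < p" "p < q" for p q
    using v[OF that] by (auto simp: U_def)
  have Umono: "U p \<le> U q" if "p \<le> q" for p q
    unfolding U_def using has_laplace_mono[OF potential_laplace that] .
  have v0: "0 \<le> v p" if "0 < p" for p
    using Uv(2)[of p "p + 1"] Umono[of p "p + 1"] that by simp
  have vmono: "v q \<le> v p" if "0 < p" "p \<le> q" for p q
  proof (cases "p = q")
    case False
    then have "v q * (q - p) \<le> v p * (q - p)" using Uv[of p q] that by linarith
    then show ?thesis using False that by (simp add: mult_le_cancel_right)
  qed simp
  define E where "E = (\<lambda>\<omega>. {y. a < y \<and> y \<le> t \<and> ennreal t < ennreal y + trajectory h \<omega>})"
  have Em: "E \<omega> \<in> sets borel" for \<omega> unfolding E_def by measurable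
  have E: "ennreal (v t) * min (trajectory h \<omega>) (ennreal (t - a)) \<le> emeasure potential (E \<omega>)"
    "emeasure potential (E \<omega>) \<le> ennreal (v a) * min (trajectory h \<omega>) (ennreal (t - a))" for \<omega>
  proof -
    obtain r where r: "min (trajectory h \<omega>) (ennreal (t - a)) = ennreal r" "0 \<le> r" "r \<le> t - a"
      and Er: "E \<omega> = {t - r<..t}"
    proof (cases "trajectory h \<omega> \<le> ennreal (t - a)")
      case True
      then obtain z where z: "trajectory h \<omega> = ennreal z" "0 \<le> z"
        by (cases "trajectory h \<omega>") (auto simp: top_unique)
      have "z \<le> t - a" using True z a by (simp add: ennreal_le_iff)
      then show thesis using True z a
        by (intro that[of z]) (auto simp: E_def ennreal_less_iff simp flip: ennreal_plus)
    next
      case False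
      then have less: "ennreal (t - a) < trajectory h \<omega>" by simp
      have "ennreal t < ennreal y + trajectory h \<omega>" if "a < y" for y
      proof -
        have "ennreal t = ennreal a + ennreal (t - a)" using a by (simp flip: ennreal_plus)
        also have "\<dots> < ennreal a + trajectory h \<omega>" using less by (simp add: ennreal_add_left_cancel_less)
        also have "\<dots> \<le> ennreal y + trajectory h \<omega>" using that by (intro add_mono ennreal_leI) auto
        finally show ?thesis .
      qed
      then show thesis using less a by (intro that[of "t - a"]) (auto simp: E_def min_def)
    qed
    have "emeasure potential (E \<omega>) = emeasure potential {..t} - emeasure potential {..t - r}"
    proof -
      have "E \<omega> = {..t} - {..t - r}" using Er by auto
      then show ?thesis using r(2) by (simp only:) (rule emeasure_Diff, auto simp: potential_fin)
    qed
    also have "\<dots> = ennreal (U t - U (t - r))"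
      by (simp add: potential_fin U_def ennreal_minus)
    finally have eq: "emeasure potential (E \<omega>) = ennreal (U t - U (t - r))" .
    have bounds: "v t * r \<le> U t - U (t - r) \<and> U t - U (t - r) \<le> v a * r"
    proof (cases "r = 0")
      case False
      have "U t - U (t - r) \<le> v (t - r) * r" "v t * r \<le> U t - U (t - r)"
        using Uv[of "t - r" t] False r a by auto
      moreover have "v (t - r) * r \<le> v a * r" using vmono[of a "t - r"] a r by (intro mult_right_mono) auto
      ultimately show ?thesis by linarith
    qed simp
    show "ennreal (v t) * min (trajectory h \<omega>) (ennreal (t - a)) \<le> emeasure potential (E \<omega>)"
      using bounds v0[OF t] r unfolding eq r(1) by (simp flip: ennreal_mult add: ennreal_leI)
    show "emeasure potential (E \<omega>) \<le> ennreal (v a) * min (trajectory h \<omega>) (ennreal (t - a))"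
      using bounds v0[of a] a r unfolding eq r(1) by (simp flip: ennreal_mult add: ennreal_leI)
  qed
  have meas_em: "(\<lambda>\<omega>. emeasure potential (F \<omega>)) \<in> borel_measurable M"
    if "F = (\<lambda>\<omega>. {y. P y \<and> ennreal t < ennreal y
        + trajectory h \<omega>})" and [measurable]: "Measurable.pred borel P" for F P
  proof -
    interpret sigma_finite_measure potential
    proof
      show "\<exists>A. countable A \<and> A \<subseteq> sets potential \<and> \<Union> A = space potential \<and> (\<forall>a\<in>A. emeasure potential a \<noteq> \<infinity>)"
        by (intro exI[of _ "range (\<lambda>n::nat. {..real n})"])
          (use real_arch_simple in \<open>auto simp: potential_fin has_laplaceD(3)[OF potential_laplace]\<close>)
    qed
    have "(\<lambda>\<omega>. \<integral>\<^sup>+y. (if P y \<and> ennreal t < ennreal y + trajectory h \<omega> then 1 else 0) \<partial>potential) \<in> borel_measurable M"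
      by measurable
    moreover have "(\<integral>\<^sup>+y. (if P y \<and> ennreal t < ennreal y + trajectory h \<omega> then 1 else 0) \<partial>potential)
        = emeasure potential (F \<omega>)" for \<omega>
      by (subst nn_integral_if_emeasure) (auto simp: that has_laplaceD(3)[OF potential_laplace])
    ultimately show ?thesis by simp
  qed
  have [measurable]: "(\<lambda>\<omega>. emeasure potential (E \<omega>)) \<in> borel_measurable M"
    by (rule meas_em[of _ "\<lambda>y. a < y \<and> y \<le> t"]) (auto simp: E_def fun_eq_iff)
  have [measurable]: "(\<lambda>\<omega>. emeasure potential (launch a t (trajectory h \<omega>))) \<in> borel_measurable M"
    by (rule meas_em[of _ "\<lambda>y. y \<le> a"]) auto
  have "crossing t t h = (\<integral>\<^sup>+\<omega>. emeasure potential (launch t t (trajectory h \<omega>)) \<partial>M)"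
    using t h by (intro crossing_potential) auto
  also have "\<dots> = (\<integral>\<^sup>+\<omega>. emeasure potential (launch a t (trajectory h \<omega>)) + emeasure potential (E \<omega>) \<partial>M)"
  proof (intro nn_integral_cong)
    fix \<omega>
    have "(launch t t (trajectory h \<omega>)) = (launch a t (trajectory h \<omega>)) \<union> E \<omega>"
      using a by (auto simp: E_def)
    moreover have "(launch a t (trajectory h \<omega>)) \<in> sets borel" by measurable
    ultimately show "emeasure potential (launch t t (trajectory h \<omega>))
       = emeasure potential (launch a t (trajectory h \<omega>)) + emeasure potential (E \<omega>)"
      using Em[of \<omega>] by (simp add: plus_emeasure[symmetric] E_def disjoint_iff)
  qed
  also have "\<dots> = (\<integral>\<^sup>+\<omega>. emeasure potential (launch a t (trajectory h \<omega>)) \<partial>M) + (\<integral>\<^sup>+\<omega>. emeasure potential (E \<omega>) \<partial>M)"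
    by (rule nn_integral_add) measurable
  also have "(\<integral>\<^sup>+\<omega>. emeasure potential (launch a t (trajectory h \<omega>)) \<partial>M) = crossing a t h"
    using t h a by (intro crossing_potential[symmetric]) auto
  finally have sum: "ennreal (h * rate t t h) = ennreal (h * rate a t h) + (\<integral>\<^sup>+\<omega>. emeasure potential (E \<omega>) \<partial>M)"
    using crossing_eq_rate[OF t, of t h] crossing_eq_rate[OF t, of a h] a h by simp
  have r0: "0 \<le> h * rate x t h" for x using h by (simp add: rate_def)
  have "ennreal (v t * (h * J)) = (\<integral>\<^sup>+\<omega>. ennreal (v t) * min (trajectory h \<omega>) (ennreal (t - a)) \<partial>M)"
    using v0[OF t] J0 h by (subst nn_integral_cmult) (auto simp: J ennreal_mult)
  also have "\<dots> \<le> (\<integral>\<^sup>+\<omega>. emeasure potential (E \<omega>) \<partial>M)" by (intro nn_integral_mono E)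
  finally have "ennreal (h * rate a t h + v t * (h * J)) \<le> ennreal (h * rate t t h)"
    using sum r0[of a] v0[OF t] J0 h by (subst ennreal_plus) (auto intro: add_left_mono)
  then have 1: "h * rate a t h + v t * (h * J) \<le> h * rate t t h" by (simp add: ennreal_le_iff r0)
  have "(\<integral>\<^sup>+\<omega>. emeasure potential (E \<omega>) \<partial>M) \<le> (\<integral>\<^sup>+\<omega>. ennreal (v a) * min (trajectory h \<omega>) (ennreal (t - a)) \<partial>M)"
    by (intro nn_integral_mono E)
  also have "\<dots> = ennreal (v a * (h * J))"
    using v0[of a] a J0 h by (subst nn_integral_cmult) (auto simp: J ennreal_mult)
  finally have "ennreal (h * rate t t h) \<le> ennreal (h * rate a t h + v a * (h * J))"
    using sum r0[of a] v0[of a] a J0 h by (subst ennreal_plus) (auto intro: add_left_mono)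
  moreover have "0 \<le> h * rate a t h + v a * (h * J)" using r0[of a] v0[of a] a J0 h by simp
  ultimately have 2: "h * rate t t h \<le> h * rate a t h + v a * (h * J)" by (simp add: ennreal_le_iff)
  have "h * (v t * J) \<le> h * (rate t t h - rate a t h)" using 1 by (simp add: algebra_simps)
  then show "v t * measure (tail_measure h) {..t - a} \<le> rate t t h - rate a t h"
    using h by (simp add: J_def)
  have "h * (rate t t h - rate a t h) \<le> h * (v a * J)" using 2 by (simp add: algebra_simps)
  then show "rate t t h - rate a t h \<le> v a * measure (tail_measure h) {..t - a}"
    using h by (simp add: J_def)
qed

end

section \<open>Regularly varying Laplace exponents\<close>

text \<open>The monotone density theorem: a monotone density at \<open>x\<close> is squeezed between difference quotients of
  its distribution function to the left and to the right of \<open>x\<close>.\<close>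

lemma monotone_density_limit:
  fixes G f :: "'i \<Rightarrow> real \<Rightarrow> real"
  assumes ev: "\<forall>\<^sub>F i in F. \<forall>a b. 0 < a \<longrightarrow> a < b \<longrightarrow> f i b * (b - a) \<le> G i b - G i a \<and> G i b - G i a \<le> f i a * (b - a)"
    and lim: "\<And>a. a > 0 \<Longrightarrow> ((\<lambda>i. G i a) \<longlongrightarrow> c * a powr \<rho>) F"
    and x: "(x \<longlongrightarrow> 1) F"
  shows "((\<lambda>i. f i (x i)) \<longlongrightarrow> c * \<rho>) F"
proof (rule tendstoI)
  fix e :: real assume e: "e > 0"
  have "((\<lambda>d. (c * (1 - d) powr \<rho> - c * (1 - 2 * d) powr \<rho>) / d) \<longlongrightarrow> c * \<rho>) (at_right 0)"
    "((\<lambda>d. (c * (1 + 2 * d) powr \<rho> - c * (1 + d) powr \<rho>) / d) \<longlongrightarrow> c * \<rho>) (at_right 0)"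
    by real_asymp+
  then have "\<forall>\<^sub>F d in at_right 0. dist ((c * (1 - d) powr \<rho> - c * (1 - 2 * d) powr \<rho>) / d) (c * \<rho>) < e"
    "\<forall>\<^sub>F d in at_right 0. dist ((c * (1 + 2 * d) powr \<rho> - c * (1 + d) powr \<rho>) / d) (c * \<rho>) < e"
    using e by (auto dest: tendstoD)
  moreover have "\<forall>\<^sub>F d in at_right (0::real). d < 1/4" by real_asymp
  moreover have "\<forall>\<^sub>F d in at_right (0::real). 0 < d" by (rule eventually_at_right_less)
  ultimately have "\<forall>\<^sub>F d in at_right 0. dist ((c * (1 - d) powr \<rho> - c * (1 - 2 * d) powr \<rho>) / d) (c * \<rho>) < e \<and>
    dist ((c * (1 + 2 * d) powr \<rho> - c * (1 + d) powr \<rho>) / d) (c * \<rho>) < e \<and> d < 1/4 \<and> 0 < d"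
    by eventually_elim auto
  then obtain d where d: "0 < d" "d < 1/4"
    and d1: "(c * (1 - d) powr \<rho> - c * (1 - 2 * d) powr \<rho>) / d < c * \<rho> + e"
    and d2: "c * \<rho> - e < (c * (1 + 2 * d) powr \<rho> - c * (1 + d) powr \<rho>) / d"
    by (auto dest!: eventually_happens simp: dist_real_def trivial_limit_at_right_real abs_less_iff)
  have l1: "((\<lambda>i. (G i (1 - d) - G i (1 - 2 * d)) / d) \<longlongrightarrow> (c * (1 - d) powr \<rho> - c * (1 - 2 * d) powr \<rho>) / d) F"
    using d by (intro tendsto_intros lim) auto
  have l2: "((\<lambda>i. (G i (1 + 2 * d) - G i (1 + d)) / d) \<longlongrightarrow> (c * (1 + 2 * d) powr \<rho> - c * (1 + d) powr \<rho>) / d) F"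
    using d by (intro tendsto_intros lim) auto
  have "\<forall>\<^sub>F i in F. dist (x i) 1 < d" using x d by (intro tendstoD)
  with order_tendstoD(2)[OF l1 d1] order_tendstoD(1)[OF l2 d2] ev
  show "\<forall>\<^sub>F i in F. dist (f i (x i)) (c * \<rho>) < e"
  proof eventually_elim
    case (elim i)
    have mono: "f i b \<le> f i a" if "0 < a" "a < b" for a b
    proof -
      have "f i b * (b - a) \<le> f i a * (b - a)" using elim(3) that by (meson order_trans)
      then show ?thesis using that by (simp add: mult_le_cancel_right)
    qed
    have xd: "1 - d < x i" "x i < 1 + d" using elim(4) by (auto simp: dist_real_def)
    have "f i (1 - d) * d \<le> G i (1 - d) - G i (1 - 2 * d)"
      using elim(3)[rule_format, of "1 - 2 * d" "1 - d"] d by (simp add: algebra_simps)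
    then have "f i (1 - d) \<le> (G i (1 - d) - G i (1 - 2 * d)) / d" using d by (simp add: pos_le_divide_eq)
    then have "f i (1 - d) < c * \<rho> + e" using elim(1) by linarith
    moreover have "f i (x i) \<le> f i (1 - d)" using xd d by (intro mono) auto
    moreover have "G i (1 + 2 * d) - G i (1 + d) \<le> f i (1 + d) * d"
      using elim(3)[rule_format, of "1 + d" "1 + 2 * d"] d by (simp add: algebra_simps)
    then have "(G i (1 + 2 * d) - G i (1 + d)) / d \<le> f i (1 + d)" using d by (simp add: pos_divide_le_eq)
    then have "c * \<rho> - e < f i (1 + d)" using elim(2) by linarith
    moreover have "f i (1 + d) \<le> f i (x i)" using xd d by (intro mono) auto
    ultimately show ?case unfolding dist_real_def by linarith
  qed
qed

lemma monotone_limit_moving: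
  fixes G :: "'i \<Rightarrow> real \<Rightarrow> real"
  assumes mono: "\<forall>\<^sub>F i in F. \<forall>a b. a \<le> b \<longrightarrow> G i a \<le> G i b"
    and lim: "\<And>a. a > 0 \<Longrightarrow> ((\<lambda>i. G i a) \<longlongrightarrow> g a) F" and g: "isCont g 1"
    and x: "(x \<longlongrightarrow> 1) F"
  shows "((\<lambda>i. G i (x i)) \<longlongrightarrow> g 1) F"
proof (rule tendstoI)
  fix e :: real assume e: "e > 0"
  then obtain d0 where d0: "d0 > 0" "\<And>y. \<bar>y - 1\<bar> < d0 \<Longrightarrow> \<bar>g y - g 1\<bar> < e / 2"
    using g unfolding continuous_at_eps_delta dist_real_def by (metis half_gt_zero)
  define d where "d = min (d0 / 2) (1 / 2)"
  have d: "0 < d" "d < 1" "d < d0" using d0(1) by (auto simp: d_def)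
  have e2: "0 < e / 2" using e by simp
  have 1: "\<forall>\<^sub>F i in F. dist (G i (1 + d)) (g (1 + d)) < e / 2" "\<forall>\<^sub>F i in F. dist (G i (1 - d)) (g (1 - d)) < e / 2"
    using tendstoD[OF lim e2, of "1 + d"] tendstoD[OF lim e2, of "1 - d"] d by auto
  have "\<forall>\<^sub>F i in F. dist (x i) 1 < d" using x d by (intro tendstoD)
  with 1 mono show "\<forall>\<^sub>F i in F. dist (G i (x i)) (g 1) < e"
  proof eventually_elim
    case (elim i)
    have "G i (1 - d) \<le> G i (x i)" "G i (x i) \<le> G i (1 + d)"
      using elim(3,4) by (auto simp: dist_real_def)
    moreover have "\<bar>g (1 + d) - g 1\<bar> < e / 2" "\<bar>g (1 - d) - g 1\<bar> < e / 2" using d0(2) d by auto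
    ultimately show ?case using elim(1,2) unfolding dist_real_def by linarith
  qed
qed

context subordinator begin

abbreviation "U x \<equiv> measure potential {..x}"
abbreviation "J h b \<equiv> measure (tail_measure h) {..b}"

lemma compose_inverse:
  fixes r :: "'i \<Rightarrow> real" and g :: "real \<Rightarrow> real"
  assumes "filterlim r (at_right 0) F" "(g \<longlongrightarrow> L) at_top"
  shows "((\<lambda>i. g (1 / r i)) \<longlongrightarrow> L) F"
proof -
  have "filterlim (\<lambda>i. inverse (r i)) at_top F"
    using filterlim_compose[OF filterlim_inverse_at_top_right assms(1)] .
  from filterlim_compose[OF assms(2) this] show ?thesis by (simp add: inverse_eq_divide)
qed

lemma eventually_compose_inverse:
  fixes r :: "'i \<Rightarrow> real"
  assumes "filterlim r (at_right 0) F" "eventually P at_top"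
  shows "\<forall>\<^sub>F i in F. P (1 / r i)"
proof -
  have "filterlim (\<lambda>i. inverse (r i)) at_top F"
    using filterlim_compose[OF filterlim_inverse_at_top_right assms(1)] .
  from eventually_compose_filterlim[OF assms(2) this] show ?thesis by (simp add: inverse_eq_divide)
qed

lemma filterlim_at_right_pos: "filterlim r (at_right (0::real)) F \<Longrightarrow> \<forall>\<^sub>F i in F. 0 < r i"
  by (auto simp: filterlim_at elim: eventually_mono)

lemma potential_limit:
  assumes rv: "\<And>c. c > 0 \<Longrightarrow> ((\<lambda>u. \<Phi> (c * u) / \<Phi> u) \<longlongrightarrow> c powr \<alpha>) at_top"
    and \<alpha>: "0 < \<alpha>" and r: "filterlim r (at_right 0) F" and a: "a > 0"
  shows "((\<lambda>i. \<Phi> (1 / r i) * U (r i * a)) \<longlongrightarrow> a powr \<alpha> / Gamma (1 + \<alpha>)) F"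
proof (rule karamata_tauberian[where f="\<lambda>_ u. 1 / \<Phi> u", OF _ _ \<alpha> a])
  show "\<forall>\<^sub>F i in F. has_laplace potential (\<lambda>u. 1 / \<Phi> u) \<and> 0 < r i \<and> 0 \<le> \<Phi> (1 / r i)"
    using filterlim_at_right_pos[OF r] by eventually_elim (use \<Phi>_nonneg potential_laplace in auto)
  fix k :: nat assume k: "0 < k"
  have "((\<lambda>u. inverse (\<Phi> (real k * u) / \<Phi> u)) \<longlongrightarrow> inverse (real k powr \<alpha>)) at_top"
    using k by (intro tendsto_inverse rv) auto
  from compose_inverse[OF r this]
  show "((\<lambda>i. \<Phi> (1 / r i) * (1 / \<Phi> (real k / r i))) \<longlongrightarrow> real k powr - \<alpha>) F"
    by (simp add: powr_minus)
qed

text \<open>The hypothesis on the step \<open>h\<close> makes \<open>1 - exp (- h \<Phi>)\<close> asymptotically equal to \<open>h \<Phi>\<close>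
  at all relevant arguments, so that the transform of the tail measure behaves like \<open>\<Phi> u / u\<close>.\<close>

lemma tail_measure_limit:
  assumes rv: "\<And>c. c > 0 \<Longrightarrow> ((\<lambda>u. \<Phi> (c * u) / \<Phi> u) \<longlongrightarrow> c powr \<alpha>) at_top"
    and \<alpha>: "\<alpha> < 1" and r: "filterlim r (at_right 0) F" and a: "a > 0"
    and h: "\<forall>\<^sub>F i in F. 0 < h i" "\<And>k::nat. 0 < k \<Longrightarrow> ((\<lambda>i. h i * \<Phi> (real k / r i)) \<longlongrightarrow> 0) F"
  shows "((\<lambda>i. 1 / (r i * \<Phi> (1 / r i)) * J (h i) (r i * a)) \<longlongrightarrow> a powr (1 - \<alpha>) / Gamma (1 + (1 - \<alpha>))) F"
proof (rule karamata_tauberian[where f="\<lambda>i u. (1 - exp (- \<Phi> u * h i)) / (h i * u)", OF _ _ _ a])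
  have rpos: "\<forall>\<^sub>F i in F. 0 < r i" by (rule filterlim_at_right_pos[OF r])
  show "\<forall>\<^sub>F i in F. has_laplace (tail_measure (h i)) (\<lambda>u. (1 - exp (- \<Phi> u * h i)) / (h i * u)) \<and>
      0 < r i \<and> 0 \<le> 1 / (r i * \<Phi> (1 / r i))"
    using rpos h(1) by eventually_elim (use \<Phi>_nonneg tail_measure_laplace in auto)
  show "0 < 1 - \<alpha>" using \<alpha> by simp
  fix k :: nat assume k: "0 < k"
  have y: "\<forall>\<^sub>F i in F. 0 < h i * \<Phi> (real k / r i)"
    using rpos h(1) by eventually_elim (use k \<Phi>_pos in auto)
  have "((\<lambda>y::real. (1 - exp (- y)) / y) \<longlongrightarrow> 1) (at_right 0)" by real_asymp
  moreover have "filterlim (\<lambda>i. h i * \<Phi> (real k / r i)) (at_right 0) F"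
    using h(2)[OF k] y by (auto simp: filterlim_at elim: eventually_mono)
  ultimately have 1: "((\<lambda>i. (1 - exp (- (h i * \<Phi> (real k / r i)))) / (h i * \<Phi> (real k / r i))) \<longlongrightarrow> 1) F"
    by (rule filterlim_compose)
  have "((\<lambda>i. \<Phi> (real k * (1 / r i)) / \<Phi> (1 / r i)) \<longlongrightarrow> real k powr \<alpha>) F"
    using k by (intro compose_inverse[OF r] rv) auto
  from tendsto_mult[OF 1 tendsto_divide[OF this tendsto_const[of "real k"]]]
  have "((\<lambda>i. (1 - exp (- (h i * \<Phi> (real k / r i)))) / (h i * \<Phi> (real k / r i)) *
      (\<Phi> (real k * (1 / r i)) / \<Phi> (1 / r i) / real k)) \<longlongrightarrow> 1 * (real k powr \<alpha> / real k)) F"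
    using k by simp
  moreover have "1 * (real k powr \<alpha> / real k) = real k powr - (1 - \<alpha>)"
    using k by (simp add: powr_diff)
  moreover have "\<forall>\<^sub>F i in F. (1 - exp (- (h i * \<Phi> (real k / r i)))) / (h i * \<Phi> (real k / r i)) *
      (\<Phi> (real k * (1 / r i)) / \<Phi> (1 / r i) / real k)
    = 1 / (r i * \<Phi> (1 / r i)) * ((1 - exp (- \<Phi> (real k / r i) * h i)) / (h i * (real k / r i)))"
    using rpos h(1)
  proof eventually_elim
    case (elim i)
    then have "\<Phi> (real k / r i) \<noteq> 0" "\<Phi> (1 / r i) \<noteq> 0"
      using k \<Phi>_pos[of "real k / r i"] \<Phi>_pos[of "1 / r i"] by auto
    then show ?case using elim k by (simp add: field_simps)
  qed
  ultimately show "((\<lambda>i. 1 / (r i * \<Phi> (1 / r i)) * ((1 - exp (- \<Phi> (real k / r i) * h i)) / (h i * (real k / r i))))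
      \<longlongrightarrow> real k powr - (1 - \<alpha>)) F"
    using Lim_transform_eventually by fastforce
qed

lemma tail_measure_limit_moving:
  assumes rv: "\<And>c. c > 0 \<Longrightarrow> ((\<lambda>u. \<Phi> (c * u) / \<Phi> u) \<longlongrightarrow> c powr \<alpha>) at_top"
    and \<alpha>: "\<alpha> < 1" and r: "filterlim r (at_right 0) F"
    and h: "\<forall>\<^sub>F i in F. 0 < h i" "\<And>k::nat. 0 < k \<Longrightarrow> ((\<lambda>i. h i * \<Phi> (real k / r i)) \<longlongrightarrow> 0) F"
    and x: "(x \<longlongrightarrow> 1) F"
  shows "((\<lambda>i. 1 / (r i * \<Phi> (1 / r i)) * J (h i) (r i * x i)) \<longlongrightarrow> 1 / Gamma (2 - \<alpha>)) F"
proof -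
  have G: "Gamma (1 + (1 - \<alpha>)) > 0" using \<alpha> by (intro Gamma_real_pos) simp
  have "((\<lambda>i. 1 / (r i * \<Phi> (1 / r i)) * J (h i) (r i * x i)) \<longlongrightarrow> 1 powr (1 - \<alpha>) / Gamma (1 + (1 - \<alpha>))) F"
  proof (rule monotone_limit_moving[where g="\<lambda>a. a powr (1 - \<alpha>) / Gamma (1 + (1 - \<alpha>))" and G="\<lambda>i a. 1 / (r i
      * \<Phi> (1 / r i)) * J (h i) (r i * a)"])
    show "\<forall>\<^sub>F i in F. \<forall>a b. a \<le> b \<longrightarrow> 1 / (r i * \<Phi> (1 / r i)) * J (h i) (r i * a)
        \<le> 1 / (r i * \<Phi> (1 / r i)) * J (h i) (r i * b)"
      using filterlim_at_right_pos[OF r] h(1)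
    proof eventually_elim
      case (elim i)
      then have "0 \<le> 1 / (r i * \<Phi> (1 / r i))" using \<Phi>_nonneg[of "1 / r i"] by simp
      then show ?case
        using elim by (intro allI impI mult_left_mono has_laplace_mono[OF tail_measure_laplace]) auto
    qed
    show "isCont (\<lambda>a. a powr (1 - \<alpha>) / Gamma (1 + (1 - \<alpha>))) 1" using G by (intro continuous_intros) auto
  qed (use x tail_measure_limit[OF rv \<alpha> r _ h] in auto)
  then show ?thesis by (simp add: algebra_simps)
qed

lemma tail_limit:
  assumes rv: "\<And>c. c > 0 \<Longrightarrow> ((\<lambda>u. \<Phi> (c * u) / \<Phi> u) \<longlongrightarrow> c powr \<alpha>) at_top"
    and \<alpha>: "\<alpha> < 1" and r: "filterlim r (at_right 0) F"
    and h: "\<forall>\<^sub>F i in F. 0 < h i" "\<And>k::nat. 0 < k \<Longrightarrow> ((\<lambda>i. h i * \<Phi> (real k / r i)) \<longlongrightarrow> 0) F"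
    and x: "(x \<longlongrightarrow> 1) F"
  shows "((\<lambda>i. tail (h i) (r i * x i) / h i / \<Phi> (1 / r i)) \<longlongrightarrow> 1 / Gamma (1 - \<alpha>)) F"
proof -
  have "((\<lambda>i. tail (h i) (r i * x i) / h i / \<Phi> (1 / r i)) \<longlongrightarrow> 1 / Gamma (1 + (1 - \<alpha>)) * (1 - \<alpha>)) F"
  proof (rule monotone_density_limit[where f="\<lambda>i a. tail (h i) (r i * a) / h i / \<Phi> (1 / r i)"
      and G="\<lambda>i a. 1 / (r i * \<Phi> (1 / r i)) * J (h i) (r i * a)"])
    show "\<forall>\<^sub>F i in F. \<forall>a b. 0 < a \<longrightarrow> a < b \<longrightarrow>
      tail (h i) (r i * b) / h i / \<Phi> (1 / r i) * (b - a) \<le> 1 / (r i * \<Phi> (1 / r i)) * J (h i) (r i * b) - 1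
          / (r i * \<Phi> (1 / r i)) * J (h i) (r i * a) \<and>
      1 / (r i * \<Phi> (1 / r i)) * J (h i) (r i * b) - 1 / (r i * \<Phi> (1 / r i)) * J (h i) (r i * a)
          \<le> tail (h i) (r i * a) / h i / \<Phi> (1 / r i) * (b - a)"
      using filterlim_at_right_pos[OF r] h(1)
    proof (eventually_elim, intro allI impI)
      fix i a b assume i: "0 < r i" "0 < h i" and ab: "0 < a" "(a::real) < b"
      have P: "0 < \<Phi> (1 / r i)" using i by (intro \<Phi>_pos) simp
      have *: "(r i * b - r i * a) * (tail (h i) (r i * b) / h i) \<le> J (h i) (r i * b) - J (h i) (r i * a)"
        "J (h i) (r i * b) - J (h i) (r i * a) \<le> (r i * b - r i * a) * (tail (h i) (r i * a) / h i)"
        using tail_measure_increment[OF i(2), of "r i * a" "r i * b"] i ab by auto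
      have c: "0 \<le> 1 / (r i * \<Phi> (1 / r i))" using i P by simp
      have eq: "1 / (r i * \<Phi> (1 / r i)) * ((r i * b - r i * a) * (y / h i)) = y / h i / \<Phi> (1 / r i) * (b - a)" for y
        using i P by (simp add: field_simps)
      show "tail (h i) (r i * b) / h i / \<Phi> (1 / r i) * (b - a)
          \<le> 1 / (r i * \<Phi> (1 / r i)) * J (h i) (r i * b) - 1 / (r i * \<Phi> (1 / r i)) * J (h i) (r i * a) \<and>
        1 / (r i * \<Phi> (1 / r i)) * J (h i) (r i * b) - 1 / (r i * \<Phi> (1 / r i)) * J (h i) (r i * a)
            \<le> tail (h i) (r i * a) / h i / \<Phi> (1 / r i) * (b - a)"
        using mult_left_mono[OF *(1) c] mult_left_mono[OF *(2) c]
        unfolding eq right_diff_distrib[of "1 / (r i * \<Phi> (1 / r i))" "J (h i) (r i * b)" "J (h i) (r i * a)"]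
            by (rule conjI)
    qed
    show "((\<lambda>i. 1 / (r i * \<Phi> (1 / r i)) * J (h i) (r i * a))
        \<longlongrightarrow> 1 / Gamma (1 + (1 - \<alpha>)) * a powr (1 - \<alpha>)) F" if "a > 0" for a
      using tail_measure_limit[OF rv \<alpha> r that h] by simp
  qed (rule x)
  moreover have "Gamma (1 + (1 - \<alpha>)) = (1 - \<alpha>) * Gamma (1 - \<alpha>)"
    using Gamma_plus1[of "1 - \<alpha>"] \<alpha> by (simp add: add.commute nonpos_Ints_def)
  ultimately show ?thesis using \<alpha> by simp
qed

lemma potential_density_limit:
  assumes rv: "\<And>c. c > 0 \<Longrightarrow> ((\<lambda>u. \<Phi> (c * u) / \<Phi> u) \<longlongrightarrow> c powr \<alpha>) at_top"
    and \<alpha>: "0 < \<alpha>" and r: "filterlim r (at_right 0) F"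
    and v: "\<And>p q. 0 < p \<Longrightarrow> p < q \<Longrightarrow> v q * (q - p) \<le> U q - U p \<and> U q - U p \<le> v p * (q - p)"
    and x: "(x \<longlongrightarrow> 1) F"
  shows "((\<lambda>i. v (r i * x i) * (r i * \<Phi> (1 / r i))) \<longlongrightarrow> 1 / Gamma \<alpha>) F"
proof -
  have "((\<lambda>i. v (r i * x i) * (r i * \<Phi> (1 / r i))) \<longlongrightarrow> 1 / Gamma (1 + \<alpha>) * \<alpha>) F"
  proof (rule monotone_density_limit[where f="\<lambda>i a. v (r i * a) * (r i * \<Phi> (1 / r i))"
      and G="\<lambda>i a. \<Phi> (1 / r i) * U (r i * a)"])
    show "\<forall>\<^sub>F i in F. \<forall>a b. 0 < a \<longrightarrow> a < b \<longrightarrow>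
      v (r i * b) * (r i * \<Phi> (1 / r i)) * (b - a) \<le> \<Phi> (1 / r i) * U (r i * b) - \<Phi> (1 / r i) * U (r i * a) \<and>
      \<Phi> (1 / r i) * U (r i * b) - \<Phi> (1 / r i) * U (r i * a) \<le> v (r i * a) * (r i * \<Phi> (1 / r i)) * (b - a)"
      using filterlim_at_right_pos[OF r]
    proof (eventually_elim, intro allI impI)
      fix i a b assume i: "0 < r i" and ab: "0 < a" "(a::real) < b"
      have P: "0 \<le> \<Phi> (1 / r i)" using i by (intro \<Phi>_nonneg) simp
      have *: "v (r i * b) * (r i * b - r i * a) \<le> U (r i * b) - U (r i * a)"
        "U (r i * b) - U (r i * a) \<le> v (r i * a) * (r i * b - r i * a)"
        using v[of "r i * a" "r i * b"] i ab by auto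
      have eq: "\<Phi> (1 / r i) * (y * (r i * b - r i * a)) = y * (r i * \<Phi> (1 / r i)) * (b - a)" for y
        by (simp add: algebra_simps)
      show "v (r i * b) * (r i * \<Phi> (1 / r i)) * (b - a) \<le> \<Phi> (1 / r i) * U (r i * b) - \<Phi> (1 / r i) * U (r i * a) \<and>
        \<Phi> (1 / r i) * U (r i * b) - \<Phi> (1 / r i) * U (r i * a) \<le> v (r i * a) * (r i * \<Phi> (1 / r i)) * (b - a)"
        using mult_left_mono[OF *(1) P] mult_left_mono[OF *(2) P]
        unfolding eq right_diff_distrib[of "\<Phi> (1 / r i)" "U (r i * b)" "U (r i * a)"] by (rule conjI)
    qed
    show "((\<lambda>i. \<Phi> (1 / r i) * U (r i * a)) \<longlongrightarrow> 1 / Gamma (1 + \<alpha>) * a powr \<alpha>) F" if "a > 0" for a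
      using potential_limit[OF rv \<alpha> r that] by simp
  qed (rule x)
  moreover have "Gamma (1 + \<alpha>) = \<alpha> * Gamma \<alpha>"
    using Gamma_plus1[of "\<alpha>"] \<alpha> by (simp add: add.commute nonpos_Ints_def)
  ultimately show ?thesis using \<alpha> by simp
qed

end

section \<open>Two-sided bounds and the choice of the time step\<close>

context subordinator begin

text \<open>A convenient lower bound for the constant of \<open>has_laplace_measure_ge\<close>.\<close>

lemma two_sided_const: "1 / 12 \<le> 1/4 - exp (-2 :: real) / 2"
  using exp_ge_add_one_self[of 2] by (simp add: exp_minus field_simps)

lemma potential_two_sided:
  assumes "0 < r"
  shows "1 / 12 / \<Phi> (1 / r) \<le> U r" "U r \<le> 3 / \<Phi> (1 / r)"
proof -
  have P: "0 < \<Phi> (1 / r)" using assms by (intro \<Phi>_pos) simp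
  have "1 / \<Phi> u \<le> 2 * (1 / \<Phi> (2 * u))" if "0 < u" for u
    using \<Phi>_double[OF that] \<Phi>_pos[OF that] \<Phi>_pos[of "2 * u"] that by (simp add: field_simps)
  from has_laplace_measure_ge[OF potential_laplace assms this]
  have "(1/4 - exp (-2) / 2) * (1 / \<Phi> (1 / r)) \<le> U r" by simp
  moreover have "1 / 12 * (1 / \<Phi> (1 / r)) \<le> (1/4 - exp (-2) / 2) * (1 / \<Phi> (1 / r))"
    using two_sided_const P by (intro mult_right_mono) auto
  ultimately show "1 / 12 / \<Phi> (1 / r) \<le> U r" by simp
  have "U r \<le> exp (1 / r * r) * (1 / \<Phi> (1 / r))"
    using assms by (intro has_laplace_measure_le[OF potential_laplace]) simp
  also have "\<dots> \<le> 3 * (1 / \<Phi> (1 / r))" using assms exp_le P by (intro mult_right_mono) auto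
  finally show "U r \<le> 3 / \<Phi> (1 / r)" by simp
qed

lemma tail_measure_upper:
  assumes "0 < h" "0 < b"
  shows "J h b \<le> 3 * (b * \<Phi> (1 / b))"
proof -
  have P: "0 < \<Phi> (1 / b)" using assms by (intro \<Phi>_pos) simp
  have "J h b \<le> exp (1 / b * b) * ((1 - exp (- \<Phi> (1 / b) * h)) / (h * (1 / b)))"
    using assms by (intro has_laplace_measure_le[OF tail_measure_laplace]) auto
  also have "\<dots> \<le> 3 * (\<Phi> (1 / b) * h / (h * (1 / b)))"
    using assms exp_le P exp_ge_add_one_self[of "- \<Phi> (1 / b) * h"]
    by (intro mult_mono divide_right_mono) auto
  finally show ?thesis using assms by (simp add: mult_ac)
qed

lemma tail_measure_lower:
  assumes h: "0 < h" and b: "0 < b" and small: "h * \<Phi> (1 / b) \<le> 1"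
  shows "b * \<Phi> (1 / b) / 24 \<le> J h b"
proof -
  have P: "0 < \<Phi> (1 / b)" using b by (intro \<Phi>_pos) simp
  have dbl: "(1 - exp (- \<Phi> u * h)) / (h * u) \<le> 2 * ((1 - exp (- \<Phi> (2 * u) * h)) / (h * (2 * u)))" if "0 < u" for u
  proof -
    have "(1 - exp (- \<Phi> u * h)) / (h * u) \<le> (1 - exp (- \<Phi> (2 * u) * h)) / (h * u)"
      using \<Phi>_mono[of u "2 * u"] that h by (intro divide_right_mono) auto
    also have "\<dots> = 2 * ((1 - exp (- \<Phi> (2 * u) * h)) / (h * (2 * u)))"
      by (simp add: mult.left_commute[of h 2] del: right_diff_distrib_numeral)
    finally show ?thesis .
  qed
  let ?y = "\<Phi> (1 / b) * h"
  have y: "0 < ?y" "?y \<le> 1" using P h small by (auto simp: mult.commute)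
  have "?y / 2 \<le> 1 - exp (- ?y)"
  proof -
    have "exp (- ?y) \<le> 1 / (1 + ?y)"
      using exp_ge_add_one_self[of ?y] y(1) by (simp add: exp_minus inverse_eq_divide divide_left_mono)
    also have "\<dots> \<le> 1 - ?y / 2"
    proof -
      have "?y * ?y \<le> ?y * 1" using y by (intro mult_left_mono) auto
      then have "1 \<le> (1 - ?y / 2) * (1 + ?y)" by (simp add: algebra_simps)
      then show ?thesis using y(1) by (simp add: pos_divide_le_eq)
    qed
    finally show ?thesis by simp
  qed
  then have "?y / 2 / (h * (1 / b)) \<le> (1 - exp (- ?y)) / (h * (1 / b))"
    using h b by (intro divide_right_mono) auto
  moreover have "?y / 2 / (h * (1 / b)) = b * \<Phi> (1 / b) / 2" using h b by simp
  ultimately have le: "b * \<Phi> (1 / b) / 2 \<le> (1 - exp (- \<Phi> (1 / b) * h)) / (h * (1 / b))"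
    by (simp only: mult_minus_left)
  have "0 \<le> 1/4 - exp (-2 :: real) / 2" using two_sided_const by linarith
  moreover have "0 \<le> b * \<Phi> (1 / b) / 2" using P b by simp
  ultimately have "1 / 12 * (b * \<Phi> (1 / b) / 2) \<le> (1/4 - exp (-2) / 2) * ((1 - exp (- \<Phi> (1 / b) * h)) / (h * (1
      / b)))"
    by (intro mult_mono two_sided_const le)
  also have "\<dots> \<le> J h b"
    by (rule has_laplace_measure_ge[OF tail_measure_laplace[OF h] b dbl])
  finally show ?thesis by simp
qed

lemma tail_upper:
  assumes h: "0 < h" and z: "0 < z"
  shows "tail h z / h \<le> 3 * \<Phi> (1 / z)"
proof -
  have "(z - 0) * (tail h z / h) \<le> J h z - J h 0" by (rule tail_measure_increment(1)) (use h z in auto)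
  also have "\<dots> \<le> 3 * (z * \<Phi> (1 / z))" using tail_measure_upper[OF h z] by (simp add: order_trans[rotated])
  finally have "z * (tail h z / h) \<le> z * (3 * \<Phi> (1 / z))" by simp
  then show ?thesis using z by (subst (asm) mult_le_cancel_left_pos)
qed

text \<open>If the tail measure of \<open>[0, K z]\<close> exceeds twice that of \<open>[0, z]\<close>, the monotone tail cannot be small at
  \<open>z\<close>.  The constant \<open>144\<close> makes the lower bound at \<open>K z\<close> twice the upper bound at \<open>z\<close>.\<close>

lemma tail_lower:
  assumes h: "0 < h" and z: "0 < z" and K: "1 < K" and small: "h * \<Phi> (1 / (K * z)) \<le> 1"
    and grow: "144 * \<Phi> (1 / z) \<le> K * \<Phi> (1 / (K * z))"
  shows "3 * \<Phi> (1 / z) / (K - 1) \<le> tail h z / h"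
proof -
  have "z * (144 * \<Phi> (1 / z)) \<le> z * (K * \<Phi> (1 / (K * z)))" using grow z by (intro mult_left_mono) auto
  then have "6 * (z * \<Phi> (1 / z)) \<le> K * z * \<Phi> (1 / (K * z)) / 24" by (simp add: mult_ac)
  also have "\<dots> \<le> J h (K * z)" using K z by (intro tail_measure_lower[OF h _ small]) simp
  finally have "3 * (z * \<Phi> (1 / z)) \<le> J h (K * z) - J h z" using tail_measure_upper[OF h z] by linarith
  also have "\<dots> \<le> (K * z - z) * (tail h z / h)"
    by (rule tail_measure_increment(2)) (use h z K in auto)
  finally have "z * (3 * \<Phi> (1 / z)) \<le> z * ((K - 1) * (tail h z / h))" by (simp add: algebra_simps)
  then have "3 * \<Phi> (1 / z) \<le> (K - 1) * (tail h z / h)" using z by (subst (asm) mult_le_cancel_left_pos)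
  then show ?thesis using K by (simp add: pos_divide_le_eq mult.commute)
qed

lemma density_upper:
  assumes z: "0 < z"
    and v: "\<And>p q. 0 < p \<Longrightarrow> p < q \<Longrightarrow> v q * (q - p) \<le> U q - U p \<and> U q - U p \<le> v p * (q - p)"
  shows "v z \<le> 6 / (z * \<Phi> (1 / z))"
proof -
  have P: "0 < \<Phi> (1 / z)" using z by (intro \<Phi>_pos) simp
  have "v z * (z - z / 2) \<le> U z - U (z / 2)" using v[of "z / 2" z] z by simp
  also have "\<dots> \<le> 3 / \<Phi> (1 / z)" using potential_two_sided(2)[OF z] by (simp add: order_trans[rotated])
  finally show ?thesis using z P by (simp add: field_simps)
qed

lemma density_lower:
  assumes z: "0 < z" and K: "1 < K" and grow: "72 * \<Phi> (1 / (K * z)) \<le> \<Phi> (1 / z)"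
    and v: "\<And>p q. 0 < p \<Longrightarrow> p < q \<Longrightarrow> v q * (q - p) \<le> U q - U p \<and> U q - U p \<le> v p * (q - p)"
  shows "3 / ((K - 1) * (z * \<Phi> (1 / z))) \<le> v z"
proof -
  have P: "0 < \<Phi> (1 / z)" "0 < \<Phi> (1 / (K * z))" using z K by (auto intro!: \<Phi>_pos)
  have "6 / \<Phi> (1 / z) \<le> 1 / 12 / \<Phi> (1 / (K * z))" using grow P by (simp add: field_simps)
  also have "\<dots> \<le> U (K * z)" using z K by (intro potential_two_sided) simp
  finally have "3 / \<Phi> (1 / z) \<le> U (K * z) - U z" using potential_two_sided(2)[OF z] by linarith
  also have "\<dots> \<le> v z * (K * z - z)" using v[of z "K * z"] z K by simp
  finally have "3 / \<Phi> (1 / z) \<le> v z * ((K - 1) * z)" by (simp add: algebra_simps)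
  moreover have "0 < (K - 1) * z" using z K by simp
  ultimately have "3 / \<Phi> (1 / z) / ((K - 1) * z) \<le> v z" by (simp only: pos_divide_le_eq)
  then show ?thesis by (simp add: mult_ac)
qed

text \<open>The step can be taken so small that \<open>h * B\<close> is small for a prescribed \<open>B\<close>; the value of \<open>B\<close> used below
  is \<open>\<Phi>\<close> at a very large argument.\<close>

lemma rate_approx:
  assumes t: "0 < t" and x: "0 \<le> x" "x \<le> t" and e: "0 < e" "0 < e'"
  shows "\<exists>h>0. h * B \<le> e \<and> \<bar>rate x t h - prob_le t x\<bar> \<le> e'"
proof -
  have "(\<lambda>n. 1 / real (Suc n) * B) \<longlonglongrightarrow> 0" by real_asymp
  then have "\<forall>\<^sub>F n in sequentially. 1 / real (Suc n) * B < e" using e by (intro order_tendstoD)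
  moreover have "\<forall>\<^sub>F n in sequentially. dist (rate x t (1 / Suc n)) (prob_le t x) < e'"
    by (rule tendstoD[OF rate_limit[OF t x] e(2)])
  ultimately have "\<forall>\<^sub>F n in sequentially. 1 / real (Suc n) * B \<le> e \<and>
     \<bar>rate x t (1 / Suc n) - prob_le t x\<bar> \<le> e'"
    by eventually_elim (auto simp: dist_real_def)
  then obtain n where "1 / real (Suc n) * B \<le> e \<and>
     \<bar>rate x t (1 / Suc n) - prob_le t x\<bar> \<le> e'"
    using eventually_happens'[OF sequentially_bot] by blast
  then show ?thesis by (intro exI[of _ "1 / real (Suc n)"]) auto
qed

lemma AE_undershoot_le:
  assumes t: "0 < t" shows "AE \<omega> in M. undershoot \<tau> t \<omega> \<le> ennreal t"
  using AE_passage_time_finite[OF t] increasing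
proof eventually_elim
  case (elim \<omega>)
  then obtain l where l: "passage_time \<tau> t \<omega> = ereal l" "0 < l" by blast
  show ?case using undershoot_le_iff[OF l elim(2), of "ennreal t"] below_passage_time[of _ \<tau> t \<omega>] l by simp
qed

text \<open>The event \<open>a \<le> undershoot\<close> includes its boundary, while differences of rates describe
  \<open>x < undershoot\<close>; hence the level \<open>x\<close> is chosen slightly below \<open>a\<close>.\<close>

lemma rate_increment_approx:
  assumes a: "0 < a" "a < t" and d: "0 < d" and e: "0 < e" "0 < e'"
  shows "\<exists>x h. 0 < x \<and> x < a \<and> a - d \<le> x \<and> 0 < h \<and> h * B \<le> e \<and>
    \<bar>rate t t h - rate x t h - prob_ge t a\<bar> \<le> e'"
proof -
  have t: "0 < t" using a by simp
  \<comment> \<open>Offset \<open>2\<close> keeps \<open>x n\<close> positive and above \<open>a - d\<close> already for \<open>n = 0\<close>.\<close>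
  define x where "x = (\<lambda>n. a - min d a / (real n + 2))"
  have x0: "0 < min d a" using a d by simp
  have xx: "0 < x n" "x n < a" "a - d \<le> x n" for n
  proof -
    have "min d a / (real n + 2) \<le> min d a / 2" using x0 by (intro divide_left_mono) auto
    moreover have "0 < min d a / (real n + 2)" using x0 by simp
    moreover have "min d a \<le> d" "min d a \<le> a" by auto
    ultimately show "0 < x n" "x n < a" "a - d \<le> x n" using x0 unfolding x_def by linarith+
  qed
  have "decseq (\<lambda>n. {\<omega>\<in>space M. ennreal (x n) < undershoot \<tau> t \<omega>})"
  proof (rule decseq_SucI, safe)
    fix n \<omega> assume "ennreal (x (Suc n)) < undershoot \<tau> t \<omega>"
    moreover have "x n \<le> x (Suc n)" using x0 by (auto simp: x_def intro!: divide_left_mono)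
    ultimately show "ennreal (x n) < undershoot \<tau> t \<omega>" by (meson ennreal_leI order_le_less_trans)
  qed
  then have "(\<lambda>n. prob {\<omega>\<in>space M. ennreal (x n) < undershoot \<tau> t \<omega>})
      \<longlonglongrightarrow> prob (\<Inter>n. {\<omega>\<in>space M. ennreal (x n) < undershoot \<tau> t \<omega>})"
    by (intro finite_Lim_measure_decseq) auto
  also have "(\<Inter>n. {\<omega>\<in>space M. ennreal (x n) < undershoot \<tau> t \<omega>}) = {\<omega>\<in>space M. ennreal a \<le> undershoot \<tau> t \<omega>}"
  proof (intro equalityI subsetI)
    fix \<omega> assume "\<omega> \<in> (\<Inter>n. {\<omega>\<in>space M. ennreal (x n) < undershoot \<tau> t \<omega>})"
    then have \<omega>: "\<omega> \<in> space M" "\<And>n. ennreal (x n) < undershoot \<tau> t \<omega>" by auto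
    have "x \<longlonglongrightarrow> a" unfolding x_def by real_asymp
    then have "(\<lambda>n. ennreal (x n)) \<longlonglongrightarrow> ennreal a" by (rule tendsto_ennrealI)
    then have "ennreal a \<le> undershoot \<tau> t \<omega>" by (rule LIMSEQ_le_const2) (use \<omega> in \<open>auto intro: less_imp_le\<close>)
    then show "\<omega> \<in> {\<omega>\<in>space M. ennreal a \<le> undershoot \<tau> t \<omega>}" using \<omega> by simp
  next
    fix \<omega> assume \<omega>: "\<omega> \<in> {\<omega>\<in>space M. ennreal a \<le> undershoot \<tau> t \<omega>}"
    have "ennreal (x n) < ennreal a" for n using xx[of n] by (simp add: ennreal_less_iff)
    then show "\<omega> \<in> (\<Inter>n. {\<omega>\<in>space M. ennreal (x n) < undershoot \<tau> t \<omega>})"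
      using \<omega> by (auto intro: less_le_trans)
  qed
  finally have "\<forall>\<^sub>F n in sequentially. dist (prob {\<omega>\<in>space M. ennreal (x n) < undershoot \<tau> t \<omega>}) (prob_ge t a) < e' / 2"
    using e by (intro tendstoD) auto
  then obtain n where n: "\<bar>prob {\<omega>\<in>space M. ennreal (x n) < undershoot \<tau> t \<omega>} - prob_ge t a\<bar> < e' / 2"
    using eventually_happens'[OF sequentially_bot] unfolding dist_real_def by blast
  have full: "prob_le t t = 1"
    using AE_undershoot_le[OF t] by (subst prob_Collect_eq_1) auto
  have "prob {\<omega>\<in>space M. ennreal (x n) < undershoot \<tau> t \<omega>} = prob (space M - {\<omega>\<in>space M. undershoot \<tau> t \<omega>
      \<le> ennreal (x n)})"
    by (intro arg_cong[where f=prob]) auto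
  also have "\<dots> = 1 - prob_le t (x n)" by (intro prob_compl) auto
  finally have compl: "prob {\<omega>\<in>space M. ennreal (x n) < undershoot \<tau> t \<omega>} = 1 - prob_le t (x n)" .
  have e4: "0 < e' / 4" using e by simp
  have "(\<lambda>m. 1 / real (Suc m) * B) \<longlonglongrightarrow> 0" by real_asymp
  then have "\<forall>\<^sub>F m in sequentially. 1 / real (Suc m) * B < e" using e by (intro order_tendstoD)
  moreover have "\<forall>\<^sub>F m in sequentially. dist (rate t t (1 / Suc m)) 1 < e' / 4"
    using tendstoD[OF rate_limit[OF t, of t] e4] t full by simp
  moreover have "\<forall>\<^sub>F m in sequentially. dist (rate (x n) t (1 / Suc m)) (prob_le t (x n)) < e' / 4"
    using xx[of n] a by (intro tendstoD[OF rate_limit[OF t] e4]) auto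
  ultimately have "\<forall>\<^sub>F m in sequentially. 1 / real (Suc m) * B \<le> e \<and>
     \<bar>rate t t (1 / Suc m) - rate (x n) t (1 / Suc m) - prob_ge t a\<bar> \<le> e'"
  proof eventually_elim
    case (elim m)
    have "\<bar>rate t t (1 / Suc m) - rate (x n) t (1 / Suc m) - prob_ge t a\<bar> \<le> e'"
      using n elim(2,3) unfolding compl dist_real_def by linarith
    then show ?case using elim(1) by simp
  qed
  then obtain m where "1 / real (Suc m) * B \<le> e \<and>
     \<bar>rate t t (1 / Suc m) - rate (x n) t (1 / Suc m) - prob_ge t a\<bar> \<le> e'"
    using eventually_happens'[OF sequentially_bot] by blast
  then show ?thesis using xx[of n] by (intro exI[of _ "x n"] exI[of _ "1 / real (Suc m)"]) auto
qed

end

lemma perturbed_limit: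
  fixes P R g :: "real \<Rightarrow> real"
  assumes close: "\<forall>\<^sub>F t in at_right 0. 0 < g t \<and> \<bar>R t - P t\<bar> \<le> t * g t"
    and lim: "((\<lambda>t. R t / g t) \<longlongrightarrow> L) (at_right 0)"
  shows "((\<lambda>t. P t / g t) \<longlongrightarrow> L) (at_right 0)"
proof -
  have "((\<lambda>t. R t / g t - P t / g t) \<longlongrightarrow> 0) (at_right 0)"
  proof (rule Lim_null_comparison)
    show "\<forall>\<^sub>F t in at_right 0. norm (R t / g t - P t / g t) \<le> t"
      using close by eventually_elim (simp add: diff_divide_distrib[symmetric] pos_divide_le_eq)
    show "((\<lambda>t::real. t) \<longlongrightarrow> 0) (at_right 0)" by real_asymp
  qed
  from tendsto_diff[OF lim this] show ?thesis by simp
qed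

lemma perturbed_order:
  fixes P R g :: "real \<Rightarrow> real"
  assumes close: "\<forall>\<^sub>F t in at_right 0. 0 < g t \<and> \<bar>R t - P t\<bar> \<le> t * g t"
    and R: "\<forall>\<^sub>F t in at_right 0. m * g t \<le> R t \<and> R t \<le> n * g t" and m: "0 < m"
  shows "\<forall>\<^sub>F t in at_right 0. m / 2 * g t \<le> P t \<and> P t \<le> (n + m) * g t"
proof -
  have "\<forall>\<^sub>F t in at_right (0::real). t < m / 2" using m by real_asymp
  with close R show ?thesis
  proof eventually_elim
    case (elim t)
    have "t * g t \<le> m / 2 * g t" using elim by (intro mult_right_mono) auto
    moreover have "0 \<le> m / 2 * g t" using elim m by simp
    ultimately have "m * g t - m / 2 * g t \<le> P t" "P t \<le> n * g t + m * g t" using elim by linarith+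
    then show ?case by (simp add: algebra_simps)
  qed
qed

section \<open>The undershoot near the two ends of its range\<close>

context subordinator begin

text \<open>Since \<open>\<Phi>\<close> is increasing, smallness of the step at the single argument \<open>1 / (t * r t)\<close>
  gives smallness at all multiples \<open>k / r t\<close> once \<open>t \<le> 1 / k\<close>.\<close>

lemma small_step_limit:
  assumes r: "\<And>t. 0 < t \<Longrightarrow> 0 < r t"
    and h: "\<And>t. 0 < t \<Longrightarrow> 0 < h t \<and> h t * \<Phi> (1 / (t * r t)) \<le> t" and k: "0 < (k::nat)"
  shows "((\<lambda>t. h t * \<Phi> (real k / r t)) \<longlongrightarrow> 0) (at_right 0)"
proof (rule Lim_null_comparison)
  have "\<forall>\<^sub>F t in at_right 0. t \<le> 1 / real k" using k by real_asymp
  with eventually_at_right_less[of 0] show "\<forall>\<^sub>F t in at_right 0. norm (h t * \<Phi> (real k / r t)) \<le> t"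
  proof eventually_elim
    case (elim t)
    then have "real k / r t \<le> 1 / (t * r t)" using r[of t] k by (simp add: field_simps)
    then have "\<Phi> (real k / r t) \<le> \<Phi> (1 / (t * r t))" using r[OF elim(1)] k by (intro \<Phi>_mono) auto
    then have "h t * \<Phi> (real k / r t) \<le> h t * \<Phi> (1 / (t * r t))" using h[OF elim(1)] by (intro mult_left_mono) auto
    moreover have "0 \<le> h t * \<Phi> (real k / r t)"
      using h[OF elim(1)] \<Phi>_nonneg[of "real k / r t"] r[OF elim(1)] k by simp
    ultimately show ?case using h[OF elim(1)] by (simp only: real_norm_def abs_of_nonneg) linarith
  qed
  show "((\<lambda>t::real. t) \<longlongrightarrow> 0) (at_right 0)" by real_asymp
qed

lemma small_step_limit_coarse:
  assumes r: "\<And>t. 0 < t \<Longrightarrow> 0 < r t \<and> r t \<le> t"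
    and h: "\<And>t. 0 < t \<Longrightarrow> 0 < h t \<and> h t * \<Phi> (1 / (t * r t)) \<le> t" and k: "0 < (k::nat)"
  shows "((\<lambda>t. h t * \<Phi> (real k / t)) \<longlongrightarrow> 0) (at_right 0)"
proof (rule Lim_null_comparison)
  show "((\<lambda>t. h t * \<Phi> (real k / r t)) \<longlongrightarrow> 0) (at_right 0)"
    using r h k by (intro small_step_limit) auto
  show "\<forall>\<^sub>F t in at_right 0. norm (h t * \<Phi> (real k / t)) \<le> h t * \<Phi> (real k / r t)"
    using eventually_at_right_less[of 0]
  proof eventually_elim
    case (elim t)
    have "real k / t \<le> real k / r t" using r[OF elim] elim k by (intro divide_left_mono) auto
    then have "\<Phi> (real k / t) \<le> \<Phi> (real k / r t)" using elim k by (intro \<Phi>_mono) auto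
    moreover have "0 \<le> \<Phi> (real k / t)" using elim k by (intro \<Phi>_nonneg) simp
    ultimately show ?case using h[OF elim] by (simp add: mult_left_mono)
  qed
qed

end

text \<open>In the following, \<open>r t\<close> is the small length \<open>\<epsilon> t * t\<close>, and \<open>low\<close> and \<open>high\<close> are the orders of magnitude
  of the probabilities that the undershoot is at most \<open>r t\<close> and at least \<open>t - r t\<close>.\<close>

locale subordinator_undershoot = subordinator M \<tau> \<Phi>
  for M :: "'w measure" and \<tau> :: "real \<Rightarrow> 'w \<Rightarrow> ennreal" and \<Phi> :: "real \<Rightarrow> real" +
  fixes \<epsilon> :: "real \<Rightarrow> real" and \<alpha> :: real
  assumes \<epsilon>: "\<And>t. 0 < t \<Longrightarrow> 0 < \<epsilon> t \<and> \<epsilon> t < 1" and \<epsilon>_lim: "(\<epsilon> \<longlongrightarrow> 0) (at_right 0)"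
    and \<alpha>: "0 < \<alpha>" "\<alpha> < 1"
begin

definition "r t = \<epsilon> t * t"

definition "low t = \<Phi> (1 / t) / \<Phi> (1 / r t)"
definition "high t = \<epsilon> t * \<Phi> (1 / r t) / \<Phi> (1 / t)"

lemma r: "0 < t \<Longrightarrow> 0 < r t" "0 < t \<Longrightarrow> r t < t"
  using \<epsilon>[of t] by (auto simp: r_def)

lemma r_lim: "filterlim r (at_right 0) (at_right 0)"
proof -
  have "((\<lambda>t. \<epsilon> t * t) \<longlongrightarrow> 0 * 0) (at_right 0)" by (intro tendsto_mult \<epsilon>_lim) real_asymp
  then have "(r \<longlongrightarrow> 0) (at_right 0)" by (simp add: r_def[abs_def])
  moreover have "\<forall>\<^sub>F t in at_right 0. r t \<in> {0<..} \<and> r t \<noteq> 0"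
    using eventually_at_right_less[of 0]
  proof eventually_elim
    case (elim t)
    then show ?case using r(1)[of t] by simp
  qed
  ultimately show ?thesis by (simp add: filterlim_at)
qed

lemma id_lim: "filterlim (\<lambda>t::real. t) (at_right 0) (at_right 0)" by (rule filterlim_ident)

lemma pos: "0 < t \<Longrightarrow> 0 < \<Phi> (1 / t)" "0 < t \<Longrightarrow> 0 < \<Phi> (1 / r t)" "0 < t \<Longrightarrow> 0 < low t" "0 < t \<Longrightarrow> 0 < high t"
  using \<Phi>_pos[of "1 / t"] \<Phi>_pos[of "1 / r t"] r[of t] \<epsilon>[of t] by (auto simp: low_def high_def)

lemma high_eq: "0 < t \<Longrightarrow> high t = r t * \<Phi> (1 / r t) / (t * \<Phi> (1 / t))"
  using r[of t] by (simp add: high_def r_def)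

lemma low_step:
  obtains h where "\<And>t. 0 < t \<Longrightarrow> 0 < h t \<and> h t * \<Phi> (1 / (t * r t)) \<le> t"
    and "\<forall>\<^sub>F t in at_right 0. 0 < low t \<and>
      \<bar>rate (r t) t (h t) - prob_le t (r t)\<bar> \<le> t * low t"
proof -
  have "\<forall>t. \<exists>h. 0 < t \<longrightarrow> 0 < h \<and> h * \<Phi> (1 / (t * r t)) \<le> t \<and>
     \<bar>rate (r t) t h - prob_le t (r t)\<bar> \<le> t * low t"
  proof
    fix t show "\<exists>h. 0 < t \<longrightarrow> 0 < h \<and> h * \<Phi> (1 / (t * r t)) \<le> t \<and>
       \<bar>rate (r t) t h - prob_le t (r t)\<bar> \<le> t * low t"
    proof (cases "0 < t")
      case True
      then show ?thesis
        using rate_approx[of t "r t" t "t * low t" "\<Phi> (1 / (t * r t))"] r[of t] pos[of t] by auto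
    qed simp
  qed
  from choice[OF this] obtain h where h: "\<And>t. 0 < t \<Longrightarrow> 0 < h t \<and> h t * \<Phi> (1 / (t * r t)) \<le> t \<and>
     \<bar>rate (r t) t (h t) - prob_le t (r t)\<bar> \<le> t * low t" by blast
  show thesis
  proof (rule that)
    show "0 < h t \<and> h t * \<Phi> (1 / (t * r t)) \<le> t" if "0 < t" for t using h[OF that] by blast
    show "\<forall>\<^sub>F t in at_right 0. 0 < low t \<and>
      \<bar>rate (r t) t (h t) - prob_le t (r t)\<bar> \<le> t * low t"
      using eventually_at_right_less[of 0] by eventually_elim (use h pos in auto)
  qed
qed

lemma high_step:
  obtains x h where "\<And>t. 0 < t \<Longrightarrow> 0 < x t \<and> x t < t - r t \<and> t - r t - t * r t \<le> x t"
    and "\<And>t. 0 < t \<Longrightarrow> 0 < h t \<and> h t * \<Phi> (1 / (t * r t)) \<le> t"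
    and "\<forall>\<^sub>F t in at_right 0. 0 < high t \<and>
      \<bar>rate t t (h t) - rate (x t) t (h t) - prob_ge t (t - r t)\<bar> \<le> t * high t"
proof -
  have "\<forall>t. \<exists>y. 0 < t \<longrightarrow> (0 < fst y \<and> fst y < t - r t \<and> t - r t - t * r t \<le> fst y) \<and>
     (0 < snd y \<and> snd y * \<Phi> (1 / (t * r t)) \<le> t) \<and>
     \<bar>rate t t (snd y) - rate (fst y) t (snd y) - prob_ge t (t - r t)\<bar> \<le> t * high t"
  proof
    fix t show "\<exists>y. 0 < t \<longrightarrow> (0 < fst y \<and> fst y < t - r t \<and> t - r t - t * r t \<le> fst y) \<and>
     (0 < snd y \<and> snd y * \<Phi> (1 / (t * r t)) \<le> t) \<and>
     \<bar>rate t t (snd y) - rate (fst y) t (snd y) - prob_ge t (t - r t)\<bar> \<le> t * high t"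
    proof (cases "0 < t")
      case True
      then obtain x h where "0 < x" "x < t - r t" "t - r t - t * r t \<le> x" "0 < h" "h * \<Phi> (1 / (t * r t)) \<le> t"
        "\<bar>rate t t h - rate x t h - prob_ge t (t - r t)\<bar> \<le> t * high t"
        using rate_increment_approx[of "t - r t" t "t * r t" t "t * high t" "\<Phi> (1 / (t
            * r t))"] r[of t] pos[of t] by auto
      then show ?thesis by (intro exI[of _ "(x, h)"]) simp
    qed simp
  qed
  from choice[OF this] obtain y where y: "\<And>t. 0 < t \<Longrightarrow>
     (0 < fst (y t) \<and> fst (y t) < t - r t \<and> t - r t - t * r t \<le> fst (y t)) \<and>
     (0 < snd (y t) \<and> snd (y t) * \<Phi> (1 / (t * r t)) \<le> t) \<and>
     \<bar>rate t t (snd (y t)) - rate (fst (y t)) t (snd (y t)) - prob_ge t (t - r t)\<bar> \<le> t * high t"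
    by blast
  show thesis
  proof (rule that[of "\<lambda>t. fst (y t)" "\<lambda>t. snd (y t)"])
    show "0 < fst (y t) \<and> fst (y t) < t - r t \<and> t - r t - t * r t
        \<le> fst (y t)" if "0 < t" for t using y[OF that] by blast
    show "0 < snd (y t) \<and> snd (y t) * \<Phi> (1 / (t * r t)) \<le> t" if "0 < t" for t using y[OF that] by blast
    show "\<forall>\<^sub>F t in at_right 0. 0 < high t \<and>
      \<bar>rate t t (snd (y t)) - rate (fst (y t)) t (snd (y t)) - prob_ge t (t - r t)\<bar> \<le> t * high t"
      using eventually_at_right_less[of 0] by eventually_elim (use y pos in auto)
  qed
qed

lemma low_limit:
  assumes rv: "\<And>c. c > 0 \<Longrightarrow> ((\<lambda>u. \<Phi> (c * u) / \<Phi> u) \<longlongrightarrow> c powr \<alpha>) at_top"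
  shows "((\<lambda>t. prob_le t (r t) / low t) \<longlongrightarrow> 1 / (Gamma (1 + \<alpha>) * Gamma (1 - \<alpha>))) (at_right 0)"
proof -
  obtain h where h: "\<And>t. 0 < t \<Longrightarrow> 0 < h t \<and> h t * \<Phi> (1 / (t * r t)) \<le> t"
    and close: "\<forall>\<^sub>F t in at_right 0. 0 < low t \<and>
      \<bar>rate (r t) t (h t) - prob_le t (r t)\<bar> \<le> t * low t"
    using low_step by blast
  have hpos: "\<forall>\<^sub>F t in at_right 0. 0 < h t" using eventually_at_right_less[of 0] by eventually_elim (use h in auto)
  have hk: "((\<lambda>t. h t * \<Phi> (real k / t)) \<longlongrightarrow> 0) (at_right 0)" if "0 < k" for k :: nat
    using small_step_limit_coarse[OF _ h that] r by (simp add: less_imp_le)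
  have potential: "((\<lambda>t. \<Phi> (1 / r t) * U (r t)) \<longlongrightarrow> 1 / Gamma (1 + \<alpha>)) (at_right 0)"
    using potential_limit[OF rv \<alpha>(1) r_lim, of 1] by simp
  have tail: "((\<lambda>t. tail (h t) (t * x t) / h t / \<Phi> (1 / t)) \<longlongrightarrow> 1 / Gamma (1 - \<alpha>)) (at_right 0)"
    if "(x \<longlongrightarrow> 1) (at_right 0)" for x
    by (rule tail_limit[OF rv \<alpha>(2) id_lim hpos hk that])
  have "((\<lambda>t. 1 - \<epsilon> t) \<longlongrightarrow> 1 - 0) (at_right 0)" by (intro tendsto_intros \<epsilon>_lim)
  from tendsto_mult[OF potential tail[OF tendsto_const]] tendsto_mult[OF potential tail[OF this[simplified]]]
  have lo: "((\<lambda>t. \<Phi> (1 / r t) * U (r t) * (tail (h t) (t * 1) / h t / \<Phi> (1 / t)))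
      \<longlongrightarrow> 1 / (Gamma (1 + \<alpha>) * Gamma (1 - \<alpha>))) (at_right 0)"
    and hi: "((\<lambda>t. \<Phi> (1 / r t) * U (r t) * (tail (h t) (t * (1 - \<epsilon> t)) / h t / \<Phi> (1 / t)))
        \<longlongrightarrow> 1 / (Gamma (1 + \<alpha>) * Gamma (1 - \<alpha>))) (at_right 0)"
    by simp_all
  have "((\<lambda>t. rate (r t) t (h t) / low t) \<longlongrightarrow> 1 / (Gamma (1 + \<alpha>) * Gamma (1 - \<alpha>))) (at_right 0)"
  proof (rule tendsto_sandwich[OF _ _ lo hi])
    have b: "U (r t) * (tail (h t) t / h t) \<le> rate (r t) t (h t)" "rate (r t) t (h t)
        \<le> U (r t) * (tail (h t) (t - r t) / h t)"
      if "0 < t" for t using rate_bounds[of t "r t" "h t"] r[OF that] h[OF that] that by auto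
    have eq: "\<Phi> (1 / r t) * U (r t) * (y / h t / \<Phi> (1 / t)) = U (r t) * (y / h t) / low t" for t y
      by (simp add: low_def)
    show "\<forall>\<^sub>F t in at_right 0. \<Phi> (1 / r t) * U (r t) * (tail (h t) (t * 1) / h t / \<Phi> (1 / t))
        \<le> rate (r t) t (h t) / low t"
      using eventually_at_right_less[of 0] unfolding eq
    proof eventually_elim
      case (elim t)
      then show ?case using divide_right_mono[OF b(1) less_imp_le[OF pos(3)]] by simp
    qed
    have tr: "t * (1 - \<epsilon> t) = t - r t" for t by (simp add: r_def algebra_simps)
    show "\<forall>\<^sub>F t in at_right 0. rate (r t) t (h t) / low t \<le> \<Phi> (1 / r t) * U (r t) * (tail (h t) (t * (1 - \<epsilon> t))
        / h t / \<Phi> (1 / t))"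
      using eventually_at_right_less[of 0] unfolding eq tr
    proof eventually_elim
      case (elim t)
      then show ?case using divide_right_mono[OF b(2) less_imp_le[OF pos(3)]] by simp
    qed
  qed
  then show ?thesis by (rule perturbed_limit[OF close])
qed

lemma high_limit:
  assumes rv: "\<And>c. c > 0 \<Longrightarrow> ((\<lambda>u. \<Phi> (c * u) / \<Phi> u) \<longlongrightarrow> c powr \<alpha>) at_top"
    and v: "\<And>p q. 0 < p \<Longrightarrow> p < q \<Longrightarrow> v q * (q - p) \<le> U q - U p \<and> U q - U p \<le> v p * (q - p)"
  shows "((\<lambda>t. prob_ge t (t - r t) / high t) \<longlongrightarrow> 1 / (Gamma \<alpha> * Gamma (2 - \<alpha>))) (at_right 0)"
proof -
  obtain x h where x: "\<And>t. 0 < t \<Longrightarrow> 0 < x t \<and> x t < t - r t \<and> t - r t - t * r t \<le> x t"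
    and h: "\<And>t. 0 < t \<Longrightarrow> 0 < h t \<and> h t * \<Phi> (1 / (t * r t)) \<le> t"
    and close: "\<forall>\<^sub>F t in at_right 0. 0 < high t \<and>
      \<bar>rate t t (h t) - rate (x t) t (h t) - prob_ge t (t - r t)\<bar> \<le> t * high t"
    using high_step by blast
  have hpos: "\<forall>\<^sub>F t in at_right 0. 0 < h t" using eventually_at_right_less[of 0] by eventually_elim (use h in auto)
  have hk: "((\<lambda>t. h t * \<Phi> (real k / r t)) \<longlongrightarrow> 0) (at_right 0)" if "0 < k" for k :: nat
    using small_step_limit[OF r(1) h that] by simp
  \<comment> \<open>The level \<open>x t\<close> lies below \<open>t - r t\<close>, but by so little that \<open>t - x t\<close> is still asymptotic to \<open>r t\<close>.\<close>
  define w where "w = (\<lambda>t. (t - x t) / r t)"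
  have "(w \<longlongrightarrow> 1) (at_right 0)"
  proof (rule tendsto_sandwich)
    show "\<forall>\<^sub>F t in at_right 0. 1 \<le> w t"
      using eventually_at_right_less[of 0]
    proof eventually_elim
      case (elim t)
      show ?case using x[OF elim] r[OF elim] by (simp add: w_def pos_le_divide_eq)
    qed
    show "\<forall>\<^sub>F t in at_right 0. w t \<le> 1 + t"
      using eventually_at_right_less[of 0]
    proof eventually_elim
      case (elim t)
      show ?case using x[OF elim] r[OF elim] by (simp add: w_def pos_divide_le_eq algebra_simps)
    qed
    show "((\<lambda>t::real. 1 + t) \<longlongrightarrow> 1) (at_right 0)" by real_asymp
  qed simp
  from tail_measure_limit_moving[OF rv \<alpha>(2) r_lim hpos hk this]
  have J: "((\<lambda>t. 1 / (r t * \<Phi> (1 / r t)) * J (h t) (r t * w t)) \<longlongrightarrow> 1 / Gamma (2 - \<alpha>)) (at_right 0)" .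
  have "((\<lambda>t. x t / t) \<longlongrightarrow> 1) (at_right 0)"
  proof (rule tendsto_sandwich)
    show "\<forall>\<^sub>F t in at_right 0. 1 - \<epsilon> t - \<epsilon> t * t \<le> x t / t"
      using eventually_at_right_less[of 0]
    proof eventually_elim
      case (elim t)
      have "(1 - \<epsilon> t - \<epsilon> t * t) * t \<le> x t" using x[OF elim] by (simp add: r_def algebra_simps)
      then show ?case using elim by (simp add: pos_le_divide_eq)
    qed
    show "\<forall>\<^sub>F t in at_right 0. x t / t \<le> 1"
      using eventually_at_right_less[of 0]
    proof eventually_elim
      case (elim t)
      then show ?case using x[OF elim] r[OF elim] by simp
    qed
    have "((\<lambda>t. 1 - \<epsilon> t - \<epsilon> t * t) \<longlongrightarrow> 1 - 0 - 0 * 0) (at_right 0)"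
      by (intro tendsto_intros \<epsilon>_lim)
    then show "((\<lambda>t. 1 - \<epsilon> t - \<epsilon> t * t) \<longlongrightarrow> 1) (at_right 0)" by simp
  qed simp
  from potential_density_limit[OF rv \<alpha>(1) id_lim v this]
  have vx: "((\<lambda>t. v (t * (x t / t)) * (t * \<Phi> (1 / t))) \<longlongrightarrow> 1 / Gamma \<alpha>) (at_right 0)" by simp
  from potential_density_limit[OF rv \<alpha>(1) id_lim v tendsto_const]
  have vt: "((\<lambda>t. v (t * 1) * (t * \<Phi> (1 / t))) \<longlongrightarrow> 1 / Gamma \<alpha>) (at_right 0)" by simp
  from tendsto_mult[OF vt J] tendsto_mult[OF vx J]
  have lo: "((\<lambda>t. v (t * 1) * (t * \<Phi> (1 / t)) * (1 / (r t * \<Phi> (1 / r t)) * J (h t) (r t * w t)))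
      \<longlongrightarrow> 1 / (Gamma \<alpha> * Gamma (2 - \<alpha>))) (at_right 0)"
    and hi: "((\<lambda>t. v (t * (x t / t)) * (t * \<Phi> (1 / t)) * (1 / (r t * \<Phi> (1 / r t)) * J (h t) (r t * w t)))
        \<longlongrightarrow> 1 / (Gamma \<alpha> * Gamma (2 - \<alpha>))) (at_right 0)"
    by simp_all
  have "((\<lambda>t. (rate t t (h t) - rate (x t) t (h t)) / high t) \<longlongrightarrow> 1 / (Gamma \<alpha> * Gamma (2 - \<alpha>))) (at_right 0)"
  proof (rule tendsto_sandwich[OF _ _ lo hi])
    have b: "v t * J (h t) (t - x t) \<le> rate t t (h t) - rate (x t) t (h t)"
      "rate t t (h t) - rate (x t) t (h t) \<le> v (x t) * J (h t) (t - x t)" if "0 < t" for t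
      using rate_increment_bounds[of "x t" t "h t" v] x[OF that] h[OF that] r[OF that] v by auto
    have eq: "y * (t * \<Phi> (1 / t)) * (1 / (r t * \<Phi> (1 / r t)) * J (h t) (r t * w t))
        = y * J (h t) (t - x t) / high t" if "0 < t" for t y
      using r[OF that] by (simp add: high_eq[OF that] w_def)
    show "\<forall>\<^sub>F t in at_right 0. v (t * 1) * (t * \<Phi> (1 / t)) * (1 / (r t * \<Phi> (1 / r t)) * J (h t) (r t * w t))
        \<le> (rate t t (h t) - rate (x t) t (h t)) / high t"
      using eventually_at_right_less[of 0]
    proof eventually_elim
      case (elim t)
      show ?case unfolding eq[OF elim] using b[OF elim] pos(4)[OF elim] by (auto intro!: divide_right_mono)
    qed
    show "\<forall>\<^sub>F t in at_right 0. (rate t t (h t) - rate (x t) t (h t)) / high t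
        \<le> v (t * (x t / t)) * (t * \<Phi> (1 / t)) * (1 / (r t * \<Phi> (1 / r t)) * J (h t) (r t * w t))"
      using eventually_at_right_less[of 0]
    proof eventually_elim
      case (elim t)
      have "t * (x t / t) = x t" using elim by simp
      then show ?case unfolding eq[OF elim] using b[OF elim] pos(4)[OF elim] by (auto intro!: divide_right_mono)
    qed
  qed
  then show ?thesis by (rule perturbed_limit[OF close])
qed

lemma obtain_growth:
  fixes \<kappa> \<beta> :: real
  assumes "0 < \<kappa>" "0 < \<beta>"
  obtains K where "1 < K" "144 \<le> \<kappa> * K powr \<beta>"
proof -
  have "\<forall>\<^sub>F K::real in at_top. 1 < K \<and> 144 \<le> \<kappa> * K powr \<beta>"
    using assms by (intro eventually_conj) real_asymp+
  then show thesis using that by (auto dest: eventually_happens simp: trivial_limit_at_top_linorder)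
qed

text \<open>The hypothesis says that \<open>\<Phi>\<close> grows under scaling like a power with exponent \<open>\<alpha>\<close>, up to the factor \<open>\<kappa>\<close>.
  As \<open>\<alpha> < 1\<close>, the lower bound for the tail applies with a large \<open>K\<close>.\<close>

lemma low_order:
  assumes \<kappa>: "0 < \<kappa>" and orv: "\<And>K. 0 < K \<Longrightarrow> \<forall>\<^sub>F u in at_top. \<kappa> * K powr \<alpha> * \<Phi> u \<le> \<Phi> (K * u) \<and> \<kappa> * \<Phi> (K * u)
      \<le> K powr \<alpha> * \<Phi> u"
  shows "\<exists>m n. 0 < m \<and> (\<forall>\<^sub>F t in at_right 0. m * low t \<le> prob_le t (r t) \<and>
    prob_le t (r t) \<le> n * low t)"
proof -
  obtain h where h: "\<And>t. 0 < t \<Longrightarrow> 0 < h t \<and> h t * \<Phi> (1 / (t * r t)) \<le> t"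
    and close: "\<forall>\<^sub>F t in at_right 0. 0 < low t \<and>
      \<bar>rate (r t) t (h t) - prob_le t (r t)\<bar> \<le> t * low t"
    using low_step by blast
  obtain K where K: "1 < K" "144 \<le> \<kappa> * K powr (1 - \<alpha>)" using obtain_growth[OF \<kappa>, of "1 - \<alpha>"] \<alpha> by auto
  have Klim: "filterlim (\<lambda>t. K * t) (at_right 0) (at_right 0)" using K(1) by real_asymp
  have "\<forall>\<^sub>F t in at_right 0. \<kappa> * \<Phi> (K * (1 / (K * t))) \<le> K powr \<alpha> * \<Phi> (1 / (K * t))"
    using eventually_compose_inverse[OF Klim orv[of K]] K by (auto elim: eventually_mono)
  moreover have "\<forall>\<^sub>F t in at_right 0. \<epsilon> t < 1 / 2" using \<epsilon>_lim by (intro order_tendstoD) auto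
  moreover have "\<forall>\<^sub>F t in at_right (0::real). t < 1" by real_asymp
  ultimately have "\<forall>\<^sub>F t in at_right 0. 1 / 12 * (3 / (K - 1)) * low t \<le> rate (r t) t (h t) \<and> rate (r t) t (h t)
      \<le> 18 * low t"
    using eventually_at_right_less[of 0]
  proof eventually_elim
    case (elim t)
    note t = elim(4)
    have rt: "0 < r t" "r t < t" using r[OF t] by auto
    have ht: "0 < h t" using h[OF t] by blast
    have P: "0 < \<Phi> (1 / t)" "0 < \<Phi> (1 / r t)" using pos[OF t] by auto
    have "144 * \<Phi> (1 / t) \<le> K * \<Phi> (1 / (K * t))"
    proof -
      have "144 * \<Phi> (1 / t) \<le> K powr (1 - \<alpha>) * (\<kappa> * \<Phi> (1 / t))"
        using mult_right_mono[OF K(2), of "\<Phi> (1 / t)"] P by (simp add: mult_ac)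
      also have "\<dots> \<le> K powr (1 - \<alpha>) * (K powr \<alpha> * \<Phi> (1 / (K * t)))"
        using elim(1) K t by (intro mult_left_mono) auto
      also have "\<dots> = K * \<Phi> (1 / (K * t))" using K by (simp flip: mult.assoc powr_add)
      finally show ?thesis .
    qed
    moreover have "h t * \<Phi> (1 / (K * t)) \<le> 1"
    proof -
      have "1 / (K * t) \<le> 1 / (t * r t)"
      proof (rule divide_left_mono)
        have "t * r t \<le> t * 1" using rt elim(3) t by (intro mult_left_mono) auto
        also have "\<dots> \<le> K * t" using K t by simp
        finally show "t * r t \<le> K * t" .
      qed (use K t rt in auto)
      then have "\<Phi> (1 / (K * t)) \<le> \<Phi> (1 / (t * r t))" using K t by (intro \<Phi>_mono) auto
      then have "h t * \<Phi> (1 / (K * t)) \<le> h t * \<Phi> (1 / (t * r t))" using ht by (intro mult_left_mono) auto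
      then show ?thesis using h[OF t] elim(3) by linarith
    qed
    ultimately have tl: "3 * \<Phi> (1 / t) / (K - 1) \<le> tail (h t) t / h t" using tail_lower[OF ht t K(1)] by blast
    have "tail (h t) (t - r t) / h t \<le> 3 * \<Phi> (1 / (t - r t))" using rt by (intro tail_upper[OF ht]) simp
    also have "\<dots> \<le> 3 * \<Phi> (2 * (1 / t))"
    proof -
      have "r t \<le> t / 2" using elim(2) t by (simp add: r_def)
      then have "1 / (t - r t) \<le> 2 * (1 / t)" using t rt by (simp add: field_simps)
      then show ?thesis using rt by (intro mult_left_mono \<Phi>_mono) auto
    qed
    also have "\<dots> \<le> 6 * \<Phi> (1 / t)" using \<Phi>_double[of "1 / t"] t by simp
    finally have tu: "tail (h t) (t - r t) / h t \<le> 6 * \<Phi> (1 / t)" .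
    have "1 / 12 * (3 / (K - 1)) * low t = 1 / 12 / \<Phi> (1 / r t) * (3 * \<Phi> (1 / t) / (K - 1))"
      by (simp add: low_def)
    also have "\<dots> \<le> U (r t) * (tail (h t) t / h t)"
      using potential_two_sided(1)[OF rt(1)] tl P K by (intro mult_mono) auto
    also have "\<dots> \<le> rate (r t) t (h t)" using rt by (intro rate_bounds[OF t _ _ ht]) auto
    finally have 1: "1 / 12 * (3 / (K - 1)) * low t \<le> rate (r t) t (h t)" .
    have "rate (r t) t (h t) \<le> U (r t) * (tail (h t) (t - r t) / h t)" using rt
        by (intro rate_bounds[OF t _ _ ht]) auto
    also have "\<dots> \<le> 3 / \<Phi> (1 / r t) * (6 * \<Phi> (1 / t))"
      using potential_two_sided(2)[OF rt(1)] tu P ht by (intro mult_mono) (auto simp: tail_def)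
    also have "\<dots> = 18 * low t" by (simp add: low_def)
    finally show ?case using 1 by simp
  qed
  note order = this
  have "0 < 1 / 12 * (3 / (K - 1))" using K by simp
  from perturbed_order[OF close order this] half_gt_zero[OF this] show ?thesis by blast
qed

text \<open>Here \<open>\<alpha> > 0\<close> makes the lower bound for the potential density applicable with a large \<open>K\<close>.\<close>

lemma high_order:
  assumes \<kappa>: "0 < \<kappa>" and orv: "\<And>K. 0 < K \<Longrightarrow> \<forall>\<^sub>F u in at_top. \<kappa> * K powr \<alpha> * \<Phi> u \<le> \<Phi> (K * u) \<and> \<kappa> * \<Phi> (K * u)
      \<le> K powr \<alpha> * \<Phi> u"
    and v: "\<And>p q. 0 < p \<Longrightarrow> p < q \<Longrightarrow> v q * (q - p) \<le> U q - U p \<and> U q - U p \<le> v p * (q - p)"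
  shows "\<exists>m n. 0 < m \<and> (\<forall>\<^sub>F t in at_right 0. m * high t \<le> prob_ge t (t - r t) \<and>
    prob_ge t (t - r t) \<le> n * high t)"
proof -
  obtain x h where x: "\<And>t. 0 < t \<Longrightarrow> 0 < x t \<and> x t < t - r t \<and> t - r t - t * r t \<le> x t"
    and h: "\<And>t. 0 < t \<Longrightarrow> 0 < h t \<and> h t * \<Phi> (1 / (t * r t)) \<le> t"
    and close: "\<forall>\<^sub>F t in at_right 0. 0 < high t \<and>
      \<bar>rate t t (h t) - rate (x t) t (h t) - prob_ge t (t - r t)\<bar> \<le> t * high t"
    using high_step by blast
  obtain K where K: "1 < K" "144 \<le> \<kappa> * K powr \<alpha>" using obtain_growth[OF \<kappa>, of "\<alpha>"] \<alpha> by auto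
  have Klim: "filterlim (\<lambda>t. K * t) (at_right 0) (at_right 0)" using K(1) by real_asymp
  have "\<forall>\<^sub>F t in at_right 0. \<kappa> * K powr \<alpha> * \<Phi> (1 / (K * t)) \<le> \<Phi> (K * (1 / (K * t)))"
    using eventually_compose_inverse[OF Klim orv[of K]] K by (auto elim: eventually_mono)
  moreover have "\<forall>\<^sub>F t in at_right 0. \<epsilon> t < 1 / 4" using \<epsilon>_lim by (intro order_tendstoD) auto
  moreover have "\<forall>\<^sub>F t in at_right (0::real). t < 1" by real_asymp
  ultimately have "\<forall>\<^sub>F t in at_right 0. 3 / (K - 1) * (1 / 24) * high t \<le> rate t t (h t) - rate (x t) t (h t) \<and>
    rate t t (h t) - rate (x t) t (h t) \<le> 72 * high t"
    using eventually_at_right_less[of 0]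
  proof eventually_elim
    case (elim t)
    note t = elim(4)
    have rt: "0 < r t" "r t < t" using r[OF t] by auto
    have ht: "0 < h t" using h[OF t] by blast
    have P: "0 < \<Phi> (1 / t)" "0 < \<Phi> (1 / r t)" using pos[OF t] by auto
    have tr: "t * r t \<le> r t" using rt elim(3) by simp
    have x1: "0 < x t" "x t < t" "r t \<le> t - x t" "t - x t \<le> 2 * r t" using x[OF t] rt tr by linarith+
    have "r t \<le> t / 4" using elim(2) t by (simp add: r_def)
    then have x2: "t / 2 \<le> x t" using x1 by linarith
    have "72 * \<Phi> (1 / (K * t)) \<le> \<Phi> (1 / t)"
    proof -
      have "72 * \<Phi> (1 / (K * t)) \<le> \<kappa> * K powr \<alpha> * \<Phi> (1 / (K * t))"
        using K t by (intro mult_right_mono \<Phi>_nonneg) auto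
      also have "\<dots> \<le> \<Phi> (1 / t)" using elim(1) K by simp
      finally show ?thesis .
    qed
    then have vl: "3 / ((K - 1) * (t * \<Phi> (1 / t))) \<le> v t" by (rule density_lower[OF t K(1) _ v])
    have "v (x t) \<le> 6 / (x t * \<Phi> (1 / x t))" by (rule density_upper[OF x1(1) v])
    also have "\<dots> \<le> 6 / (t / 2 * \<Phi> (1 / t))"
    proof (rule divide_left_mono)
      have "\<Phi> (1 / t) \<le> \<Phi> (1 / x t)" using x1 t by (intro \<Phi>_mono) (auto intro: divide_left_mono)
      then show "t / 2 * \<Phi> (1 / t) \<le> x t * \<Phi> (1 / x t)" using x2 P t by (intro mult_mono) auto
    qed (use x1 t P \<Phi>_pos[of "1 / x t"] in auto)
    finally have vu: "v (x t) \<le> 12 / (t * \<Phi> (1 / t))" by simp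
    have "h t * \<Phi> (1 / r t) \<le> 1"
    proof -
      have "1 / r t \<le> 1 / (t * r t)" using tr rt t by (intro divide_left_mono) auto
      then have "\<Phi> (1 / r t) \<le> \<Phi> (1 / (t * r t))" using rt by (intro \<Phi>_mono) auto
      then have "h t * \<Phi> (1 / r t) \<le> h t * \<Phi> (1 / (t * r t))" using ht by (intro mult_left_mono) auto
      then show ?thesis using h[OF t] elim(3) by linarith
    qed
    then have "r t * \<Phi> (1 / r t) / 24 \<le> J (h t) (r t)" by (rule tail_measure_lower[OF ht rt(1)])
    also have "\<dots> \<le> J (h t) (t - x t)" by (rule has_laplace_mono[OF tail_measure_laplace[OF ht] x1(3)])
    finally have jl: "r t * \<Phi> (1 / r t) / 24 \<le> J (h t) (t - x t)" .
    have "J (h t) (t - x t) \<le> J (h t) (2 * r t)" by (rule has_laplace_mono[OF tail_measure_laplace[OF ht] x1(4)])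
    also have "\<dots> \<le> 3 * (2 * r t * \<Phi> (1 / (2 * r t)))" using rt by (intro tail_measure_upper[OF ht]) simp
    also have "\<dots> \<le> 3 * (2 * r t * \<Phi> (1 / r t))"
      using rt by (intro mult_left_mono \<Phi>_mono) (auto intro: divide_left_mono)
    finally have ju: "J (h t) (t - x t) \<le> 6 * (r t * \<Phi> (1 / r t))" by simp
    have v0: "0 \<le> v (x t)"
      using v[of "x t" t] has_laplace_mono[OF potential_laplace, of "x t" t] x1
      by (smt (verit) mult_less_0_iff)
    have "3 / (K - 1) * (1 / 24) * high t = 3 / ((K - 1) * (t * \<Phi> (1 / t))) * (r t * \<Phi> (1 / r t) / 24)"
    proof -
      have "3 / a * (1 / 24) * (b / c) = 3 / (a * c) * (b / 24)" for a b c :: real by simp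
      then show ?thesis unfolding high_eq[OF t] .
    qed
    also have "\<dots> \<le> v t * J (h t) (t - x t)"
      using vl jl P K t rt by (intro mult_mono) (auto intro: order_trans[OF _ vl])
    also have "\<dots> \<le> rate t t (h t) - rate (x t) t (h t)"
      using x1 by (intro rate_increment_bounds[OF _ _ ht v]) auto
    finally have 1: "3 / (K - 1) * (1 / 24) * high t \<le> rate t t (h t) - rate (x t) t (h t)" .
    have "rate t t (h t) - rate (x t) t (h t) \<le> v (x t) * J (h t) (t - x t)"
      using x1 by (intro rate_increment_bounds[OF _ _ ht v]) auto
    also have "\<dots> \<le> 12 / (t * \<Phi> (1 / t)) * (6 * (r t * \<Phi> (1 / r t)))"
      using vu ju v0 P t rt by (intro mult_mono) auto
    also have "\<dots> = 72 * high t" by (simp add: high_eq[OF t])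
    finally show ?case using 1 by simp
  qed
  note order = this
  have "0 < 3 / (K - 1) * (1 / 24)" using K by simp
  from perturbed_order[OF close order this] half_gt_zero[OF this] show ?thesis by blast
qed

end

section \<open>Slow variation and the asymptotic formulas\<close>

lemma ennreal_divide_le_iff_le:
  assumes "0 < t" "0 \<le> e"
  shows "z / ennreal t \<le> ennreal e \<longleftrightarrow> z \<le> ennreal (e * t)"
  using assms by (cases z) (auto simp: divide_ennreal ennreal_le_iff pos_divide_le_eq ennreal_top_divide top_unique)

lemma ennreal_le_divide_iff_le:
  assumes "0 < t" "0 \<le> e"
  shows "ennreal e \<le> z / ennreal t \<longleftrightarrow> ennreal (e * t) \<le> z"
  using assms by (cases z) (auto simp: divide_ennreal ennreal_le_iff pos_le_divide_eq ennreal_top_divide)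

lemma slowly_varying_inverse:
  assumes l: "slowly_varying_at_0 l" and c: "0 < c"
  shows "((\<lambda>u. ((c * u) powr \<alpha> * l (1 / (c * u))) / (u powr \<alpha> * l (1 / u))) \<longlongrightarrow> c powr \<alpha>) at_top"
proof -
  have "0 < 1 / c" using c by simp
  then have "((\<lambda>x. l (1 / c * x) / l x) \<longlongrightarrow> 1) (at_right 0)"
    using l unfolding slowly_varying_at_0_def by blast
  moreover have "filterlim (\<lambda>u::real. 1 / u) (at_right 0) at_top" by real_asymp
  ultimately have "((\<lambda>u. l (1 / c * (1 / u)) / l (1 / u)) \<longlongrightarrow> 1) at_top" by (rule filterlim_compose)
  from tendsto_mult[OF tendsto_const[of "c powr \<alpha>"] this]
  have "((\<lambda>u. c powr \<alpha> * (l (1 / c * (1 / u)) / l (1 / u))) \<longlongrightarrow> c powr \<alpha>) at_top" by simp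
  moreover have "\<forall>\<^sub>F u in at_top. c powr \<alpha> * (l (1 / c * (1 / u)) / l (1 / u))
      = ((c * u) powr \<alpha> * l (1 / (c * u))) / (u powr \<alpha> * l (1 / u))"
    using eventually_gt_at_top[of 0] by eventually_elim (use c in \<open>simp add: powr_mult\<close>)
  ultimately show ?thesis by (rule Lim_transform_eventually)
qed

lemma Gamma_reflection_sin:
  fixes \<alpha> :: real
  assumes "0 < \<alpha>" "\<alpha> < 1"
  shows "1 / (Gamma (1 + \<alpha>) * Gamma (1 - \<alpha>)) = sin (pi * \<alpha>) / (pi * \<alpha>)"
proof -
  have "complex_of_real (Gamma \<alpha> * Gamma (1 - \<alpha>)) = complex_of_real (pi / sin (pi * \<alpha>))"
    using Gamma_reflection_complex[of "complex_of_real \<alpha>"]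
    by (simp flip: Gamma_complex_of_real sin_of_real)
  then have "Gamma \<alpha> * Gamma (1 - \<alpha>) = pi / sin (pi * \<alpha>)" by (simp only: of_real_eq_iff)
  moreover have "\<alpha> \<notin> \<int>\<^sub>\<le>\<^sub>0" using assms(1) by (auto elim!: nonpos_Ints_cases)
  then have "Gamma (1 + \<alpha>) = \<alpha> * Gamma \<alpha>" using Gamma_plus1[of "\<alpha>"] by (simp add: add.commute)
  ultimately have "Gamma (1 + \<alpha>) * Gamma (1 - \<alpha>) = \<alpha> * (pi / sin (pi * \<alpha>))"
    by (metis mult.assoc)
  then show ?thesis by simp
qed

lemma special_potential_density:
  assumes "subordinator M \<tau> \<Phi>" and sp: "special_bernstein \<Phi>"
  shows "\<exists>v. \<forall>p q. 0 < p \<longrightarrow> p < q \<longrightarrow>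
     v q * (q - p) \<le> measure (subordinator.potential M \<tau>) {..q} - measure (subordinator.potential M \<tau>) {..p} \<and>
     measure (subordinator.potential M \<tau>) {..q} - measure (subordinator.potential M \<tau>) {..p} \<le> v p * (q - p)"
proof -
  interpret subordinator M \<tau> \<Phi> by fact
  have eq: "(\<lambda>x. x * (1 / \<Phi> x)) = (\<lambda>x. x / \<Phi> x)" by simp
  show ?thesis
    by (rule laplace_monotone_density[OF potential_laplace])
      (use sp in \<open>auto simp: special_bernstein_def bernstein_def\<close>)
qed

text \<open>The constants in \<open>same_order\<close> must be positive and ordered; both follow from positivity of \<open>g\<close> at a
  single point, which exists because the filter is proper.\<close>

lemma same_order_trans_bounds:
  assumes g: "\<forall>\<^sub>F t in F. 0 < g t" and m: "0 < m" and k: "0 < k"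
    and P: "\<forall>\<^sub>F t in F. m * g t \<le> P t \<and> P t \<le> n * g t"
    and Q: "\<forall>\<^sub>F t in F. k * g t \<le> Q t \<and> Q t \<le> k' * g t" and F: "F \<noteq> bot"
  shows "same_order F P Q"
proof -
  have "\<forall>\<^sub>F t in F. 0 < n \<and> 0 < k'"
    using g P Q
  proof eventually_elim
    case (elim t)
    have "0 < m * g t" "0 < k * g t" using elim m k by auto
    then have "0 < n * g t" "0 < k' * g t" using elim by linarith+
    then show ?case using elim by (simp add: zero_less_mult_iff)
  qed
  then have nk: "0 < n" "0 < k'" using F by (auto dest!: eventually_happens)
  have ev: "\<forall>\<^sub>F t in F. k / n * P t \<le> Q t \<and> Q t \<le> k' / m * P t"
    using g P Q
  proof eventually_elim
    case (elim t)
    have "k / n * P t \<le> k / n * (n * g t)" using elim k nk by (intro mult_left_mono) auto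
    also have "\<dots> = k * g t" using nk by simp
    finally have 1: "k / n * P t \<le> Q t" using elim by linarith
    have "k' * g t = k' / m * (m * g t)" using m by simp
    also have "\<dots> \<le> k' / m * P t" using elim m nk by (intro mult_left_mono) auto
    finally show ?case using 1 elim by linarith
  qed
  have "\<forall>\<^sub>F t in F. k / n \<le> k' / m"
    using ev g P
  proof eventually_elim
    case (elim t)
    have "0 < m * g t" using elim m by auto
    then have "0 < P t" using elim by linarith
    moreover have "k / n * P t \<le> k' / m * P t" using elim by linarith
    ultimately show ?case by (simp only: mult_le_cancel_right_pos)
  qed
  then have "k / n \<le> k' / m" using F by (auto dest!: eventually_happens)
  then show ?thesis unfolding same_order_def using ev k nk by (intro exI[of _ "k / n"] exI[of _ "k' / m"]) auto
qed

theorem theorem3p4: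
  fixes M :: "'w measure" and \<tau> :: "real \<Rightarrow> 'w \<Rightarrow> ennreal"
    and \<Phi> l \<epsilon> :: "real \<Rightarrow> real" and \<alpha> :: real
  assumes "prob_space M"
    and "killed_subordinator M \<tau>"
    and "has_laplace_exponent M \<tau> \<Phi>"
    and "\<exists>u>0. \<Phi> u \<noteq> 0"
    and "0 < \<alpha>" and "\<alpha> < 1"
    and "slowly_varying_at_0 l"
    and "\<And>t. 0 < t \<Longrightarrow> 0 < \<epsilon> t \<and> \<epsilon> t < 1"
    and "(\<epsilon> \<longlongrightarrow> 0) (at_right 0)"
  shows
    "(\<Phi> \<sim>[at_top] (\<lambda>u. u powr \<alpha> * l (1 / u)) \<longrightarrow>
        (\<lambda>t. \<P>(\<omega> in M. undershoot \<tau> t \<omega> / ennreal t \<le> ennreal (\<epsilon> t)))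
          \<sim>[at_right 0]
        (\<lambda>t. sin (pi * \<alpha>) / (pi * \<alpha>) * (l t / l (\<epsilon> t * t)) * \<epsilon> t powr \<alpha>) \<and>
        (special_bernstein \<Phi> \<longrightarrow>
          (\<lambda>t. \<P>(\<omega> in M. undershoot \<tau> t \<omega> / ennreal t \<ge> ennreal (1 - \<epsilon> t)))
            \<sim>[at_right 0]
          (\<lambda>t. sin (pi * (1 - \<alpha>)) / (pi * (1 - \<alpha>)) * (l (\<epsilon> t * t) / l t)
                 * \<epsilon> t powr (1 - \<alpha>)))) \<and>
     (same_order at_top \<Phi> (\<lambda>u. u powr \<alpha> * l (1 / u)) \<longrightarrow>
        same_order (at_right 0)
          (\<lambda>t. \<P>(\<omega> in M. undershoot \<tau> t \<omega> / ennreal t \<le> ennreal (\<epsilon> t)))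
          (\<lambda>t. l t / l (\<epsilon> t * t) * \<epsilon> t powr \<alpha>) \<and>
        (special_bernstein \<Phi> \<longrightarrow>
          same_order (at_right 0)
            (\<lambda>t. \<P>(\<omega> in M. undershoot \<tau> t \<omega> / ennreal t \<ge> ennreal (1 - \<epsilon> t)))
            (\<lambda>t. l (\<epsilon> t * t) / l t * \<epsilon> t powr (1 - \<alpha>))))"
proof -
  have sub: "subordinator M \<tau> \<Phi>"
    by (rule killed_subordinator_imp_subordinator[OF assms(2,3,4)])
  interpret subordinator M \<tau> \<Phi> by (rule sub)
  interpret subordinator_undershoot M \<tau> \<Phi> \<epsilon> \<alpha>
    by unfold_locales (use assms(5,6,8,9) in auto)
  define f where "f = (\<lambda>u. u powr \<alpha> * l (1 / u))"
  have lpos: "0 < l x" if "0 < x" for x using assms(7) that by (simp add: slowly_varying_at_0_def)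
  have fpos: "0 < f u" if "0 < u" for u using lpos[of "1 / u"] that by (simp add: f_def)
  have frv: "((\<lambda>u. f (c * u) / f u) \<longlongrightarrow> c powr \<alpha>) at_top" if "0 < c" for c
    using slowly_varying_inverse[OF assms(7) that, of \<alpha>] by (simp add: f_def)
  have ev0: "\<forall>\<^sub>F t in at_right (0::real). 0 < t" by (rule eventually_at_right_less)
  define A where "A = (\<lambda>t. l t / l (\<epsilon> t * t) * \<epsilon> t powr \<alpha>)"
  define B where "B = (\<lambda>t. l (\<epsilon> t * t) / l t * \<epsilon> t powr (1 - \<alpha>))"
  \<comment> \<open>The function \<open>l\<close> enters only through \<open>f\<close> at \<open>1 / t\<close> and \<open>1 / r t\<close>, where \<open>f\<close> is comparable with \<open>\<Phi>\<close>.\<close>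
  have A_eq: "A t = f (1 / t) / f (1 / r t)" if t: "0 < t" for t
    using assms(8)[OF t] t lpos[of t] lpos[of "\<epsilon> t * t"]
    by (simp add: A_def f_def r_def powr_mult powr_divide field_simps)
  have B_eq: "B t = \<epsilon> t / A t" if t: "0 < t" for t
    using assms(8)[OF t] t lpos[of t] lpos[of "\<epsilon> t * t"]
    by (simp add: A_def B_def powr_diff field_simps)
  have A_pos: "0 < A t" if t: "0 < t" for t
    using fpos[of "1 / t"] fpos[of "1 / r t"] r[OF t] t by (simp add: A_eq)
  have high_low: "high t = \<epsilon> t / low t" for t by (simp add: high_def low_def)
  define P where "P = (\<lambda>t. \<P>(\<omega> in M. undershoot \<tau> t \<omega> / ennreal t \<le> ennreal (\<epsilon> t)))"
  define Q where "Q = (\<lambda>t. \<P>(\<omega> in M. undershoot \<tau> t \<omega> / ennreal t \<ge> ennreal (1 - \<epsilon> t)))"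
  have P_eq: "P t = prob_le t (r t)" if "0 < t" for t
    using assms(8)[OF that] that unfolding P_def r_def by (subst ennreal_divide_le_iff_le) auto
  have Q_eq: "Q t = prob_ge t (t - r t)" if "0 < t" for t
  proof -
    have "(1 - \<epsilon> t) * t = t - r t" by (simp add: r_def algebra_simps)
    then show ?thesis using assms(8)[OF that] that unfolding Q_def by (subst ennreal_le_divide_iff_le) auto
  qed
  have density: "\<exists>v. \<forall>p q. 0 < p \<longrightarrow> p < q \<longrightarrow> v q * (q - p) \<le> U q - U p \<and> U q - U p \<le> v p * (q - p)"
    if "special_bernstein \<Phi>" using special_potential_density[OF sub that] .
  have asymp: "P \<sim>[at_right 0] (\<lambda>t. sin (pi * \<alpha>) / (pi * \<alpha>) * A t) \<and>
     (special_bernstein \<Phi> \<longrightarrow> Q \<sim>[at_right 0] (\<lambda>t. sin (pi * (1 - \<alpha>)) / (pi * (1 - \<alpha>)) * B t))"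
    if hyp: "\<Phi> \<sim>[at_top] f"
  proof -
    have "\<forall>\<^sub>F u in at_top. (if \<Phi> u = 0 \<and> f u = 0 then 1 else \<Phi> u / f u) = \<Phi> u / f u"
      using eventually_gt_at_top[of 0] by eventually_elim (use fpos in force)
    with hyp have lim: "((\<lambda>u. \<Phi> u / f u) \<longlongrightarrow> 1) at_top"
      unfolding asymp_equiv_def by (rule Lim_transform_eventually)
    have rv: "((\<lambda>u. \<Phi> (c * u) / \<Phi> u) \<longlongrightarrow> c powr \<alpha>) at_top" if c: "0 < c" for c
    proof -
      have "filterlim (\<lambda>u. c * u) at_top at_top" using c by real_asymp
      from filterlim_compose[OF lim this]
      have "((\<lambda>u. \<Phi> (c * u) / f (c * u)) \<longlongrightarrow> 1) at_top" .
      from tendsto_mult[OF tendsto_mult[OF this frv[OF c]] tendsto_inverse[OF lim]]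
      have "((\<lambda>u. \<Phi> (c * u) / f (c * u) * (f (c * u) / f u) * inverse (\<Phi> u / f u)) \<longlongrightarrow> c powr \<alpha>) at_top" by simp
      moreover have "\<forall>\<^sub>F u in at_top. \<Phi> (c * u) / f (c * u) * (f (c * u) / f u) * inverse (\<Phi> u / f u)
          = \<Phi> (c * u) / \<Phi> u"
        using eventually_gt_at_top[of 0]
      proof eventually_elim
        case (elim u)
        then show ?case using fpos[of u] fpos[of "c * u"] c by simp
      qed
      ultimately show ?thesis by (rule Lim_transform_eventually)
    qed
    have "((\<lambda>t. \<Phi> (1 / t) / f (1 / t) * inverse (\<Phi> (1 / r t) / f (1 / r t))) \<longlongrightarrow> 1 * inverse 1) (at_right 0)"
      by (intro tendsto_mult tendsto_inverse compose_inverse[OF id_lim lim] compose_inverse[OF r_lim lim]) simp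
    moreover have "\<forall>\<^sub>F t in at_right 0. \<Phi> (1 / t) / f (1 / t) * inverse (\<Phi> (1 / r t) / f (1 / r t)) = low t / A t"
      using ev0
    proof eventually_elim
      case (elim t)
      show ?case by (simp add: A_eq[OF elim] low_def)
    qed
    ultimately have lowA: "((\<lambda>t. low t / A t) \<longlongrightarrow> 1) (at_right 0)"
      using Lim_transform_eventually by fastforce
    have sin: "0 < sin (pi * \<beta>) / (pi * \<beta>)" if "0 < \<beta>" "\<beta> < 1" for \<beta>
      using that by (intro divide_pos_pos sin_gt_zero) auto
    define c where "c = sin (pi * \<alpha>) / (pi * \<alpha>)"
    define d where "d = sin (pi * (1 - \<alpha>)) / (pi * (1 - \<alpha>))"
    have c: "c \<noteq> 0" and d: "d \<noteq> 0" using sin[OF \<alpha>] sin[of "1 - \<alpha>"] \<alpha> by (auto simp: c_def d_def)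
    from tendsto_divide[OF tendsto_mult[OF low_limit[OF rv] lowA] tendsto_const[of c] c]
    have "((\<lambda>t. prob_le t (r t) / low t * (low t / A t) / c) \<longlongrightarrow> c * 1 / c) (at_right 0)"
      unfolding Gamma_reflection_sin[OF \<alpha>] c_def[symmetric] .
    moreover have "c * 1 / c = 1" using c by simp
    moreover have "\<forall>\<^sub>F t in at_right 0. prob_le t (r t) / low t * (low t / A t) / c = P t / (c * A t)"
      using ev0
    proof eventually_elim
      case (elim t)
      then show ?case using pos(3)[OF elim] by (simp add: P_eq)
    qed
    ultimately have "((\<lambda>t. P t / (c * A t)) \<longlongrightarrow> 1) (at_right 0)" using Lim_transform_eventually by fastforce
    then have 1: "P \<sim>[at_right 0] (\<lambda>t. c * A t)" by (rule asymp_equivI')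
    have 2: "Q \<sim>[at_right 0] (\<lambda>t. d * B t)" if special: "special_bernstein \<Phi>"
    proof -
      obtain v where v: "\<And>p q. 0 < p \<Longrightarrow> p < q \<Longrightarrow> v q * (q - p) \<le> U q - U p \<and> U q - U p \<le> v p * (q - p)"
        using density[OF special] by blast
      have refl: "1 / (Gamma \<alpha> * Gamma (2 - \<alpha>)) = d"
        using Gamma_reflection_sin[of "1 - \<alpha>"] \<alpha> by (simp add: d_def mult.commute)
      from tendsto_divide[OF tendsto_mult[OF high_limit[OF rv v] tendsto_inverse[OF lowA]] tendsto_const[of d] d]
      have "((\<lambda>t. prob_ge t (t - r t) / high t * inverse (low t / A t) / d) \<longlongrightarrow> d * inverse 1 / d) (at_right 0)"
        unfolding refl by simp
      moreover have "d * inverse 1 / d = 1" using d by simp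
      moreover have "\<forall>\<^sub>F t in at_right 0. prob_ge t (t - r t) / high t * inverse (low t / A t) / d = Q t / (d * B t)"
        using ev0
      proof eventually_elim
        case (elim t)
        have "high t * (low t / A t) = B t" using pos(3)[OF elim] by (simp add: high_low B_eq[OF elim])
        then show ?case by (simp add: Q_eq[OF elim] divide_inverse mult_ac flip: inverse_mult_distrib)
      qed
      ultimately have "((\<lambda>t. Q t / (d * B t)) \<longlongrightarrow> 1) (at_right 0)" using Lim_transform_eventually by fastforce
      then show ?thesis by (rule asymp_equivI')
    qed
    show ?thesis using 1 2 unfolding c_def d_def by blast
  qed
  have order: "same_order (at_right 0) P A \<and> (special_bernstein \<Phi> \<longrightarrow> same_order (at_right 0) Q B)"
    if hyp: "same_order at_top \<Phi> f"
  proof -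
    obtain C1 C2 where C: "0 < C1" "C1 \<le> C2" and bounds: "\<forall>\<^sub>F u in at_top. C1 * \<Phi> u \<le> f u \<and> f u \<le> C2 * \<Phi> u"
      using hyp unfolding same_order_def by blast
    define \<kappa> where "\<kappa> = C1 / (2 * C2)"
    have \<kappa>: "0 < \<kappa>" using C by (simp add: \<kappa>_def)
    have orv: "\<forall>\<^sub>F u in at_top. \<kappa> * K powr \<alpha> * \<Phi> u \<le> \<Phi> (K * u) \<and> \<kappa> * \<Phi> (K * u) \<le> K powr \<alpha> * \<Phi> u" if K: "0 < K" for K
    proof -
      have Kp: "0 < K powr \<alpha>" using K by simp
      have "\<forall>\<^sub>F u in at_top. C1 * \<Phi> (K * u) \<le> f (K * u) \<and> f (K * u) \<le> C2 * \<Phi> (K * u)"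
        by (rule eventually_compose_filterlim[OF bounds]) (use K in real_asymp)
      moreover have "\<forall>\<^sub>F u in at_top. K powr \<alpha> / 2 < f (K * u) / f u" "\<forall>\<^sub>F u in at_top. f (K * u) / f u < 2
          * K powr \<alpha>"
        by (rule order_tendstoD[OF frv[OF K]]; use Kp in simp)+
      ultimately show ?thesis using bounds eventually_gt_at_top[of 0]
      proof eventually_elim
        case (elim u)
        have fu: "0 < f u" using elim(5) by (rule fpos)
        have 1: "K powr \<alpha> / 2 * f u \<le> f (K * u)" using elim(2) fu by (simp add: pos_less_divide_eq less_imp_le)
        have 2: "f (K * u) \<le> 2 * K powr \<alpha> * f u" using elim(3) fu by (simp add: pos_divide_less_eq less_imp_le)
        have "K powr \<alpha> / 2 * (C1 * \<Phi> u) \<le> K powr \<alpha> / 2 * f u" using elim Kp by (intro mult_left_mono) auto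
        then have "K powr \<alpha> / 2 * (C1 * \<Phi> u) \<le> C2 * \<Phi> (K * u)" using 1 elim by linarith
        then have a: "\<kappa> * K powr \<alpha> * \<Phi> u \<le> \<Phi> (K * u)" using C by (simp add: \<kappa>_def field_simps)
        have "2 * K powr \<alpha> * f u \<le> 2 * K powr \<alpha> * (C2 * \<Phi> u)" using elim Kp by (intro mult_left_mono) auto
        then have "C1 * \<Phi> (K * u) \<le> 2 * K powr \<alpha> * (C2 * \<Phi> u)" using 2 elim by linarith
        then have "\<kappa> * \<Phi> (K * u) \<le> K powr \<alpha> * \<Phi> u" using C by (simp add: \<kappa>_def field_simps)
        with a show ?case by blast
      qed
    qed
    have AB: "\<forall>\<^sub>F t in at_right 0. (C1 / C2 * low t \<le> A t \<and> A t \<le> C2 / C1 * low t) \<and>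
        (C1 / C2 * high t \<le> B t \<and> B t \<le> C2 / C1 * high t)"
      using ev0 eventually_compose_inverse[OF id_lim bounds] eventually_compose_inverse[OF r_lim bounds]
    proof eventually_elim
      case (elim t)
      have P: "0 < \<Phi> (1 / t)" "0 < \<Phi> (1 / r t)" "0 < low t" using pos[OF elim(1)] by auto
      have ff: "0 < f (1 / t)" "0 < f (1 / r t)" using fpos r elim(1) by auto
      have C2: "0 < C2" using C by simp
      have "C1 / C2 * low t = C1 * \<Phi> (1 / t) / (C2 * \<Phi> (1 / r t))" by (simp add: low_def)
      also have "\<dots> \<le> f (1 / t) / f (1 / r t)" using elim ff P C by (intro frac_le) auto
      finally have 1: "C1 / C2 * low t \<le> A t" by (simp add: A_eq[OF elim(1)])
      have "f (1 / t) / f (1 / r t) \<le> C2 * \<Phi> (1 / t) / (C1 * \<Phi> (1 / r t))" using elim ff P C by (intro frac_le) auto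
      also have "\<dots> = C2 / C1 * low t" by (simp add: low_def)
      finally have 2: "A t \<le> C2 / C1 * low t" by (simp add: A_eq[OF elim(1)])
      have e: "0 < \<epsilon> t" using assms(8) elim(1) by blast
      have Ap: "0 < A t" by (rule A_pos[OF elim(1)])
      have "C1 / C2 * high t = \<epsilon> t / (C2 / C1 * low t)" by (simp add: high_low)
      also have "\<dots> \<le> \<epsilon> t / A t" using 2 Ap e P C C2 by (intro divide_left_mono) auto
      finally have 3: "C1 / C2 * high t \<le> B t" by (simp add: B_eq[OF elim(1)])
      have "\<epsilon> t / A t \<le> \<epsilon> t / (C1 / C2 * low t)" using 1 Ap e P C C2 by (intro divide_left_mono) auto
      also have "\<dots> = C2 / C1 * high t" by (simp add: high_low)
      finally have 4: "B t \<le> C2 / C1 * high t" by (simp add: B_eq[OF elim(1)])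
      show ?case using 1 2 3 4 by blast
    qed
    have C12: "0 < C1 / C2" using C by simp
    obtain m n where m: "0 < m" and "\<forall>\<^sub>F t in at_right 0. m * low t \<le> prob_le t (r t) \<and>
        prob_le t (r t) \<le> n * low t"
      using low_order[OF \<kappa> orv] by blast
    from ev0 this(2) have Pb: "\<forall>\<^sub>F t in at_right 0. m * low t \<le> P t \<and> P t \<le> n * low t"
      by eventually_elim (simp add: P_eq)
    have lowpos: "\<forall>\<^sub>F t in at_right 0. 0 < low t" "\<forall>\<^sub>F t in at_right 0. 0 < high t"
      using ev0 by (auto elim!: eventually_mono dest: pos)
    have 1: "same_order (at_right 0) P A"
      by (rule same_order_trans_bounds[OF lowpos(1) m C12 Pb, of _ "C2 / C1"])
        (use AB in \<open>auto elim: eventually_mono\<close>)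
    have 2: "same_order (at_right 0) Q B" if special: "special_bernstein \<Phi>"
    proof -
      obtain v where v: "\<And>p q. 0 < p \<Longrightarrow> p < q \<Longrightarrow> v q * (q - p) \<le> U q - U p \<and> U q - U p \<le> v p * (q - p)"
        using density[OF special] by blast
      obtain m n where m: "0 < m" and "\<forall>\<^sub>F t in at_right 0. m * high t \<le> prob_ge t (t - r t) \<and>
          prob_ge t (t - r t) \<le> n * high t"
        using high_order[OF \<kappa> orv v] by blast
      from ev0 this(2) have Qb: "\<forall>\<^sub>F t in at_right 0. m * high t \<le> Q t \<and> Q t \<le> n * high t"
        by eventually_elim (simp add: Q_eq)
      show ?thesis
        by (rule same_order_trans_bounds[OF lowpos(2) m C12 Qb, of _ "C2 / C1"])
          (use AB in \<open>auto elim: eventually_mono\<close>)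
    qed
    show ?thesis using 1 2 by blast
  qed
  show ?thesis
    using asymp order unfolding P_def Q_def A_def B_def f_def by (simp only: mult.assoc) blast
qed

end
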